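(* Let $q$ be an odd prime power, $k=\mathbb F_q$, let $n\ge 1$ and $j\ge 0$ be integers, and let $L/k$ be the field extension of $\mathbb F_q$ of degree $n$. Then \[ \binom{L/k}{j} = \binom{n}{j} - (1 -u)\cdot \binom{\frac{n-2}{2}}{\frac{j-1}{2}} \in \mathrm{GW}(\mathbb F_q), \] where integers $m$ are viewed in $\mathrm{GW}(\mathbb F_q)$ as $m\cdot 1$.
   Context: $\mathrm{GW}(k)$ is the Grothendieck–Witt group of $k$ (group completion of isomorphism classes of non-degenerate symmetric bilinear forms, a ring under tensor product); $1$ is the class of $(x,y)\mapsto xy$ on $k$, and $u$ is the class of $(x,y)\mapsto \mu xy$ on $k$ with $\mu\in\mathbb F_q^*$ a non-square. Fix a separable closure $k^s$ of $k$; $\mathrm{Emb}_k(L,k^s)$ is the set of $k$-embeddings $L\to k^s$, and $\mathrm{Emb}^j_k(L,k^s)$ is the set of $j$-element subsets of it, with the $\mathrm{Gal}(k^s/k)$-action induced by composition. $\binom{L/k}{j}\in\mathrm{GW}(k)$ is the class of the trace form $(x,y)\mapsto \mathrm{Tr}_{E/k}(xy)$ of the finite étale $k$-algebra $E$ corresponding, under the Galois correspondence between finite étale $k$-algebras and finite $\mathrm{Gal}(k^s/k)$-sets, to $\mathrm{Emb}^j_k(L,k^s)$. Convention: $\binom{a}{b}:=0$ if $a$ or $b$ is not an integer; as usual $\binom{a}{b}=0$ for integers $b<0$ or $b>a\ge 0$. *)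

theory Defs
  imports
    "HOL-Computational_Algebra.Computational_Algebra"
    "HOL-Library.Function_Algebras"
    "HOL-Number_Theory.Prime_Powers"
begin

section \<open>Symmetric bilinear forms\<close>

text \<open>A vector space over a field is given by a scalar multiplication \<open>s\<close> on an abelian group
  together with a carrier \<open>V\<close>, a subspace of that group.\<close>

definition symmetric_bilinear ::
    "('k::field \<Rightarrow> 'v::ab_group_add \<Rightarrow> 'v) \<Rightarrow> 'v set \<Rightarrow> ('v \<Rightarrow> 'v \<Rightarrow> 'k) \<Rightarrow> bool"
  where "symmetric_bilinear s V b \<longleftrightarrow>
    (\<forall>x\<in>V. \<forall>y\<in>V. b x y = b y x) \<and>
    (\<forall>x\<in>V. \<forall>y\<in>V. \<forall>z\<in>V. b (x + y) z = b x z + b y z) \<and>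
    (\<forall>c. \<forall>x\<in>V. \<forall>y\<in>V. b (s c x) y = c * b x y)"

definition nondegenerate :: "'v set \<Rightarrow> ('v::ab_group_add \<Rightarrow> 'v \<Rightarrow> 'k::field) \<Rightarrow> bool"
  where "nondegenerate V b \<longleftrightarrow> (\<forall>x\<in>V. (\<forall>y\<in>V. b x y = 0) \<longrightarrow> x = 0)"

definition isometry ::
    "('k::field \<Rightarrow> 'v::ab_group_add \<Rightarrow> 'v) \<Rightarrow> 'v set \<Rightarrow> ('v \<Rightarrow> 'v \<Rightarrow> 'k) \<Rightarrow>
     ('k \<Rightarrow> 'w::ab_group_add \<Rightarrow> 'w) \<Rightarrow> 'w set \<Rightarrow> ('w \<Rightarrow> 'w \<Rightarrow> 'k) \<Rightarrow> ('v \<Rightarrow> 'w) \<Rightarrow> bool"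
  where "isometry s V b t W c \<phi> \<longleftrightarrow>
    bij_betw \<phi> V W \<and>
    (\<forall>x\<in>V. \<forall>y\<in>V. \<phi> (x + y) = \<phi> x + \<phi> y) \<and>
    (\<forall>a. \<forall>x\<in>V. \<phi> (s a x) = t a (\<phi> x)) \<and>
    (\<forall>x\<in>V. \<forall>y\<in>V. c (\<phi> x) (\<phi> y) = b x y)"

definition isometric ::
    "('k::field \<Rightarrow> 'v::ab_group_add \<Rightarrow> 'v) \<Rightarrow> 'v set \<Rightarrow> ('v \<Rightarrow> 'v \<Rightarrow> 'k) \<Rightarrow>
     ('k \<Rightarrow> 'w::ab_group_add \<Rightarrow> 'w) \<Rightarrow> 'w set \<Rightarrow> ('w \<Rightarrow> 'w \<Rightarrow> 'k) \<Rightarrow> bool"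
  where "isometric s V b t W c \<longleftrightarrow> (\<exists>\<phi>. isometry s V b t W c \<phi>)"

lemma symmetric_bilinearD:
  assumes "symmetric_bilinear s V b"
  shows "x \<in> V \<Longrightarrow> y \<in> V \<Longrightarrow> b x y = b y x"
    and "x \<in> V \<Longrightarrow> y \<in> V \<Longrightarrow> z \<in> V \<Longrightarrow> b (x + y) z = b x z + b y z"
    and "x \<in> V \<Longrightarrow> y \<in> V \<Longrightarrow> b (s c x) y = c * b x y"
  using assms unfolding symmetric_bilinear_def by blast+

lemma isometryD:
  assumes "isometry s V b t W c f"
  shows "bij_betw f V W"
    and "x \<in> V \<Longrightarrow> y \<in> V \<Longrightarrow> f (x + y) = f x + f y"
    and "x \<in> V \<Longrightarrow> f (s a x) = t a (f x)"
    and "x \<in> V \<Longrightarrow> y \<in> V \<Longrightarrow> c (f x) (f y) = b x y"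
  using assms unfolding isometry_def by blast+

lemma isometric_trans:
  assumes "isometric s V b t W c" "isometric t W c r X d"
  shows "isometric s V b r X d"
proof -
  obtain f g where f: "isometry s V b t W c f" and g: "isometry t W c r X d g"
    using assms unfolding isometric_def by blast
  have fW: "f x \<in> W" if "x \<in> V" for x
    using f that unfolding isometry_def by (auto dest: bij_betwE)
  have "isometry s V b r X d (g \<circ> f)"
    unfolding isometry_def
  proof (intro conjI)
    show "bij_betw (g \<circ> f) V X"
      using f g unfolding isometry_def by (blast intro: bij_betw_trans)
  qed (use f g fW in \<open>auto simp: isometry_def\<close>)
  thus ?thesis
    unfolding isometric_def by blast
qed

text \<open>Closure of \<open>V\<close> under the operations is what makes the inverse of an isometry linear.\<close>

lemma isometric_sym:
  assumes "isometric s V b t W c"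
    and "\<And>x y. x \<in> V \<Longrightarrow> y \<in> V \<Longrightarrow> x + y \<in> V" "\<And>a x. x \<in> V \<Longrightarrow> s a x \<in> V"
  shows "isometric t W c s V b"
proof -
  obtain f where f: "isometry s V b t W c f"
    using assms(1) unfolding isometric_def by blast
  define g where "g = inv_into V f"
  have bij: "bij_betw f V W"
    using f unfolding isometry_def by blast
  have gf: "g (f x) = x" if "x \<in> V" for x
    using bij that unfolding g_def by (simp add: bij_betw_inv_into_left)
  have ex: "\<exists>x\<in>V. y = f x" if "y \<in> W" for y
    using bij that unfolding bij_betw_def by auto
  have "isometry t W c s V b g"
    unfolding isometry_def
  proof (intro conjI ballI allI)
    show "bij_betw g W V"
      unfolding g_def by (rule bij_betw_inv_into[OF bij])
  next
    fix x y assume "x \<in> W" "y \<in> W"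
    then obtain x' y' where *: "x' \<in> V" "y' \<in> V" "x = f x'" "y = f y'"
      using ex by blast
    have "f (x' + y') = x + y"
      using f * unfolding isometry_def by auto
    thus "g (x + y) = g x + g y"
      using gf[of "x' + y'"] assms(2) gf * by auto
    show "b (g x) (g y) = c x y"
      using f gf * unfolding isometry_def by auto
  next
    fix a x assume "x \<in> W"
    then obtain x' where *: "x' \<in> V" "x = f x'"
      using ex by blast
    have "f (s a x') = t a x"
      using f * unfolding isometry_def by auto
    thus "g (t a x) = s a (g x)"
      using gf[of "s a x'"] assms(3) gf * by auto
  qed
  thus ?thesis
    unfolding isometric_def by blast
qed


section \<open>Forms on coordinate spaces\<close>

text \<open>The space \<open>k\<^sup>n\<close> is the set of sequences supported on \<open>{..<n}\<close>.\<close>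

definition coord_scale :: "'k::field \<Rightarrow> (nat \<Rightarrow> 'k) \<Rightarrow> nat \<Rightarrow> 'k"
  where "coord_scale c x = (\<lambda>i. c * x i)"

definition coord_space :: "nat \<Rightarrow> (nat \<Rightarrow> 'k::field) set"
  where "coord_space n = {x. \<forall>i\<ge>n. x i = 0}"

definition std_vec :: "nat \<Rightarrow> nat \<Rightarrow> 'k::field"
  where "std_vec i = (\<lambda>l. if l = i then 1 else 0)"

type_synonym 'k coord_form = "nat \<times> ((nat \<Rightarrow> 'k) \<Rightarrow> (nat \<Rightarrow> 'k) \<Rightarrow> 'k)"

definition nondeg_form :: "'k::field coord_form \<Rightarrow> bool"
  where "nondeg_form F \<longleftrightarrow>
    symmetric_bilinear coord_scale (coord_space (fst F)) (snd F) \<and>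
    nondegenerate (coord_space (fst F)) (snd F)"

definition form_rel :: "'k::field coord_form \<Rightarrow> 'k coord_form \<Rightarrow> bool"
  where "form_rel F G \<longleftrightarrow> nondeg_form F \<and> nondeg_form G \<and>
    isometric coord_scale (coord_space (fst F)) (snd F) coord_scale (coord_space (fst G)) (snd G)"

definition matrix_form :: "nat \<Rightarrow> (nat \<Rightarrow> nat \<Rightarrow> 'k::field) \<Rightarrow> (nat \<Rightarrow> 'k) \<Rightarrow> (nat \<Rightarrow> 'k) \<Rightarrow> 'k"
  where "matrix_form n A x y = (\<Sum>i<n. \<Sum>j<n. x i * A i j * y j)"

definition trunc_vec :: "nat \<Rightarrow> (nat \<Rightarrow> 'k::field) \<Rightarrow> nat \<Rightarrow> 'k"
  where "trunc_vec n x = (\<lambda>i. if i < n then x i else 0)"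

definition shift_vec :: "nat \<Rightarrow> (nat \<Rightarrow> 'k::field) \<Rightarrow> nat \<Rightarrow> 'k"
  where "shift_vec n x = (\<lambda>i. x (n + i))"

fun orth_sum :: "'k::field coord_form \<Rightarrow> 'k coord_form \<Rightarrow> 'k coord_form"
  where "orth_sum (n, b) (m, c) = (n + m, \<lambda>x y.
    b (trunc_vec n x) (trunc_vec n y) + c (shift_vec n x) (shift_vec n y))"

text \<open>In the tensor product \<open>k\<^sup>n \<otimes> k\<^sup>m = k\<^sup>n\<^sup>m\<close>, the standard vector
  with index \<open>i * m + j\<close> (\<open>i < n\<close>, \<open>j < m\<close>) is the pure tensor of the standard vectors with
  indices \<open>i\<close> and \<open>j\<close>; the tensor product of forms is determined by its values on these.\<close>

fun tensor_form :: "'k::field coord_form \<Rightarrow> 'k coord_form \<Rightarrow> 'k coord_form"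
  where "tensor_form (n, b) (m, c) = (n * m, matrix_form (n * m) (\<lambda>p q.
    b (std_vec (p div m)) (std_vec (q div m)) * c (std_vec (p mod m)) (std_vec (q mod m))))"

lemma coord_space_closed [simp]:
  "x \<in> coord_space n \<Longrightarrow> y \<in> coord_space n \<Longrightarrow> x + y \<in> coord_space n"
  "x \<in> coord_space n \<Longrightarrow> coord_scale c x \<in> coord_space n"
  "0 \<in> coord_space n" "i < n \<Longrightarrow> std_vec i \<in> coord_space n"
  by (auto simp: coord_space_def coord_scale_def std_vec_def)

lemma isometric_coord_sym:
  "isometric coord_scale (coord_space n) b coord_scale (coord_space m) c \<Longrightarrow>
   isometric coord_scale (coord_space m) c coord_scale (coord_space n) b"
  by (erule isometric_sym) auto

lemma form_rel_refl: "form_rel F F \<longleftrightarrow> nondeg_form F"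
  unfolding form_rel_def isometric_def
  by (auto simp: isometry_def intro!: exI[of _ id])

lemma form_rel_sym: "form_rel F G \<Longrightarrow> form_rel G F"
  unfolding form_rel_def using isometric_coord_sym by blast

lemma form_rel_trans: "form_rel F G \<Longrightarrow> form_rel G H \<Longrightarrow> form_rel F H"
  unfolding form_rel_def using isometric_trans by blast

lemma matrix_form_std_vec:
  assumes "i < n" "j < n"
  shows "matrix_form n A (std_vec i) (std_vec j) = A i j"
proof -
  have "matrix_form n A (std_vec i) (std_vec j) =
      (\<Sum>p<n. \<Sum>q<n. if p = i \<and> q = j then A p q else 0)"
    unfolding matrix_form_def std_vec_def by (intro sum.cong) auto
  also have "\<dots> = (\<Sum>p<n. if p = i then (\<Sum>q<n. if q = j then A p q else 0) else 0)"
    by (intro sum.cong) auto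
  also have "\<dots> = A i j"
    using assms by simp
  finally show ?thesis .
qed

lemma symmetric_bilinear_matrix_form:
  assumes "\<And>i j. i < n \<Longrightarrow> j < n \<Longrightarrow> A i j = A j i"
  shows "symmetric_bilinear coord_scale V (matrix_form n A)"
  unfolding symmetric_bilinear_def
proof (intro conjI ballI allI)
  fix x y z :: "nat \<Rightarrow> 'a" and c
  show "matrix_form n A x y = matrix_form n A y x"
    unfolding matrix_form_def
    by (subst sum.swap) (intro sum.cong refl, use assms in \<open>auto simp: mult_ac\<close>)
  show "matrix_form n A (x + y) z = matrix_form n A x z + matrix_form n A y z"
    by (simp add: matrix_form_def algebra_simps sum.distrib)
  show "matrix_form n A (coord_scale c x) y = c * matrix_form n A x y"
    by (simp add: matrix_form_def coord_scale_def sum_distrib_left mult_ac)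
qed

lemma coord_expand:
  assumes "x \<in> coord_space n"
  shows "x = (\<Sum>i<n. coord_scale (x i) (std_vec i))"
proof
  fix l
  have app: "(\<Sum>i\<in>I. f i) l = (\<Sum>i\<in>I. f i l)" if "finite I" for I and f :: "nat \<Rightarrow> nat \<Rightarrow> 'a"
    using that by (induction I rule: finite_induct) auto
  have "(\<Sum>i<n. coord_scale (x i) (std_vec i)) l = (\<Sum>i<n. if l = i then x i else 0)"
    unfolding app[OF finite_lessThan] by (intro sum.cong) (auto simp: coord_scale_def std_vec_def)
  also have "\<dots> = x l"
    using assms by (auto simp: coord_space_def)
  finally show "x l = (\<Sum>i<n. coord_scale (x i) (std_vec i)) l" ..
qed

lemma form_sum_left:
  assumes "symmetric_bilinear coord_scale (coord_space n) b"
    and "finite I" "\<And>i. i \<in> I \<Longrightarrow> f i \<in> coord_space n" "y \<in> coord_space n"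
  shows "(\<Sum>i\<in>I. f i) \<in> coord_space n \<and> b (\<Sum>i\<in>I. f i) y = (\<Sum>i\<in>I. b (f i) y)"
  using assms(2,3)
proof (induction I rule: finite_induct)
  case empty
  have "b (coord_scale 0 0) y = 0 * b 0 y"
    using assms(4) by (intro symmetric_bilinearD(3)[OF assms(1)]) auto
  moreover have "coord_scale 0 0 = (0 :: nat \<Rightarrow> 'a)"
    by (auto simp: coord_scale_def)
  ultimately have "b 0 y = 0" by simp
  thus ?case
    unfolding sum.empty using coord_space_closed(3) by blast
next
  case (insert i I)
  have *: "f i \<in> coord_space n" "(\<Sum>i\<in>I. f i) \<in> coord_space n"
      "b (\<Sum>i\<in>I. f i) y = (\<Sum>i\<in>I. b (f i) y)"
    using insert by auto
  show ?case
    unfolding sum.insert[OF insert.hyps]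
    using coord_space_closed(1)[OF *(1,2)] symmetric_bilinearD(2)[OF assms(1) *(1,2) assms(4)] *(3)
    by metis
qed

lemma form_expand:
  assumes "symmetric_bilinear coord_scale (coord_space n) b"
    and "x \<in> coord_space n" "y \<in> coord_space n"
  shows "b x y = matrix_form n (\<lambda>i j. b (std_vec i) (std_vec j)) x y"
proof -
  have left: "b z w = (\<Sum>i<n. z i * b (std_vec i) w)"
    if z: "z \<in> coord_space n" and w: "w \<in> coord_space n" for z w
  proof -
    have "b z w = b (\<Sum>i<n. coord_scale (z i) (std_vec i)) w"
      using coord_expand[OF z] by simp
    also have "\<dots> = (\<Sum>i<n. b (coord_scale (z i) (std_vec i)) w)"
      using form_sum_left[OF assms(1), of "{..<n}"] w by simp
    also have "\<dots> = (\<Sum>i<n. z i * b (std_vec i) w)"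
      using assms(1) w unfolding symmetric_bilinear_def by (intro sum.cong) auto
    finally show ?thesis .
  qed
  have comm: "b z w = b w z" if "z \<in> coord_space n" "w \<in> coord_space n" for z w
    using assms(1) that unfolding symmetric_bilinear_def by blast
  have "b x y = (\<Sum>i<n. x i * b y (std_vec i))"
    unfolding left[OF assms(2,3)]
    by (intro sum.cong refl arg_cong2[where f = "(*)"] comm) (use assms(3) in auto)
  also have "\<dots> = (\<Sum>i<n. x i * (\<Sum>j<n. y j * b (std_vec j) (std_vec i)))"
    using left assms(2,3) by (intro sum.cong) auto
  also have "\<dots> = (\<Sum>i<n. x i * (\<Sum>j<n. y j * b (std_vec i) (std_vec j)))"
    by (intro sum.cong refl arg_cong2[where f = "(*)"] comm) auto
  also have "\<dots> = matrix_form n (\<lambda>i j. b (std_vec i) (std_vec j)) x y"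
    by (simp add: matrix_form_def sum_distrib_left mult_ac)
  finally show ?thesis .
qed

lemma form_relI_gram:
  assumes F: "nondeg_form (n, b)" and G: "nondeg_form (n, c)" and \<pi>: "bij_betw \<pi> {..<n} {..<n}"
    and gram: "\<And>i j. i < n \<Longrightarrow> j < n \<Longrightarrow>
      c (std_vec i) (std_vec j) = b (std_vec (\<pi> i)) (std_vec (\<pi> j))"
  shows "form_rel (n, b) (n, c)"
proof -
  define \<rho> where "\<rho> = inv_into {..<n} \<pi>"
  have \<rho>: "bij_betw \<rho> {..<n} {..<n}"
    unfolding \<rho>_def by (rule bij_betw_inv_into[OF \<pi>])
  have \<rho>\<pi>: "\<rho> (\<pi> i) = i" "\<pi> (\<rho> i) = i" if "i < n" for i
    using \<pi> that unfolding \<rho>_def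
    by (simp_all add: bij_betw_inv_into_left bij_betw_inv_into_right)
  have less: "\<pi> i < n" "\<rho> i < n" if "i < n" for i
    using that bij_betwE[OF \<pi>] bij_betwE[OF \<rho>] by auto
  define f :: "(nat \<Rightarrow> 'a) \<Rightarrow> nat \<Rightarrow> 'a"
    where "f x = (\<lambda>l. if l < n then x (\<pi> l) else 0)" for x
  define g :: "(nat \<Rightarrow> 'a) \<Rightarrow> nat \<Rightarrow> 'a"
    where "g x = (\<lambda>l. if l < n then x (\<rho> l) else 0)" for x
  have mem: "f x \<in> coord_space n" "g x \<in> coord_space n" for x
    by (auto simp: f_def g_def coord_space_def)
  have "isometry coord_scale (coord_space n) b coord_scale (coord_space n) c f"
    unfolding isometry_def
  proof (intro conjI ballI allI)
    show "bij_betw f (coord_space n) (coord_space n)"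
      by (rule bij_betw_byWitness[of _ g])
        (use mem less \<rho>\<pi> in \<open>auto simp: f_def g_def coord_space_def fun_eq_iff\<close>)
  next
    fix x y :: "nat \<Rightarrow> 'a" assume xy: "x \<in> coord_space n" "y \<in> coord_space n"
    have "c (f x) (f y) = matrix_form n (\<lambda>i j. c (std_vec i) (std_vec j)) (f x) (f y)"
      using form_expand[of n c] G mem by (simp add: nondeg_form_def)
    also have "\<dots> = (\<Sum>i<n. \<Sum>j<n. x (\<pi> i) * b (std_vec (\<pi> i)) (std_vec (\<pi> j)) * y (\<pi> j))"
      unfolding matrix_form_def by (intro sum.cong refl) (auto simp: f_def gram)
    also have "\<dots> = (\<Sum>i<n. \<Sum>j<n. x (\<pi> i) * b (std_vec (\<pi> i)) (std_vec j) * y j)"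
      by (intro sum.cong refl sum.reindex_bij_betw[OF \<pi>])
    also have "\<dots> = (\<Sum>i<n. \<Sum>j<n. x i * b (std_vec i) (std_vec j) * y j)"
      by (rule sum.reindex_bij_betw[OF \<pi>])
    also have "\<dots> = b x y"
      using form_expand[of n b] F xy by (simp add: nondeg_form_def matrix_form_def)
    finally show "c (f x) (f y) = b x y" .
  qed (auto simp: f_def coord_scale_def)
  with F G show ?thesis
    unfolding form_rel_def isometric_def by auto
qed

lemma form_relI_gram_id:
  assumes "nondeg_form (n, b)" "nondeg_form (n, c)"
    and "\<And>i j. i < n \<Longrightarrow> j < n \<Longrightarrow>
      c (std_vec i) (std_vec j) = b (std_vec i) (std_vec j)"
  shows "form_rel (n, b) (n, c)"
  using form_relI_gram[OF assms(1,2), of id] assms(3) by simp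


subsection \<open>Orthogonal sums\<close>

definition join_vec :: "nat \<Rightarrow> (nat \<Rightarrow> 'k::field) \<Rightarrow> (nat \<Rightarrow> 'k) \<Rightarrow> nat \<Rightarrow> 'k"
  where "join_vec n x y = (\<lambda>i. if i < n then x i else y (i - n))"

lemma trunc_shift_mem:
  "trunc_vec n x \<in> coord_space n"
  "x \<in> coord_space (n + m) \<Longrightarrow> shift_vec n x \<in> coord_space m"
  by (auto simp: coord_space_def trunc_vec_def shift_vec_def)

lemma join_vec_mem:
  "y \<in> coord_space m \<Longrightarrow> join_vec n x y \<in> coord_space (n + m)"
  by (auto simp: coord_space_def join_vec_def)

lemma join_vec_simps:
  "x \<in> coord_space n \<Longrightarrow> trunc_vec n (join_vec n x y) = x"
  "shift_vec n (join_vec n x y) = y"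
  "join_vec n (trunc_vec n x) (shift_vec n x) = x"
  by (auto simp: coord_space_def join_vec_def trunc_vec_def shift_vec_def)

lemma join_vec_zero: "join_vec n 0 0 = 0"
  by (auto simp: join_vec_def)

lemma trunc_shift_linear:
  "trunc_vec n (x + y) = trunc_vec n x + trunc_vec n y"
  "shift_vec n (x + y) = shift_vec n x + shift_vec n y"
  "trunc_vec n (coord_scale a x) = coord_scale a (trunc_vec n x)"
  "shift_vec n (coord_scale a x) = coord_scale a (shift_vec n x)"
  by (auto simp: coord_scale_def trunc_vec_def shift_vec_def)

lemma form_zero:
  assumes "symmetric_bilinear coord_scale (coord_space n) b" "x \<in> coord_space n"
  shows "b 0 x = 0" "b x 0 = 0"
proof -
  show "b 0 x = 0"
    using form_sum_left[OF assms(1), of "{}" "\<lambda>_. 0" x] assms(2) by simp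
  thus "b x 0 = 0"
    using assms unfolding symmetric_bilinear_def by (metis coord_space_closed(3))
qed

lemma nondeg_form_orth_sum:
  assumes "nondeg_form F" "nondeg_form G"
  shows "nondeg_form (orth_sum F G)"
proof -
  obtain n b m c where FG: "F = (n, b)" "G = (m, c)"
    by (metis surj_pair)
  have b: "symmetric_bilinear coord_scale (coord_space n) b" "nondegenerate (coord_space n) b"
    and c: "symmetric_bilinear coord_scale (coord_space m) c" "nondegenerate (coord_space m) c"
    using assms unfolding nondeg_form_def FG by auto
  let ?d = "\<lambda>x y. b (trunc_vec n x) (trunc_vec n y) + c (shift_vec n x) (shift_vec n y)"
  have "symmetric_bilinear coord_scale (coord_space (n + m)) ?d"
    unfolding symmetric_bilinear_def
  proof (intro conjI ballI allI)
    fix x y z :: "nat \<Rightarrow> 'a" and a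
    assume x: "x \<in> coord_space (n + m)" and y: "y \<in> coord_space (n + m)"
    note mem = trunc_shift_mem(2)[OF x] trunc_shift_mem(2)[OF y]
    note b' = symmetric_bilinearD[OF b(1) trunc_shift_mem(1) trunc_shift_mem(1)]
    show "?d x y = ?d y x"
      using b'(1) symmetric_bilinearD(1)[OF c(1) mem] by metis
    show "?d (coord_scale a x) y = a * ?d x y"
      unfolding trunc_shift_linear b'(3) symmetric_bilinearD(3)[OF c(1) mem]
      by (simp add: algebra_simps)
    assume z: "z \<in> coord_space (n + m)"
    show "?d (x + y) z = ?d x z + ?d y z"
      unfolding trunc_shift_linear b'(2)[OF trunc_shift_mem(1)]
        symmetric_bilinearD(2)[OF c(1) mem trunc_shift_mem(2)[OF z]]
      by (simp add: algebra_simps)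
  qed
  moreover have "nondegenerate (coord_space (n + m)) ?d"
    unfolding nondegenerate_def
  proof (intro ballI impI)
    fix x :: "nat \<Rightarrow> 'a"
    assume x: "x \<in> coord_space (n + m)" and 0: "\<forall>y\<in>coord_space (n + m). ?d x y = 0"
    have "b (trunc_vec n x) y = 0" if "y \<in> coord_space n" for y
      using bspec[OF 0 join_vec_mem[of 0 m n y]] that
      unfolding join_vec_simps(1)[OF that] join_vec_simps(2)
      using form_zero(2)[OF c(1) trunc_shift_mem(2)[OF x]] by simp
    hence "trunc_vec n x = 0"
      using b(2) trunc_shift_mem(1) unfolding nondegenerate_def by blast
    moreover have "c (shift_vec n x) y = 0" if "y \<in> coord_space m" for y
      using bspec[OF 0 join_vec_mem[of y m n 0]] that
      unfolding join_vec_simps(1)[OF coord_space_closed(3)] join_vec_simps(2)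
      using form_zero(2)[OF b(1) trunc_shift_mem(1)] by simp
    hence "shift_vec n x = 0"
      using c(2) trunc_shift_mem(2)[OF x] unfolding nondegenerate_def by blast
    ultimately show "x = 0"
      using join_vec_simps(3)[of n x] join_vec_zero by metis
  qed
  ultimately show ?thesis
    unfolding FG nondeg_form_def by simp
qed

lemma form_rel_orth_sum:
  assumes "form_rel F F'" "form_rel G G'"
  shows "form_rel (orth_sum F G) (orth_sum F' G')"
proof -
  obtain n b m c where FG: "F = (n, b)" "G = (m, c)"
    by (metis surj_pair)
  obtain n' b' m' c' where FG': "F' = (n', b')" "G' = (m', c')"
    by (metis surj_pair)
  obtain f where f: "isometry coord_scale (coord_space n) b coord_scale (coord_space n') b' f"
    using assms unfolding FG FG' form_rel_def isometric_def by auto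
  obtain g where g: "isometry coord_scale (coord_space m) c coord_scale (coord_space m') c' g"
    using assms unfolding FG FG' form_rel_def isometric_def by auto
  have bij: "bij_betw f (coord_space n) (coord_space n')"
      "bij_betw g (coord_space m) (coord_space m')"
    using f g unfolding isometry_def by auto
  have fg: "f x \<in> coord_space n'" "g y \<in> coord_space m'"
    if "x \<in> coord_space n" "y \<in> coord_space m" for x y
    using that bij by (auto dest: bij_betwE)
  define f' where "f' = inv_into (coord_space n) f"
  define g' where "g' = inv_into (coord_space m) g"
  have fg': "f' x \<in> coord_space n" "g' y \<in> coord_space m"
    if "x \<in> coord_space n'" "y \<in> coord_space m'" for x y
    using that bij[THEN bij_betw_inv_into] unfolding f'_def g'_def by (auto dest: bij_betwE)
  have inv: "f' (f x) = x" "g' (g y) = y" if "x \<in> coord_space n" "y \<in> coord_space m" for x y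
    using that bij unfolding f'_def g'_def by (simp_all add: bij_betw_inv_into_left)
  have inv': "f (f' x) = x" "g (g' y) = y" if "x \<in> coord_space n'" "y \<in> coord_space m'" for x y
    using that bij unfolding f'_def g'_def by (simp_all add: bij_betw_inv_into_right)
  define h where "h x = join_vec n' (f (trunc_vec n x)) (g (shift_vec n x))" for x
  define h' where "h' x = join_vec n (f' (trunc_vec n' x)) (g' (shift_vec n' x))" for x
  have mem: "h x \<in> coord_space (n' + m')" if "x \<in> coord_space (n + m)" for x
    unfolding h_def by (intro join_vec_mem fg[OF coord_space_closed(3)] trunc_shift_mem(2) that)
  have mem': "h' x \<in> coord_space (n + m)" if "x \<in> coord_space (n' + m')" for x
    unfolding h'_def by (intro join_vec_mem fg'[OF coord_space_closed(3)] trunc_shift_mem(2) that)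
  have th: "trunc_vec n' (h x) = f (trunc_vec n x)" "shift_vec n' (h x) = g (shift_vec n x)" for x
    unfolding h_def using join_vec_simps fg(1)[OF trunc_shift_mem(1) coord_space_closed(3)]
    by blast+
  have th': "trunc_vec n (h' x) = f' (trunc_vec n' x)" "shift_vec n (h' x) = g' (shift_vec n' x)"
    for x
    unfolding h'_def using join_vec_simps fg'(1)[OF trunc_shift_mem(1) coord_space_closed(3)]
    by blast+
  have "isometry coord_scale (coord_space (n + m)) (snd (orth_sum F G))
      coord_scale (coord_space (n' + m')) (snd (orth_sum F' G')) h"
    unfolding isometry_def
  proof (intro conjI ballI allI)
    have "h' (h x) = x" if "x \<in> coord_space (n + m)" for x
      unfolding h'_def th
      using inv[OF trunc_shift_mem(1) trunc_shift_mem(2)[OF that]] join_vec_simps(3) by simp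
    moreover have "h (h' x) = x" if "x \<in> coord_space (n' + m')" for x
      unfolding h_def th'
      using inv'[OF trunc_shift_mem(1) trunc_shift_mem(2)[OF that]] join_vec_simps(3) by simp
    ultimately show "bij_betw h (coord_space (n + m)) (coord_space (n' + m'))"
      using mem mem' by (intro bij_betw_byWitness[of _ h']) auto
  next
    fix x y :: "nat \<Rightarrow> 'a"
    assume x: "x \<in> coord_space (n + m)" and y: "y \<in> coord_space (n + m)"
    note mem = trunc_shift_mem(2)[OF x] trunc_shift_mem(2)[OF y]
    have "h (x + y) = join_vec n' (f (trunc_vec n x) + f (trunc_vec n y))
        (g (shift_vec n x) + g (shift_vec n y))"
      unfolding h_def trunc_shift_linear
      using mem isometryD(2)[OF f trunc_shift_mem(1) trunc_shift_mem(1)] isometryD(2)[OF g]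
      by simp
    also have "\<dots> = h x + h y"
      by (auto simp: h_def join_vec_def)
    finally show "h (x + y) = h x + h y" .
    show "snd (orth_sum F' G') (h x) (h y) = snd (orth_sum F G) x y"
      unfolding FG FG' orth_sum.simps snd_conv th
      using mem isometryD(4)[OF f trunc_shift_mem(1) trunc_shift_mem(1)] isometryD(4)[OF g]
      by simp
  next
    fix a and x :: "nat \<Rightarrow> 'a"
    assume x: "x \<in> coord_space (n + m)"
    have "h (coord_scale a x) = join_vec n' (coord_scale a (f (trunc_vec n x)))
        (coord_scale a (g (shift_vec n x)))"
      unfolding h_def trunc_shift_linear
      using isometryD(3)[OF f trunc_shift_mem(1)] isometryD(3)[OF g trunc_shift_mem(2)[OF x]]
      by simp
    also have "\<dots> = coord_scale a (h x)"
      by (auto simp: h_def join_vec_def coord_scale_def)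
    finally show "h (coord_scale a x) = coord_scale a (h x)" .
  qed
  moreover have "nondeg_form (orth_sum F G)" "nondeg_form (orth_sum F' G')"
    using assms by (auto intro!: nondeg_form_orth_sum simp: form_rel_def)
  ultimately show ?thesis
    unfolding form_rel_def isometric_def FG FG' by auto
qed

lemma orth_sum_std_vec:
  assumes "nondeg_form (n, b)" "nondeg_form (m, c)" "i < n + m" "j < n + m"
  shows "snd (orth_sum (n, b) (m, c)) (std_vec i) (std_vec j) =
    (if i < n \<and> j < n then b (std_vec i) (std_vec j)
     else if i \<ge> n \<and> j \<ge> n then c (std_vec (i - n)) (std_vec (j - n)) else 0)"
proof -
  have 1: "trunc_vec n (std_vec l) = (if l < n then std_vec l else 0)"
      "shift_vec n (std_vec l) = (if l < n then 0 else std_vec (l - n))" for l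
    by (auto simp: std_vec_def fun_eq_iff trunc_vec_def shift_vec_def)
  have b: "b 0 x = 0" "b x 0 = 0" if "x \<in> coord_space n" for x
    using form_zero[of n b] assms(1) that by (auto simp: nondeg_form_def)
  have c: "c 0 x = 0" "c x 0 = 0" if "x \<in> coord_space m" for x
    using form_zero[of m c] assms(2) that by (auto simp: nondeg_form_def)
  show ?thesis
    unfolding orth_sum.simps snd_conv 1 using assms(3,4) by (auto simp: b c)
qed


subsection \<open>Tensor products\<close>

definition col_vec :: "nat \<Rightarrow> nat \<Rightarrow> nat \<Rightarrow> (nat \<Rightarrow> 'k::field) \<Rightarrow> nat \<Rightarrow> 'k"
  where "col_vec n m j x = (\<lambda>i. if i < n then x (i * m + j) else 0)"

lemma index_less: "i < n \<Longrightarrow> j < m \<Longrightarrow> i * m + j < n * (m :: nat)"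
proof -
  assume "i < n" "j < m"
  hence "i * m + j < Suc i * m" "Suc i * m \<le> n * m"
    by (auto intro!: mult_le_mono1 simp del: mult_Suc) simp
  thus ?thesis by linarith
qed

lemma sum_div_mod:
  "(\<Sum>p<n * m. f p) = (\<Sum>i<n. \<Sum>j<m. f (i * m + j))" for f :: "nat \<Rightarrow> 'a::comm_monoid_add"
proof (induction n)
  case (Suc n)
  have "(\<Sum>p<Suc n * m. f p) = (\<Sum>p<n * m + m. f p)"
    by (simp add: add.commute)
  also have "\<dots> = (\<Sum>p<n * m. f p) + (\<Sum>j<m. f (n * m + j))"
  proof -
    have "(\<Sum>p<k + m. f p) = (\<Sum>p<k. f p) + (\<Sum>j<m. f (k + j))" for k
      by (induction m) (simp_all add: add.assoc)
    thus ?thesis .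
  qed
  finally show ?case
    using Suc.IH by simp
qed simp

lemma matrix_form_tensor:
  "matrix_form (n * m) (\<lambda>p q. A (p div m) (q div m) * B (p mod m) (q mod m)) x y =
   (\<Sum>j<m. \<Sum>j'<m. B j j' * matrix_form n A (col_vec n m j x) (col_vec n m j' y))"
proof -
  have "matrix_form (n * m) (\<lambda>p q. A (p div m) (q div m) * B (p mod m) (q mod m)) x y =
      (\<Sum>i<n. \<Sum>j<m. \<Sum>i'<n. \<Sum>j'<m.
        x (i * m + j) * (A i i' * B j j') * y (i' * m + j'))"
    unfolding matrix_form_def sum_div_mod by (intro sum.cong refl) auto
  also have "\<dots> = (\<Sum>j<m. \<Sum>i<n. \<Sum>i'<n. \<Sum>j'<m.
        x (i * m + j) * (A i i' * B j j') * y (i' * m + j'))"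
    by (rule sum.swap)
  also have "\<dots> = (\<Sum>j<m. \<Sum>i<n. \<Sum>j'<m. \<Sum>i'<n.
        x (i * m + j) * (A i i' * B j j') * y (i' * m + j'))"
    by (intro sum.cong refl sum.swap)
  also have "\<dots> = (\<Sum>j<m. \<Sum>j'<m. \<Sum>i<n. \<Sum>i'<n.
        x (i * m + j) * (A i i' * B j j') * y (i' * m + j'))"
    by (intro sum.cong refl sum.swap)
  also have "\<dots> = (\<Sum>j<m. \<Sum>j'<m. B j j' * matrix_form n A (col_vec n m j x) (col_vec n m j' y))"
    unfolding matrix_form_def col_vec_def
    by (intro sum.cong refl) (simp add: sum_distrib_left mult_ac)
  finally show ?thesis .
qed

lemma col_vec_mem: "col_vec n m j x \<in> coord_space n"
  by (auto simp: col_vec_def coord_space_def)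

lemma tensor_form_col:
  assumes "symmetric_bilinear coord_scale (coord_space n) b"
  shows "snd (tensor_form (n, b) (m, c)) x y =
    (\<Sum>j<m. \<Sum>j'<m. c (std_vec j) (std_vec j') * b (col_vec n m j x) (col_vec n m j' y))"
  unfolding tensor_form.simps snd_conv
    matrix_form_tensor[of n m "\<lambda>i j. b (std_vec i) (std_vec j)"
      "\<lambda>i j. c (std_vec i) (std_vec j)"]
  by (simp add: form_expand[OF assms col_vec_mem col_vec_mem])

lemma nondeg_form_std_vec_sym:
  "nondeg_form (n, b) \<Longrightarrow> i < n \<Longrightarrow> j < n \<Longrightarrow> b (std_vec i) (std_vec j) = b (std_vec j) (std_vec i)"
  by (auto simp: nondeg_form_def symmetric_bilinear_def)

lemma div_mod_less:
  "p < n * m \<Longrightarrow> p div m < n" "p < n * m \<Longrightarrow> p mod m < m" for p n m :: nat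
  by (simp add: less_mult_imp_div_less) (cases "m = 0", auto)

lemma nondeg_form_tensor_form:
  assumes "nondeg_form F" "nondeg_form G"
  shows "nondeg_form (tensor_form F G)"
proof -
  obtain n b m c where FG: "F = (n, b)" "G = (m, c)"
    by (metis surj_pair)
  have b: "symmetric_bilinear coord_scale (coord_space n) b" "nondegenerate (coord_space n) b"
    and c: "symmetric_bilinear coord_scale (coord_space m) c" "nondegenerate (coord_space m) c"
    using assms unfolding nondeg_form_def FG by auto
  let ?d = "snd (tensor_form (n, b) (m, c))"
  have "symmetric_bilinear coord_scale (coord_space (n * m)) ?d"
    unfolding tensor_form.simps snd_conv
    by (intro symmetric_bilinear_matrix_form arg_cong2[where f = "(*)"]
        nondeg_form_std_vec_sym[OF assms(1)[unfolded FG]]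
        nondeg_form_std_vec_sym[OF assms(2)[unfolded FG]] div_mod_less)
  moreover have "nondegenerate (coord_space (n * m)) ?d"
    unfolding nondegenerate_def
  proof (intro ballI impI)
    fix x :: "nat \<Rightarrow> 'a"
    assume x: "x \<in> coord_space (n * m)" and 0: "\<forall>y\<in>coord_space (n * m). ?d x y = 0"
    define z where "z j' = (\<Sum>j<m. coord_scale (c (std_vec j) (std_vec j')) (col_vec n m j x))" for j'
    have z_mem: "z j' \<in> coord_space n" for j'
      unfolding z_def using form_sum_left[OF b(1), of "{..<m}" _ 0] by (simp add: col_vec_mem)
    have "z j' = 0" if j': "j' < m" for j'
    proof -
      have "b (z j') w = 0" if w: "w \<in> coord_space n" for w
      proof -
        define y where "y = (\<lambda>p. if p < n * m \<and> p mod m = j' then w (p div m) else 0)"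
        have y: "y \<in> coord_space (n * m)"
          by (auto simp: y_def coord_space_def)
        have col: "col_vec n m l y = (if l = j' then w else 0)" if "l < m" for l
          using that j' w by (auto simp: col_vec_def y_def coord_space_def index_less fun_eq_iff)
        have "0 = ?d x y"
          using 0 y by simp
        also have "\<dots> = (\<Sum>j<m. \<Sum>l<m. if l = j' then
            c (std_vec j) (std_vec j') * b (col_vec n m j x) w else 0)"
          unfolding tensor_form_col[OF b(1)]
          by (intro sum.cong refl) (use form_zero[OF b(1) col_vec_mem] in \<open>auto simp: col\<close>)
        also have "\<dots> = (\<Sum>j<m. c (std_vec j) (std_vec j') * b (col_vec n m j x) w)"
          using j' by simp
        also have "\<dots> = (\<Sum>j<m. b (coord_scale (c (std_vec j) (std_vec j')) (col_vec n m j x)) w)"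
          by (intro sum.cong refl symmetric_bilinearD(3)[OF b(1) col_vec_mem w, symmetric])
        also have "\<dots> = b (z j') w"
          unfolding z_def using form_sum_left[OF b(1), of "{..<m}"] w by (simp add: col_vec_mem)
        finally show ?thesis by simp
      qed
      thus ?thesis
        using b(2) z_mem unfolding nondegenerate_def by blast
    qed note z0 = this
    have app: "(\<Sum>i\<in>I. f i) l = (\<Sum>i\<in>I. f i l)" if "finite I" for I l and f :: "nat \<Rightarrow> nat \<Rightarrow> 'a"
      using that by (induction I rule: finite_induct) auto
    have row: "(\<lambda>j. if j < m then x (i * m + j) else 0) = 0" if i: "i < n" for i
    proof -
      let ?r = "\<lambda>j. if j < m then x (i * m + j) else 0"
      have r: "?r \<in> coord_space m"
        by (auto simp: coord_space_def)
      have "c ?r w = 0" if w: "w \<in> coord_space m" for w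
      proof -
        have "c ?r w = (\<Sum>j<m. \<Sum>j'<m. x (i * m + j) * c (std_vec j) (std_vec j') * w j')"
          unfolding form_expand[OF c(1) r w] matrix_form_def by (intro sum.cong) auto
        also have "\<dots> = (\<Sum>j'<m. w j' * z j' i)"
          unfolding z_def app[OF finite_lessThan] sum_distrib_left
          by (subst sum.swap) (use i in \<open>simp add: coord_scale_def col_vec_def mult_ac\<close>)
        also have "\<dots> = 0"
          using z0 by simp
        finally show ?thesis .
      qed
      thus ?thesis
        using c(2) r unfolding nondegenerate_def by blast
    qed
    show "x = 0"
    proof
      fix p
      show "x p = 0 p"
      proof (cases "p < n * m")
        case True
        from fun_cong[OF row[OF div_mod_less(1)[OF True]], of "p mod m"] div_mod_less(2)[OF True]
        show ?thesis by simp
      qed (use x in \<open>auto simp: coord_space_def\<close>)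
    qed
  qed
  ultimately show ?thesis
    unfolding FG nondeg_form_def by simp
qed

lemma tensor_form_std_vec:
  assumes "i < n * m" "j < n * m"
  shows "snd (tensor_form (n, b) (m, c)) (std_vec i) (std_vec j) =
    b (std_vec (i div m)) (std_vec (j div m)) * c (std_vec (i mod m)) (std_vec (j mod m))"
  using assms by (simp add: matrix_form_std_vec)

lemma form_rel_tensor_comm:
  assumes "nondeg_form F" "nondeg_form G"
  shows "form_rel (tensor_form F G) (tensor_form G F)"
proof -
  obtain n b m c where FG: "F = (n, b)" "G = (m, c)"
    by (metis surj_pair)
  define \<pi> where "\<pi> p = p mod n * m + p div n" for p :: nat
  define \<rho> where "\<rho> p = p mod m * n + p div m" for p :: nat
  have less: "\<pi> p < n * m" "\<rho> p < n * m" if "p < n * m" for p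
  proof -
    have "p < m * n" using that by (simp add: mult.commute)
    thus "\<pi> p < n * m"
      unfolding \<pi>_def by (intro index_less div_mod_less)
    show "\<rho> p < n * m"
      unfolding \<rho>_def using index_less[of "p mod m" m "p div m" n] div_mod_less[OF that]
      by (simp add: mult.commute)
  qed
  have \<pi>: "\<pi> p div m = p mod n" "\<pi> p mod m = p div n" if "p < n * m" for p
    using div_mod_less(1)[of p m n] that by (auto simp: \<pi>_def mult.commute)
  have \<rho>: "\<rho> p div n = p mod m" "\<rho> p mod n = p div m" if "p < n * m" for p
    using div_mod_less(1)[of p n m] that by (auto simp: \<rho>_def)
  have "bij_betw \<pi> {..<n * m} {..<n * m}"
  proof (rule bij_betw_byWitness[of _ \<rho>])
    show "\<forall>p\<in>{..<n * m}. \<rho> (\<pi> p) = p"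
      using \<pi> by (auto simp: \<rho>_def[of "\<pi> _"])
    show "\<forall>p\<in>{..<n * m}. \<pi> (\<rho> p) = p"
      using \<rho> by (auto simp: \<pi>_def[of "\<rho> _"])
  qed (use less in auto)
  moreover have "tensor_form F G = (n * m, snd (tensor_form F G))"
      "tensor_form G F = (n * m, snd (tensor_form G F))"
    by (auto simp: FG mult.commute)
  ultimately show ?thesis
    using form_relI_gram[of "n * m" "snd (tensor_form F G)" "snd (tensor_form G F)" \<pi>]
      nondeg_form_tensor_form[OF assms] nondeg_form_tensor_form[OF assms(2,1)]
      tensor_form_std_vec[of _ n m _ b c] tensor_form_std_vec[of _ m n _ c b] less \<pi>
    by (simp add: FG mult.commute)
qed

lemma form_rel_tensor_left:
  assumes "form_rel F F'" "nondeg_form G"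
  shows "form_rel (tensor_form F G) (tensor_form F' G)"
proof -
  obtain n b m c n' b' where FG: "F = (n, b)" "G = (m, c)" "F' = (n', b')"
    by (metis surj_pair)
  have b: "symmetric_bilinear coord_scale (coord_space n) b"
      "symmetric_bilinear coord_scale (coord_space n') b'"
    using assms unfolding form_rel_def nondeg_form_def FG by auto
  obtain f where f: "isometry coord_scale (coord_space n) b coord_scale (coord_space n') b' f"
    using assms unfolding FG form_rel_def isometric_def by auto
  hence bij: "bij_betw f (coord_space n) (coord_space n')"
    unfolding isometry_def by auto
  define f' where "f' = inv_into (coord_space n) f"
  have inv: "f' (f x) = x" if "x \<in> coord_space n" for x
    using that bij unfolding f'_def by (simp add: bij_betw_inv_into_left)
  have inv': "f (f' x) = x" if "x \<in> coord_space n'" for x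
    using that bij unfolding f'_def by (simp add: bij_betw_inv_into_right)
  have fm: "f x \<in> coord_space n'" if "x \<in> coord_space n" for x
    using that bij by (auto dest: bij_betwE)
  have fm': "f' x \<in> coord_space n" if "x \<in> coord_space n'" for x
    using that bij_betw_inv_into[OF bij] unfolding f'_def by (auto dest: bij_betwE)
  define build where
    "build n v = (\<lambda>p. if p < n * m then v (p mod m) (p div m) else 0)"
    for n and v :: "nat \<Rightarrow> nat \<Rightarrow> 'a"
  have build_mem: "build n v \<in> coord_space (n * m)" for n v
    by (auto simp: build_def coord_space_def)
  have col_build: "col_vec n m j (build n v) = v j" if "j < m" "v j \<in> coord_space n" for n v j
    using that by (auto simp: col_vec_def build_def coord_space_def index_less fun_eq_iff)
  have build_col: "build n (\<lambda>j. col_vec n m j x) = x" if "x \<in> coord_space (n * m)" for n x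
    using that div_mod_less(1)[of _ n m]
    by (auto simp: col_vec_def build_def coord_space_def fun_eq_iff)
  have build_cong: "build n v = build n w" if "\<And>j. j < m \<Longrightarrow> v j = w j" for n v w
    using that div_mod_less(2)[of _ n m] by (auto simp: build_def fun_eq_iff)
  have build_add: "build n v + build n w = build n (\<lambda>j. v j + w j)" for n v w
    by (auto simp: build_def fun_eq_iff)
  have build_scale: "coord_scale a (build n v) = build n (\<lambda>j. coord_scale a (v j))" for a n v
    by (auto simp: build_def coord_scale_def fun_eq_iff)
  define h where "h x = build n' (\<lambda>j. f (col_vec n m j x))" for x
  define h' where "h' x = build n (\<lambda>j. f' (col_vec n' m j x))" for x
  have col_h: "col_vec n' m j (h x) = f (col_vec n m j x)" if "j < m" for j x
    unfolding h_def by (rule col_build[OF that fm[OF col_vec_mem]])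
  have col_h': "col_vec n m j (h' x) = f' (col_vec n' m j x)" if "j < m" for j x
    unfolding h'_def by (rule col_build[OF that fm'[OF col_vec_mem]])
  have "isometry coord_scale (coord_space (n * m)) (snd (tensor_form F G))
      coord_scale (coord_space (n' * m)) (snd (tensor_form F' G)) h"
    unfolding isometry_def
  proof (intro conjI ballI allI)
    have "h' (h x) = x" if "x \<in> coord_space (n * m)" for x
    proof -
      have "h' (h x) = build n (\<lambda>j. col_vec n m j x)"
        unfolding h'_def by (rule build_cong) (simp add: col_h inv col_vec_mem)
      thus ?thesis using build_col[OF that] by simp
    qed
    moreover have "h (h' x) = x" if "x \<in> coord_space (n' * m)" for x
    proof -
      have "h (h' x) = build n' (\<lambda>j. col_vec n' m j x)"
        unfolding h_def by (rule build_cong) (simp add: col_h' inv' col_vec_mem)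
      thus ?thesis using build_col[OF that] by simp
    qed
    ultimately show "bij_betw h (coord_space (n * m)) (coord_space (n' * m))"
      using build_mem by (intro bij_betw_byWitness[of _ h']) (auto simp: h_def h'_def)
  next
    fix x y :: "nat \<Rightarrow> 'a"
    have "col_vec n m j (x + y) = col_vec n m j x + col_vec n m j y" for j
      by (auto simp: col_vec_def)
    hence "f (col_vec n m j (x + y)) = f (col_vec n m j x) + f (col_vec n m j y)" for j
      using isometryD(2)[OF f col_vec_mem col_vec_mem] by simp
    thus "h (x + y) = h x + h y"
      unfolding h_def build_add by simp
    show "snd (tensor_form F' G) (h x) (h y) = snd (tensor_form F G) x y"
      unfolding FG tensor_form_col[OF b(1)] tensor_form_col[OF b(2)]
      using isometryD(4)[OF f col_vec_mem col_vec_mem]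
      by (intro sum.cong refl) (auto simp: col_h)
  next
    fix a and x :: "nat \<Rightarrow> 'a"
    have "col_vec n m j (coord_scale a x) = coord_scale a (col_vec n m j x)" for j
      by (auto simp: col_vec_def coord_scale_def)
    hence "f (col_vec n m j (coord_scale a x)) = coord_scale a (f (col_vec n m j x))" for j
      using isometryD(3)[OF f col_vec_mem] by simp
    thus "h (coord_scale a x) = coord_scale a (h x)"
      unfolding h_def build_scale by simp
  qed
  moreover have "nondeg_form (tensor_form F G)" "nondeg_form (tensor_form F' G)"
    using assms by (auto intro!: nondeg_form_tensor_form simp: form_rel_def)
  ultimately show ?thesis
    unfolding form_rel_def isometric_def FG by auto
qed

lemma form_rel_tensor:
  assumes "form_rel F F'" "form_rel G G'"
  shows "form_rel (tensor_form F G) (tensor_form F' G')"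
proof -
  have nd: "nondeg_form F" "nondeg_form F'" "nondeg_form G" "nondeg_form G'"
    using assms unfolding form_rel_def by auto
  note form_rel_trans [trans]
  have "form_rel (tensor_form F G) (tensor_form F' G)"
    by (rule form_rel_tensor_left[OF assms(1) nd(3)])
  also have "form_rel \<dots> (tensor_form G F')"
    by (rule form_rel_tensor_comm[OF nd(2,3)])
  also have "form_rel \<dots> (tensor_form G' F')"
    by (rule form_rel_tensor_left[OF assms(2) nd(2)])
  also have "form_rel \<dots> (tensor_form F' G')"
    by (rule form_rel_tensor_comm[OF nd(4,2)])
  finally show ?thesis .
qed


section \<open>The Grothendieck--Witt ring\<close>

text \<open>Isomorphism classes of non-degenerate symmetric bilinear forms. Every finite-dimensional
  space is isomorphic to some \<open>k\<^sup>n\<close>, so forms on these represent all classes.\<close>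

quotient_type (overloaded) 'k form_class = "'k::field coord_form" / partial: form_rel
proof (rule part_equivpI)
  have "nondeg_form (0, \<lambda>_ _. 0 :: 'k)"
    by (auto simp: nondeg_form_def symmetric_bilinear_def nondegenerate_def coord_space_def)
  thus "\<exists>F :: 'k coord_form. form_rel F F"
    unfolding form_rel_refl by blast
qed (auto intro!: sympI transpI intro: form_rel_sym form_rel_trans)

lemma nondeg_form_zero: "nondeg_form (0, \<lambda>_ _. 0)"
  by (auto simp: nondeg_form_def symmetric_bilinear_def nondegenerate_def coord_space_def)

lemma nondeg_form_one: "nondeg_form (1, \<lambda>x y. x 0 * y 0)"
proof -
  have "x = 0" if "x \<in> coord_space 1" "\<forall>y\<in>coord_space 1. x 0 * y 0 = 0" for x :: "nat \<Rightarrow> 'a"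
  proof -
    have "x 0 * std_vec 0 0 = 0"
      by (rule bspec[OF that(2)]) simp
    hence "x i = 0" for i
      using that(1) by (cases i) (auto simp: coord_space_def std_vec_def)
    thus ?thesis by auto
  qed
  thus ?thesis
    by (auto simp: nondeg_form_def symmetric_bilinear_def nondegenerate_def coord_scale_def
        algebra_simps)
qed

lemma isometric_coord_dim_le:
  assumes "isometric coord_scale (coord_space n) b coord_scale (coord_space m) (c :: _ \<Rightarrow> _ \<Rightarrow> 'k::field)"
  shows "n \<le> m"
proof -
  interpret vs: vector_space "coord_scale :: 'k \<Rightarrow> _"
    by unfold_locales (auto simp: coord_scale_def algebra_simps)
  obtain f where f: "isometry coord_scale (coord_space n) b coord_scale (coord_space m) c f"
    using assms unfolding isometric_def by blast
  have std: "std_vec i \<in> (coord_space n :: (nat \<Rightarrow> 'k) set)" if "i < n" for i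
    using that by simp
  have inj: "inj_on (\<lambda>i. f (std_vec i)) {..<n}"
  proof (rule inj_onI)
    fix i j assume ij: "i \<in> {..<n}" "j \<in> {..<n}" "f (std_vec i) = f (std_vec j)"
    hence "std_vec i = (std_vec j :: nat \<Rightarrow> 'k)"
      using bij_betw_imp_inj_on[OF isometryD(1)[OF f]] std by (auto dest: inj_onD)
    from fun_cong[OF this, of i] show "i = j"
      by (simp add: std_vec_def split: if_splits)
  qed
  have f0: "f 0 = 0"
    using isometryD(3)[OF f coord_space_closed(3), of 0] by simp
  have f_sum: "(\<Sum>i\<in>I. coord_scale (u i) (std_vec i)) \<in> coord_space n \<and>
      f (\<Sum>i\<in>I. coord_scale (u i) (std_vec i)) = (\<Sum>i\<in>I. coord_scale (u i) (f (std_vec i)))"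
    if "finite I" "I \<subseteq> {..<n}" for u I
    using that
  proof (induction I rule: finite_induct)
    case empty
    show ?case
      unfolding sum.empty f0 using coord_space_closed(3) by blast
  next
    case (insert i I)
    hence 1: "coord_scale (u i) (std_vec i) \<in> coord_space n" "std_vec i \<in> (coord_space n :: (nat \<Rightarrow> 'k) set)"
        "(\<Sum>i\<in>I. coord_scale (u i) (std_vec i)) \<in> coord_space n"
        "f (\<Sum>i\<in>I. coord_scale (u i) (std_vec i)) = (\<Sum>i\<in>I. coord_scale (u i) (f (std_vec i)))"
      by auto
    show ?case
      unfolding sum.insert[OF insert.hyps]
        isometryD(2)[OF f 1(1,3)] isometryD(3)[OF f 1(2)] 1(4)
      using coord_space_closed(1)[OF 1(1,3)] by blast
  qed
  let ?B = "(\<lambda>i. f (std_vec i)) ` {..<n}"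
  have "vs.independent ?B"
  proof (rule vs.independent_if_scalars_zero)
    fix u x assume u: "(\<Sum>x\<in>?B. coord_scale (u x) x) = 0" and x: "x \<in> ?B"
    let ?v = "\<lambda>i. u (f (std_vec i))"
    define z where "z = (\<Sum>i<n. coord_scale (?v i) (std_vec i))"
    have z: "z \<in> coord_space n" "f z = (\<Sum>i<n. coord_scale (?v i) (f (std_vec i)))"
      unfolding z_def using f_sum[of "{..<n}" ?v] by auto
    have "f z = f 0"
      using z(2) u f0 unfolding sum.reindex[OF inj] o_def by simp
    hence "z = 0"
      using bij_betw_imp_inj_on[OF isometryD(1)[OF f]] z(1) coord_space_closed(3)
      by (auto dest: inj_onD)
    obtain i where i: "i < n" "x = f (std_vec i)"
      using x by auto
    define w where "w = (\<lambda>l. if l < n then ?v l else 0)"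
    have "w \<in> coord_space n"
      by (auto simp: w_def coord_space_def)
    from coord_expand[OF this] have "w = z"
      unfolding z_def by (simp add: w_def)
    hence "w i = 0"
      using \<open>z = 0\<close> by simp
    thus "u x = 0"
      using i by (simp add: w_def)
  qed simp
  moreover have "?B \<subseteq> vs.span (std_vec ` {..<m})"
  proof
    fix x assume "x \<in> ?B"
    hence "x \<in> coord_space m"
      using bij_betwE[OF isometryD(1)[OF f]] by auto
    from coord_expand[OF this] show "x \<in> vs.span (std_vec ` {..<m})"
      by (metis (no_types, lifting) vs.span_sum vs.span_scale vs.span_base imageI)
  qed
  ultimately have "card ?B \<le> card (std_vec ` {..<m} :: (nat \<Rightarrow> 'k) set)"
    using vs.independent_span_bound by blast
  also have "\<dots> \<le> m"
    using card_image_le[of "{..<m}" std_vec] by simp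
  finally show ?thesis
    by (simp add: card_image[OF inj])
qed

lemma form_rel_dim: "form_rel F G \<Longrightarrow> fst F = fst G"
  unfolding form_rel_def
  by (meson isometric_coord_dim_le isometric_coord_sym order_antisym)

instantiation form_class :: (field) comm_semiring_1
begin

lift_definition zero_form_class :: "'a form_class" is "(0, \<lambda>_ _. 0)"
  by (simp only: form_rel_refl nondeg_form_zero)

lift_definition one_form_class :: "'a form_class" is "(1, \<lambda>x y. x 0 * y 0)"
  by (simp only: form_rel_refl nondeg_form_one)

lift_definition plus_form_class :: "'a form_class \<Rightarrow> 'a form_class \<Rightarrow> 'a form_class" is orth_sum
  by (rule form_rel_orth_sum)

lift_definition times_form_class :: "'a form_class \<Rightarrow> 'a form_class \<Rightarrow> 'a form_class" is tensor_form
  by (rule form_rel_tensor)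

instance
proof
  fix A B C :: "'a form_class"
  show "A + B + C = A + (B + C)"
  proof (transfer, unfold form_rel_refl)
    fix F G H :: "'a coord_form"
    assume nd: "nondeg_form F" "nondeg_form G" "nondeg_form H"
    obtain n b m c l d where FGH: "F = (n, b)" "G = (m, c)" "H = (l, d)"
      by (metis surj_pair)
    have 1: "nondeg_form (orth_sum (orth_sum F G) H)" "nondeg_form (orth_sum F (orth_sum G H))"
        "nondeg_form (orth_sum F G)" "nondeg_form (orth_sum G H)"
      using nd by (simp_all add: nondeg_form_orth_sum)
    have "snd (orth_sum (orth_sum F G) H) (std_vec i) (std_vec j) =
        snd (orth_sum F (orth_sum G H)) (std_vec i) (std_vec j)"
      if "i < n + m + l" "j < n + m + l" for i j
    proof -
      obtain e where e: "orth_sum F G = (n + m, e)" "e = snd (orth_sum F G)"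
        by (simp add: FGH)
      obtain e' where e': "orth_sum G H = (m + l, e')" "e' = snd (orth_sum G H)"
        by (simp add: FGH)
      have "snd (orth_sum (orth_sum F G) H) (std_vec i) (std_vec j) =
          (if i < n + m \<and> j < n + m then e (std_vec i) (std_vec j)
           else if i \<ge> n + m \<and> j \<ge> n + m then d (std_vec (i - (n + m))) (std_vec (j - (n + m))) else 0)"
        unfolding e(1) FGH(3)
        by (rule orth_sum_std_vec) (use 1 nd e FGH that in auto)
      moreover have "snd (orth_sum F (orth_sum G H)) (std_vec i) (std_vec j) =
          (if i < n \<and> j < n then b (std_vec i) (std_vec j)
           else if i \<ge> n \<and> j \<ge> n then e' (std_vec (i - n)) (std_vec (j - n)) else 0)"
        unfolding e'(1) FGH(1)
        by (rule orth_sum_std_vec) (use 1 nd e' FGH that in auto)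
      moreover have "e (std_vec i) (std_vec j) =
          (if i < n \<and> j < n then b (std_vec i) (std_vec j)
           else if i \<ge> n \<and> j \<ge> n then c (std_vec (i - n)) (std_vec (j - n)) else 0)"
        if "i < n + m" "j < n + m"
        unfolding e(2) FGH by (rule orth_sum_std_vec) (use nd FGH that in auto)
      moreover have "e' (std_vec (i - n)) (std_vec (j - n)) =
          (if i - n < m \<and> j - n < m then c (std_vec (i - n)) (std_vec (j - n))
           else if i - n \<ge> m \<and> j - n \<ge> m then d (std_vec (i - n - m)) (std_vec (j - n - m)) else 0)"
        if "i \<ge> n" "j \<ge> n"
        unfolding e'(2) FGH
        by (rule orth_sum_std_vec) (use nd FGH that \<open>i < n + m + l\<close> \<open>j < n + m + l\<close> in auto)
      ultimately show ?thesis
        by (auto simp: diff_diff_left)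
    qed
    moreover have "orth_sum (orth_sum F G) H = (n + m + l, snd (orth_sum (orth_sum F G) H))"
        "orth_sum F (orth_sum G H) = (n + m + l, snd (orth_sum F (orth_sum G H)))"
      by (auto simp: FGH)
    ultimately show "form_rel (orth_sum (orth_sum F G) H) (orth_sum F (orth_sum G H))"
      using 1(1,2) form_relI_gram_id[of "n + m + l" "snd (orth_sum (orth_sum F G) H)"
          "snd (orth_sum F (orth_sum G H))"] by metis
  qed
  show "A + B = B + A"
  proof (transfer, unfold form_rel_refl)
    fix F G :: "'a coord_form"
    assume nd: "nondeg_form F" "nondeg_form G"
    obtain n b m c where FG: "F = (n, b)" "G = (m, c)"
      by (metis surj_pair)
    define \<pi> where "\<pi> i = (if i < m then n + i else i - m)" for i
    define \<rho> where "\<rho> i = (if i < n then m + i else i - n)" for i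
    have "bij_betw \<pi> {..<n + m} {..<n + m}"
      by (rule bij_betw_byWitness[of _ \<rho>]) (auto simp: \<pi>_def \<rho>_def)
    moreover have "snd (orth_sum G F) (std_vec i) (std_vec j) =
        snd (orth_sum F G) (std_vec (\<pi> i)) (std_vec (\<pi> j))"
      if "i < n + m" "j < n + m" for i j
    proof -
      have "snd (orth_sum G F) (std_vec i) (std_vec j) =
          (if i < m \<and> j < m then c (std_vec i) (std_vec j)
           else if i \<ge> m \<and> j \<ge> m then b (std_vec (i - m)) (std_vec (j - m)) else 0)"
        unfolding FG by (rule orth_sum_std_vec) (use nd FG that in auto)
      moreover have "snd (orth_sum F G) (std_vec (\<pi> i)) (std_vec (\<pi> j)) =
          (if \<pi> i < n \<and> \<pi> j < n then b (std_vec (\<pi> i)) (std_vec (\<pi> j))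
           else if \<pi> i \<ge> n \<and> \<pi> j \<ge> n then c (std_vec (\<pi> i - n)) (std_vec (\<pi> j - n)) else 0)"
        unfolding FG by (rule orth_sum_std_vec) (use nd FG that in \<open>auto simp: \<pi>_def\<close>)
      ultimately show ?thesis
        using that by (auto simp: \<pi>_def)
    qed
    moreover have "orth_sum F G = (n + m, snd (orth_sum F G))"
        "orth_sum G F = (n + m, snd (orth_sum G F))"
      by (auto simp: FG)
    moreover have "nondeg_form (orth_sum F G)" "nondeg_form (orth_sum G F)"
      using nd by (auto intro: nondeg_form_orth_sum)
    ultimately show "form_rel (orth_sum F G) (orth_sum G F)"
      using form_relI_gram[of "n + m" "snd (orth_sum F G)" "snd (orth_sum G F)" \<pi>] by metis
  qed
  show "0 + A = A"
  proof (transfer, unfold form_rel_refl)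
    fix F :: "'a coord_form"
    assume nd: "nondeg_form F"
    obtain n b where F: "F = (n, b)"
      by (metis surj_pair)
    have "nondeg_form (orth_sum (0, \<lambda>_ _. 0) F)"
      by (intro nondeg_form_orth_sum nondeg_form_zero nd)
    moreover have "b (std_vec i) (std_vec j) = snd (orth_sum (0, \<lambda>_ _. 0) F) (std_vec i) (std_vec j)" for i j
      by (simp add: F shift_vec_def)
    ultimately show "form_rel (orth_sum (0, \<lambda>_ _. 0) F) F"
      using nd unfolding F by (auto intro!: form_relI_gram_id)
  qed
  show comm: "A * B = B * A" for A B :: "'a form_class"
    by transfer (unfold form_rel_refl, rule form_rel_tensor_comm)
  show "A * B * C = A * (B * C)"
  proof (transfer, unfold form_rel_refl)
    fix F G H :: "'a coord_form"
    assume nd: "nondeg_form F" "nondeg_form G" "nondeg_form H"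
    obtain n b m c l d where FGH: "F = (n, b)" "G = (m, c)" "H = (l, d)"
      by (metis surj_pair)
    have 1: "nondeg_form (tensor_form (tensor_form F G) H)" "nondeg_form (tensor_form F (tensor_form G H))"
      using nd by (simp_all add: nondeg_form_tensor_form)
    have "snd (tensor_form F (tensor_form G H)) (std_vec i) (std_vec j) =
        snd (tensor_form (tensor_form F G) H) (std_vec i) (std_vec j)"
      if ij: "i < n * m * l" "j < n * m * l" for i j
    proof -
      obtain e where e: "tensor_form F G = (n * m, e)" "e = snd (tensor_form F G)"
        by (simp add: FGH)
      obtain e' where e': "tensor_form G H = (m * l, e')" "e' = snd (tensor_form G H)"
        by (simp add: FGH)
      have ij': "i < n * (m * l)" "j < n * (m * l)"
        using ij by (simp_all add: mult.assoc)
      have "snd (tensor_form (tensor_form F G) H) (std_vec i) (std_vec j) =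
          e (std_vec (i div l)) (std_vec (j div l)) * d (std_vec (i mod l)) (std_vec (j mod l))"
        unfolding e(1) FGH(3) by (rule tensor_form_std_vec[OF ij])
      also have "e (std_vec (i div l)) (std_vec (j div l)) =
          b (std_vec (i div l div m)) (std_vec (j div l div m)) *
          c (std_vec (i div l mod m)) (std_vec (j div l mod m))"
        unfolding e(2) FGH by (intro tensor_form_std_vec div_mod_less ij)
      finally have *: "snd (tensor_form (tensor_form F G) H) (std_vec i) (std_vec j) =
          b (std_vec (i div l div m)) (std_vec (j div l div m)) *
          c (std_vec (i div l mod m)) (std_vec (j div l mod m)) *
          d (std_vec (i mod l)) (std_vec (j mod l))" .
      have "snd (tensor_form F (tensor_form G H)) (std_vec i) (std_vec j) =
          b (std_vec (i div (m * l))) (std_vec (j div (m * l))) *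
          e' (std_vec (i mod (m * l))) (std_vec (j mod (m * l)))"
        unfolding e'(1) FGH(1) by (rule tensor_form_std_vec[OF ij'])
      also have "e' (std_vec (i mod (m * l))) (std_vec (j mod (m * l))) =
          c (std_vec (i mod (m * l) div l)) (std_vec (j mod (m * l) div l)) *
          d (std_vec (i mod (m * l) mod l)) (std_vec (j mod (m * l) mod l))"
        unfolding e'(2) FGH by (intro tensor_form_std_vec div_mod_less(2)[OF ij'(1)] div_mod_less(2)[OF ij'(2)])
      finally have **: "snd (tensor_form F (tensor_form G H)) (std_vec i) (std_vec j) =
          b (std_vec (i div (m * l))) (std_vec (j div (m * l))) *
          (c (std_vec (i mod (m * l) div l)) (std_vec (j mod (m * l) div l)) *
           d (std_vec (i mod (m * l) mod l)) (std_vec (j mod (m * l) mod l)))" .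
      have idx: "p div (m * l) = p div l div m" "p mod (m * l) div l = p div l mod m"
          "p mod (m * l) mod l = p mod l" for p
        by (simp_all add: div_mult2_eq mult.commute[of m l] mod_mult2_eq)
           (cases "l = 0", simp_all)
      show ?thesis
        unfolding * ** idx by (simp add: mult_ac)
    qed
    moreover have "tensor_form (tensor_form F G) H = (n * m * l, snd (tensor_form (tensor_form F G) H))"
        "tensor_form F (tensor_form G H) = (n * m * l, snd (tensor_form F (tensor_form G H)))"
      by (auto simp: FGH mult.assoc)
    ultimately show "form_rel (tensor_form (tensor_form F G) H) (tensor_form F (tensor_form G H))"
      using 1 form_relI_gram_id[of "n * m * l" "snd (tensor_form (tensor_form F G) H)"
          "snd (tensor_form F (tensor_form G H))"] by metis
  qed
  show "1 * A = A"
  proof (transfer, unfold form_rel_refl)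
    fix F :: "'a coord_form"
    assume nd: "nondeg_form F"
    obtain n b where F: "F = (n, b)"
      by (metis surj_pair)
    define G :: "'a coord_form" where "G = tensor_form (1, \<lambda>x y. x 0 * y 0) F"
    have "nondeg_form G"
      unfolding G_def by (intro nondeg_form_tensor_form nondeg_form_one nd)
    moreover have "b (std_vec i) (std_vec j) = snd G (std_vec i) (std_vec j)"
      if "i < n" "j < n" for i j
    proof -
      have "snd G (std_vec i) (std_vec j) =
          std_vec (i div n) 0 * std_vec (j div n) 0 * b (std_vec (i mod n)) (std_vec (j mod n))"
        unfolding G_def F by (rule tensor_form_std_vec) (use that in auto)
      thus ?thesis
        using that by (simp add: std_vec_def)
    qed
    moreover have "G = (n, snd G)"
      by (simp add: G_def F)
    ultimately have "form_rel G F"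
      using nd form_relI_gram_id[of n "snd G" b] unfolding F by metis
    thus "form_rel (tensor_form (1, \<lambda>x y. x 0 * y 0) F) F"
      by (simp only: G_def)
  qed
  show "(A + B) * C = A * C + B * C"
  proof (transfer, unfold form_rel_refl)
    fix F G H :: "'a coord_form"
    assume nd: "nondeg_form F" "nondeg_form G" "nondeg_form H"
    obtain n b m c l d where FGH: "F = (n, b)" "G = (m, c)" "H = (l, d)"
      by (metis surj_pair)
    let ?L = "tensor_form (orth_sum F G) H" and ?R = "orth_sum (tensor_form F H) (tensor_form G H)"
    have 1: "nondeg_form (orth_sum F G)" "nondeg_form (tensor_form F H)" "nondeg_form (tensor_form G H)"
      using nd by (simp_all add: nondeg_form_tensor_form nondeg_form_orth_sum)
    have 2: "nondeg_form ?L" "nondeg_form ?R"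
      using nd 1 by (simp_all add: nondeg_form_tensor_form nondeg_form_orth_sum)
    have "snd ?R (std_vec i) (std_vec j) = snd ?L (std_vec i) (std_vec j)"
      if ij: "i < (n + m) * l" "j < (n + m) * l" for i j
    proof -
      have l: "l > 0"
        using ij by (cases "l = 0") auto
      obtain e where e: "orth_sum F G = (n + m, e)" "e = snd (orth_sum F G)"
        by (simp add: FGH)
      obtain r where r: "tensor_form F H = (n * l, r)" "r = snd (tensor_form F H)"
        by (simp add: FGH)
      obtain t where t: "tensor_form G H = (m * l, t)" "t = snd (tensor_form G H)"
        by (simp add: FGH)
      have "snd ?L (std_vec i) (std_vec j) =
          e (std_vec (i div l)) (std_vec (j div l)) * d (std_vec (i mod l)) (std_vec (j mod l))"
        unfolding e(1) FGH(3) by (rule tensor_form_std_vec[OF ij])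
      also have "e (std_vec (i div l)) (std_vec (j div l)) =
          (if i div l < n \<and> j div l < n then b (std_vec (i div l)) (std_vec (j div l))
           else if i div l \<ge> n \<and> j div l \<ge> n then c (std_vec (i div l - n)) (std_vec (j div l - n)) else 0)"
        unfolding e(2) FGH by (rule orth_sum_std_vec) (use nd FGH ij div_mod_less in auto)
      finally have *: "snd ?L (std_vec i) (std_vec j) =
          (if i div l < n \<and> j div l < n then b (std_vec (i div l)) (std_vec (j div l))
           else if i div l \<ge> n \<and> j div l \<ge> n then c (std_vec (i div l - n)) (std_vec (j div l - n)) else 0) *
          d (std_vec (i mod l)) (std_vec (j mod l))" .
      have **: "snd ?R (std_vec i) (std_vec j) =
          (if i < n * l \<and> j < n * l then r (std_vec i) (std_vec j)
           else if i \<ge> n * l \<and> j \<ge> n * l then t (std_vec (i - n * l)) (std_vec (j - n * l)) else 0)"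
        unfolding r(1) t(1)
        by (rule orth_sum_std_vec) (use 1 r(1) t(1) ij in \<open>auto simp: algebra_simps\<close>)
      have r': "r (std_vec i) (std_vec j) = b (std_vec (i div l)) (std_vec (j div l)) *
          d (std_vec (i mod l)) (std_vec (j mod l))" if "i < n * l" "j < n * l"
        unfolding r(2) FGH by (rule tensor_form_std_vec[OF that])
      have t': "t (std_vec (i - n * l)) (std_vec (j - n * l)) =
          c (std_vec ((i - n * l) div l)) (std_vec ((j - n * l) div l)) *
          d (std_vec ((i - n * l) mod l)) (std_vec ((j - n * l) mod l))" if "i \<ge> n * l" "j \<ge> n * l"
        unfolding t(2) FGH
        by (rule tensor_form_std_vec) (use that ij in \<open>auto simp: algebra_simps\<close>)
      have lt: "p div l < n \<longleftrightarrow> p < n * l" for p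
        by (rule div_less_iff_less_mult[OF l])
      have sub: "(p - n * l) div l = p div l - n" "(p - n * l) mod l = p mod l" if p: "n * l \<le> p" for p
      proof -
        obtain s where "p = n * l + s"
          using le_Suc_ex[OF p] by blast
        thus "(p - n * l) div l = p div l - n" "(p - n * l) mod l = p mod l"
          using l by (simp_all add: add.commute[of "n * l"])
      qed
      show ?thesis
      proof (cases "i < n * l"; cases "j < n * l")
        assume ij: "i < n * l" "j < n * l"
        thus ?thesis unfolding * ** lt by (simp add: r')
      next
        assume ij: "\<not> i < n * l" "\<not> j < n * l"
        hence ge: "n \<le> i div l" "n \<le> j div l" "n * l \<le> i" "n * l \<le> j"
          using lt[of i] lt[of j] by linarith+
        show ?thesis
          unfolding * ** t'[OF ge(3,4)] sub[OF ge(3)] sub[OF ge(4)] using ge by auto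
      next
        assume ij: "i < n * l" "\<not> j < n * l"
        thus ?thesis unfolding * ** using lt[of i] lt[of j] by simp
      next
        assume ij: "\<not> i < n * l" "j < n * l"
        thus ?thesis unfolding * ** using lt[of i] lt[of j] by simp
      qed
    qed
    moreover have "?L = ((n + m) * l, snd ?L)" "?R = ((n + m) * l, snd ?R)"
      by (auto simp: FGH algebra_simps)
    ultimately show "form_rel ?L ?R"
      using 2 form_relI_gram_id[of "(n + m) * l" "snd ?L" "snd ?R"] by metis
  qed
  show zero: "0 * A = 0" for A :: "'a form_class"
  proof (transfer, unfold form_rel_refl)
    fix F :: "'a coord_form"
    assume nd: "nondeg_form F"
    obtain n b where F: "F = (n, b)"
      by (metis surj_pair)
    have "nondeg_form (tensor_form (0, \<lambda>_ _. 0) F)"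
      by (intro nondeg_form_tensor_form nondeg_form_zero nd)
    thus "form_rel (tensor_form (0, \<lambda>_ _. 0) F) (0, \<lambda>_ _. 0)"
      unfolding F using nondeg_form_zero by (auto intro!: form_relI_gram_id)
  qed
  show "A * 0 = 0"
    using zero comm by metis
  show "(0 :: 'a form_class) \<noteq> 1"
    by transfer (auto dest: form_rel_dim)
qed

end

lift_definition form_rank :: "'k::field form_class \<Rightarrow> nat" is fst
  by (rule form_rel_dim)

lemma form_rank_simps [simp]:
  "form_rank (0 :: 'k::field form_class) = 0"
  "form_rank (1 :: 'k form_class) = 1"
  "form_rank (A + B) = form_rank A + form_rank (B :: 'k form_class)"
  by (transfer; auto)+

text \<open>The pair \<open>(A, B)\<close> stands for the formal difference \<open>A - B\<close>. The summand \<open>E\<close> is part of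
  the general definition of the group completion.\<close>

definition gw_rel :: "'k::field form_class \<times> 'k form_class \<Rightarrow> 'k form_class \<times> 'k form_class \<Rightarrow> bool"
  where "gw_rel p q \<longleftrightarrow> (\<exists>E. fst p + snd q + E = fst q + snd p + E)"

lemma gw_rel_trans:
  assumes "gw_rel p q" "gw_rel q r"
  shows "gw_rel p r"
proof -
  obtain E E' where E: "fst p + snd q + E = fst q + snd p + E" "fst q + snd r + E' = fst r + snd q + E'"
    using assms unfolding gw_rel_def by blast
  have "fst p + snd r + (snd q + E + E') = (fst p + snd q + E) + snd r + E'"
    by (simp only: ac_simps)
  also have "\<dots> = (fst q + snd r + E') + snd p + E"
    unfolding E(1) by (simp only: ac_simps)
  also have "\<dots> = fst r + snd p + (snd q + E + E')"
    unfolding E(2) by (simp only: ac_simps)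
  finally have "fst p + snd r + (snd q + E + E') = fst r + snd p + (snd q + E + E')" .
  thus ?thesis
    unfolding gw_rel_def by blast
qed

quotient_type (overloaded) 'k gw = "'k::field form_class \<times> 'k form_class" / gw_rel
proof (rule equivpI)
  show "reflp (gw_rel :: 'k form_class \<times> _ \<Rightarrow> _)"
    by (auto simp: reflp_def gw_rel_def)
  show "symp (gw_rel :: 'k form_class \<times> _ \<Rightarrow> _)"
    by (auto simp: symp_def gw_rel_def intro: sym)
  show "transp (gw_rel :: 'k form_class \<times> _ \<Rightarrow> _)"
    using gw_rel_trans by (auto simp: transp_def)
qed

instantiation gw :: (field) comm_ring_1
begin

lift_definition zero_gw :: "'a gw" is "(0, 0)" .

lift_definition one_gw :: "'a gw" is "(1, 0)" .

lift_definition plus_gw :: "'a gw \<Rightarrow> 'a gw \<Rightarrow> 'a gw"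
  is "\<lambda>p q. (fst p + fst q, snd p + snd q)"
proof -
  fix p p' q q' :: "'a form_class \<times> 'a form_class"
  assume "gw_rel p p'" "gw_rel q q'"
  then obtain E E' where E: "fst p + snd p' + E = fst p' + snd p + E" "fst q + snd q' + E' = fst q' + snd q + E'"
    unfolding gw_rel_def by blast
  have "fst p + fst q + (snd p' + snd q') + (E + E') =
      (fst p + snd p' + E) + (fst q + snd q' + E')"
    by (simp only: ac_simps)
  also have "\<dots> = (fst p' + snd p + E) + (fst q' + snd q + E')"
    unfolding E ..
  also have "\<dots> = fst p' + fst q' + (snd p + snd q) + (E + E')"
    by (simp only: ac_simps)
  finally have "fst p + fst q + (snd p' + snd q') + (E + E') =
      fst p' + fst q' + (snd p + snd q) + (E + E')" .
  thus "gw_rel (fst p + fst q, snd p + snd q) (fst p' + fst q', snd p' + snd q')"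
    unfolding gw_rel_def by auto
qed

lift_definition uminus_gw :: "'a gw \<Rightarrow> 'a gw" is "\<lambda>p. (snd p, fst p)"
  unfolding gw_rel_def fst_conv snd_conv by (metis add.commute)

definition minus_gw :: "'a gw \<Rightarrow> 'a gw \<Rightarrow> 'a gw"
  where "minus_gw x y = x + - y"

lift_definition times_gw :: "'a gw \<Rightarrow> 'a gw \<Rightarrow> 'a gw"
  is "\<lambda>p q. (fst p * fst q + snd p * snd q, fst p * snd q + snd p * fst q)"
proof -
  let ?t = "\<lambda>p q :: 'a form_class \<times> 'a form_class.
    (fst p * fst q + snd p * snd q, fst p * snd q + snd p * fst q)"
  have left: "gw_rel (?t p q) (?t p' q)" if p: "gw_rel p p'" for p p' q
  proof -
    obtain E where "fst p + snd p' + E = fst p' + snd p + E"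
      using p unfolding gw_rel_def by blast
    hence "(fst p + snd p' + E) * fst q + (fst p' + snd p + E) * snd q =
        (fst p' + snd p + E) * fst q + (fst p + snd p' + E) * snd q"
      by simp
    hence "fst (?t p q) + snd (?t p' q) + (E * fst q + E * snd q) =
        fst (?t p' q) + snd (?t p q) + (E * fst q + E * snd q)"
      by (simp add: algebra_simps)
    thus ?thesis
      unfolding gw_rel_def by blast
  qed
  have comm: "?t p q = ?t q p" for p q
    by (simp add: mult.commute add.commute)
  fix p p' q q' :: "'a form_class \<times> 'a form_class"
  assume "gw_rel p p'" "gw_rel q q'"
  thus "gw_rel (?t p q) (?t p' q')"
    using gw_rel_trans[OF left[of p p' q] left[of q q' p', unfolded comm[of q p'] comm[of q' p']]]
    by blast
qed

instance
proof
  have eq: "gw_rel p q" if "p = q" for p q :: "'a form_class \<times> 'a form_class"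
    using that by (auto simp: gw_rel_def)
  fix x y z :: "'a gw"
  show "x + y + z = x + (y + z)"
    by transfer (rule eq, simp add: add.assoc)
  show "x + y = y + x"
    by transfer (rule eq, simp add: add.commute)
  show "0 + x = x"
    by transfer (rule eq, simp)
  show "- x + x = 0"
    by transfer (auto simp: gw_rel_def add.commute)
  show "x - y = x + - y"
    by (rule minus_gw_def)
  show "x * y * z = x * (y * z)"
    by transfer (rule eq, simp add: algebra_simps)
  show "x * y = y * x"
    by transfer (rule eq, simp add: algebra_simps)
  show "1 * x = x"
    by transfer (rule eq, simp)
  show "(x + y) * z = x * z + y * z"
    by transfer (rule eq, simp add: algebra_simps)
  show "(0 :: 'a gw) \<noteq> 1"
  proof (transfer, unfold gw_rel_def, rule notI)
    assume "\<exists>E :: 'a form_class. fst (0, 0) + snd (1, 0) + E = fst (1, 0) + snd (0, 0) + E"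
    then obtain E :: "'a form_class" where "0 + 0 + E = 1 + 0 + E"
      by auto
    from arg_cong[OF this, of form_rank] show False
      by simp
  qed
qed

end

definition gw_of :: "'k::field form_class \<Rightarrow> 'k gw"
  where "gw_of A = abs_gw (A, 0)"

text \<open>The class of a non-degenerate symmetric bilinear form \<open>b\<close> on a finite-dimensional space
  \<open>V\<close> is that of any isometric form on some \<open>k\<^sup>n\<close>.\<close>

definition gw_class ::
    "('k::field \<Rightarrow> 'v::ab_group_add \<Rightarrow> 'v) \<Rightarrow> 'v set \<Rightarrow> ('v \<Rightarrow> 'v \<Rightarrow> 'k) \<Rightarrow> 'k gw"
  where "gw_class s V b = gw_of (abs_form_class (SOME F. nondeg_form F \<and>
    isometric s V b coord_scale (coord_space (fst F)) (snd F)))"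

lemma gw_class_eqI:
  assumes "nondeg_form F" "isometric s V b coord_scale (coord_space (fst F)) (snd F)"
    and "\<And>x y. x \<in> V \<Longrightarrow> y \<in> V \<Longrightarrow> x + y \<in> V" "\<And>a x. x \<in> V \<Longrightarrow> s a x \<in> V"
  shows "gw_class s V b = gw_of (abs_form_class F)"
proof -
  define G where "G = (SOME G. nondeg_form G \<and>
    isometric s V b coord_scale (coord_space (fst G)) (snd G))"
  have G: "nondeg_form G" "isometric s V b coord_scale (coord_space (fst G)) (snd G)"
    using someI[of "\<lambda>G. nondeg_form G \<and> isometric s V b coord_scale (coord_space (fst G)) (snd G)" F]
      assms(1,2) unfolding G_def by auto
  have "form_rel G F"
    unfolding form_rel_def
    using G assms(1) isometric_trans[OF isometric_sym[OF G(2) assms(3,4)] assms(2)] by blast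
  hence "abs_form_class G = abs_form_class F"
    using Quotient3_form_class unfolding Quotient3_def by blast
  thus ?thesis
    unfolding gw_class_def G_def by simp
qed

lemma gw_class_isometric:
  assumes "isometric s V b t W c" and "nondeg_form F" "isometric s V b coord_scale (coord_space (fst F)) (snd F)"
    and "\<And>x y. x \<in> V \<Longrightarrow> y \<in> V \<Longrightarrow> x + y \<in> V" "\<And>a x. x \<in> V \<Longrightarrow> s a x \<in> V"
    and "\<And>x y. x \<in> W \<Longrightarrow> y \<in> W \<Longrightarrow> x + y \<in> W" "\<And>a x. x \<in> W \<Longrightarrow> t a x \<in> W"
  shows "gw_class s V b = gw_class t W c"
  using gw_class_eqI[OF assms(2,3,4,5)] assms
    gw_class_eqI[OF assms(2) isometric_trans[OF isometric_sym[OF assms(1,4,5)] assms(3)] assms(6,7)]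
  by metis

definition diag_form :: "'k::field \<Rightarrow> 'k gw"
  where "diag_form a = gw_class (*) UNIV (\<lambda>x y. a * x * y)"

lemma diag_form_one: "diag_form (1 :: 'k::field) = 1"
proof -
  let ?f = "\<lambda>x :: 'k. \<lambda>i :: nat. if i = 0 then x else 0"
  have "isometry (*) UNIV (\<lambda>x y. 1 * x * y) coord_scale (coord_space 1) (\<lambda>x y. x 0 * y 0) ?f"
    unfolding isometry_def
  proof (intro conjI ballI allI)
    show "bij_betw ?f UNIV (coord_space 1)"
      by (rule bij_betw_byWitness[of _ "\<lambda>x. x 0"]) (auto simp: coord_space_def fun_eq_iff)
  qed (auto simp: coord_scale_def)
  hence "gw_class (*) UNIV (\<lambda>x y :: 'k. 1 * x * y) = gw_of (abs_form_class (1, \<lambda>x y. x 0 * y 0))"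
    by (intro gw_class_eqI nondeg_form_one) (auto simp: isometric_def)
  also have "\<dots> = 1"
    by (simp add: one_gw.abs_eq gw_of_def one_form_class.abs_eq)
  finally show ?thesis
    unfolding diag_form_def .
qed


section \<open>Finite etale algebras and trace forms\<close>

definition field_embedding :: "('a::field \<Rightarrow> 'b::field) \<Rightarrow> bool"
  where "field_embedding f \<longleftrightarrow>
    f 1 = 1 \<and> (\<forall>x y. f (x + y) = f x + f y) \<and> (\<forall>x y. f (x * y) = f x * f y)"

text \<open>An extension of \<open>k\<close> is a field embedding \<open>\<kappa>\<close> of \<open>k\<close> into the larger field.\<close>

definition ext_scale :: "('k::field \<Rightarrow> 'l::field) \<Rightarrow> 'k \<Rightarrow> 'l \<Rightarrow> 'l"
  where "ext_scale \<kappa> a x = \<kappa> a * x"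

text \<open>\<open>dim\<close> is \<open>0\<close> for infinite-dimensional spaces, so \<open>n\<close> is required to be positive.\<close>

definition extension_of_degree :: "('k::field \<Rightarrow> 'l::field) \<Rightarrow> nat \<Rightarrow> bool"
  where "extension_of_degree \<kappa> n \<longleftrightarrow>
    field_embedding \<kappa> \<and> n > 0 \<and> vector_space.dim (ext_scale \<kappa>) (UNIV :: 'l set) = n"

definition separable_poly :: "'k::field poly \<Rightarrow> bool"
  where "separable_poly p \<longleftrightarrow> coprime p (pderiv p)"

definition separable_closure :: "('k::field \<Rightarrow> 's::field) \<Rightarrow> bool"
  where "separable_closure \<iota> \<longleftrightarrow>
    field_embedding \<iota> \<and>
    (\<forall>x. \<exists>p. separable_poly p \<and> poly (map_poly \<iota> p) x = 0) \<and>
    (\<forall>p :: 's poly. separable_poly p \<and> degree p > 0 \<longrightarrow> (\<exists>x. poly p x = 0))"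

definition galois_group :: "('k::field \<Rightarrow> 's::field) \<Rightarrow> ('s \<Rightarrow> 's) set"
  where "galois_group \<iota> = {\<tau>. bij \<tau> \<and> field_embedding \<tau> \<and> (\<forall>a. \<tau> (\<iota> a) = \<iota> a)}"

definition embeddings :: "('k::field \<Rightarrow> 'l::field) \<Rightarrow> ('k \<Rightarrow> 's::field) \<Rightarrow> ('l \<Rightarrow> 's) set"
  where "embeddings \<kappa> \<iota> = {\<sigma>. field_embedding \<sigma> \<and> (\<forall>a. \<sigma> (\<kappa> a) = \<iota> a)}"

definition embedding_subsets ::
    "nat \<Rightarrow> ('k::field \<Rightarrow> 'l::field) \<Rightarrow> ('k \<Rightarrow> 's::field) \<Rightarrow> ('l \<Rightarrow> 's) set set"
  where "embedding_subsets j \<kappa> \<iota> = {T. T \<subseteq> embeddings \<kappa> \<iota> \<and> finite T \<and> card T = j}"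

definition subset_action :: "('s \<Rightarrow> 's) \<Rightarrow> ('l \<Rightarrow> 's) set \<Rightarrow> ('l \<Rightarrow> 's) set"
  where "subset_action \<tau> T = (\<lambda>\<sigma>. \<tau> \<circ> \<sigma>) ` T"

text \<open>Under the Galois correspondence, a finite \<open>Gal(k\<^sup>s/k)\<close>-set \<open>S\<close> corresponds to the
  \<open>k\<close>-algebra of equivariant maps \<open>S \<rightarrow> k\<^sup>s\<close> with pointwise operations; the functor in the other
  direction is \<open>E \<mapsto> Hom\<^sub>k(E, k\<^sup>s)\<close>. Here \<open>S\<close> is a set in a larger type, and its maps are
  represented by functions vanishing off \<open>S\<close>, so that the unit is the indicator function
  of \<open>S\<close>.\<close>

definition etale_algebra ::
    "('k::field \<Rightarrow> 's::field) \<Rightarrow> 't set \<Rightarrow> (('s \<Rightarrow> 's) \<Rightarrow> 't \<Rightarrow> 't) \<Rightarrow> ('t \<Rightarrow> 's) set"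
  where "etale_algebra \<iota> S act = {f. (\<forall>t. t \<notin> S \<longrightarrow> f t = 0) \<and>
    (\<forall>\<tau>\<in>galois_group \<iota>. \<forall>t\<in>S. f (act \<tau> t) = \<tau> (f t))}"

definition map_scale :: "('k::field \<Rightarrow> 's::field) \<Rightarrow> 'k \<Rightarrow> ('t \<Rightarrow> 's) \<Rightarrow> 't \<Rightarrow> 's"
  where "map_scale \<iota> a f = (\<lambda>t. \<iota> a * f t)"

text \<open>The trace of an endomorphism \<open>T\<close> of a finite-dimensional space \<open>V\<close>, computed in an
  arbitrary basis.\<close>

definition endo_trace ::
    "('k::field \<Rightarrow> 'v::ab_group_add \<Rightarrow> 'v) \<Rightarrow> 'v set \<Rightarrow> ('v \<Rightarrow> 'v) \<Rightarrow> 'k"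
  where "endo_trace s V T =
    (let B = (SOME B. \<not> module.dependent s B \<and> module.span s B = V)
     in \<Sum>b\<in>B. module.representation s B (T b) b)"

definition algebra_trace ::
    "('k::field \<Rightarrow> 'e::{ab_group_add, times} \<Rightarrow> 'e) \<Rightarrow> 'e set \<Rightarrow> 'e \<Rightarrow> 'k"
  where "algebra_trace s E x = endo_trace s E (\<lambda>z. x * z)"

definition trace_class :: "('k::field \<Rightarrow> 'e::{ab_group_add, times} \<Rightarrow> 'e) \<Rightarrow> 'e set \<Rightarrow> 'k gw"
  where "trace_class s E = gw_class s E (\<lambda>x y. algebra_trace s E (x * y))"

definition enriched_binomial ::
    "('k::field \<Rightarrow> 's::field) \<Rightarrow> ('k \<Rightarrow> 'l::field) \<Rightarrow> nat \<Rightarrow> 'k gw"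
  where "enriched_binomial \<iota> \<kappa> j =
    trace_class (map_scale \<iota>) (etale_algebra \<iota> (embedding_subsets j \<kappa> \<iota>) subset_action)"


section \<open>Binomial coefficients with rational arguments\<close>

text \<open>For an integer \<open>a\<close>, the number \<open>a gchoose k\<close> is an integer, and taking the floor only
  changes its type.\<close>

definition rat_binomial :: "rat \<Rightarrow> rat \<Rightarrow> int"
  where "rat_binomial a b =
    (if a \<in> \<int> \<and> b \<in> \<int> \<and> b \<ge> 0 then \<lfloor>a gchoose nat \<lfloor>b\<rfloor>\<rfloor> else 0)"

end

theory Submission
  imports Defs "HOL-Combinatorics.Permutations" "Jordan_Normal_Form.Char_Poly"
begin

text \<open>
  Let \<open>S\<close> be the set of \<open>j\<close>-subsets of the embeddings, \<open>E\<close> its algebra and \<open>N = |S|\<close>. The trace form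
  of \<open>E\<close> is \<open>\<langle>f, g\<rangle> = \<Sum>\<^sub>T f(T) g(T)\<close>. It is non-degenerate, so \<open>E\<close> has an orthogonal basis
  \<open>e\<^sub>1, \<dots>, e\<^sub>N\<close>, and the class of \<open>E\<close> is the sum of the classes of the unary forms with coefficients
  \<open>a\<^sub>i = \<langle>e\<^sub>i, e\<^sub>i\<rangle>\<close>, i.e. \<open>N - (1 - u) m\<close> where \<open>m\<close> of the \<open>a\<^sub>i\<close> are non-squares. As
  \<open>2 u = 2\<close>, only the parity of \<open>m\<close> matters, and \<open>m\<close> is even iff \<open>\<Prod>\<^sub>i a\<^sub>i\<close> is a square. This
  product is the square of \<open>\<delta> = det (e\<^sub>i(T))\<close>, and Frobenius multiplies \<open>\<delta>\<close> by the sign of its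
  permutation of \<open>S\<close>. Frobenius is an \<open>n\<close>-cycle on the embeddings, hence a product of \<open>n - 1\<close>
  transpositions, each of which acts on \<open>S\<close> as a product of \<open>n - 2\<close> choose \<open>j - 1\<close> transpositions;
  Lucas' theorem modulo 2 turns the resulting sign into the stated binomial coefficient.
\<close>

section \<open>Signs of permutations of subsets\<close>

text \<open>Only Frobenius matters. A Galois element need not be a power of it, but agrees with one
  on the common image of all embeddings, and every value of an element of \<open>E\<close> lies in
  that image. So equivariance is a single equation, and descent to \<open>k\<close> is the equation
  \<open>x ^ q = x\<close>. \<open>E\<close> is never split into fields, and orbits with stabilisers
  need no separate treatment. Instead a longest orthogonal family is taken. Non-degeneracy holds
  even against arbitrary maps from \<open>S\<close> to the closure, so the family is also a basis of
  all these maps over the closure. This yields both the dimension \<open>N\<close> and the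
  completeness relation: the sum over i of e_i(T) e_i(U) / a_i is 1 if T = U and 0 otherwise. That
  relation turns the trace, defined through an arbitrary basis, into a sum over \<open>S\<close>.
  The identity \<open>2 u = 2\<close> comes from writing a non-square as a sum of two
  squares.\<close>

lemma bij_betw_involution:
  assumes "f ` A \<subseteq> A" "\<And>x. x \<in> A \<Longrightarrow> f (f x) = x"
  shows "bij_betw f A A"
  using assms by (intro bij_betw_byWitness[of _ f]) auto

lemma sign_on_involution:
  assumes "finite A" "finite C" "inj_on g C" "C \<inter> g ` C = {}" "C \<union> g ` C \<subseteq> A"
    and "\<And>x. x \<in> C \<Longrightarrow> f x = g x \<and> f (g x) = x"
    and "\<And>x. x \<in> A \<Longrightarrow> x \<notin> C \<Longrightarrow> x \<notin> g ` C \<Longrightarrow> f x = x"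
  shows "sign_on A f = (-1) ^ card C"
  using assms(2-)
proof (induction C arbitrary: f rule: finite_induct)
  case empty
  have "sign_on A f = sign_on A id"
    using empty by (intro sign_on_cong) auto
  thus ?case by simp
next
  case (insert x C)
  \<comment> \<open>\<open>f\<close> with the exchange of \<open>x\<close> and \<open>g x\<close>
    undone, so that \<open>f\<close> agrees on \<open>A\<close> with
    \<open>f' \<circ> transpose x (g x)\<close>.\<close>
  define f' where "f' y = (if y = x \<or> y = g x then y else f y)" for y
  have gx: "g x \<notin> g ` C" "g x \<noteq> x" "x \<notin> g ` C" "g x \<notin> C" "x \<in> A" "g x \<in> A"
    using insert.prems(1-3) insert.hyps by auto
  have f': "f' y = g y \<and> f' (g y) = y" if "y \<in> C" for y
  proof -
    have "y \<noteq> x" "y \<noteq> g x" "g y \<noteq> x" "g y \<noteq> g x"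
      using that gx(2-) insert.hyps(2) gx(1) by (auto simp: image_iff)
    thus ?thesis
      using that insert.prems(4)[of y] unfolding f'_def by simp
  qed
  have f'_fix: "f' y = y" if "y \<in> A" "y \<notin> C" "y \<notin> g ` C" for y
    using that insert.prems(5)[of y] unfolding f'_def by auto
  have C: "inj_on g C" "C \<inter> g ` C = {}" "C \<union> g ` C \<subseteq> A"
    using insert.prems(1-3) by auto
  have IH: "sign_on A f' = (-1) ^ card C"
    by (rule insert.IH[OF C]) (fact f', fact f'_fix)
  have "bij_betw f' A A"
  proof (rule bij_betw_involution)
    have "f' y \<in> A \<and> f' (f' y) = y" if "y \<in> A" for y
      using f'[of y] f' f'_fix[OF that] C(3) that by (cases "y \<in> C"; cases "y \<in> g ` C") auto
    thus "f' ` A \<subseteq> A" "\<And>y. y \<in> A \<Longrightarrow> f' (f' y) = y"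
      by auto
  qed
  moreover have "bij_betw (transpose x (g x)) A A"
    using permutes_imp_bij[OF permutes_swap_id[OF gx(5,6)]] .
  ultimately have "sign_on A (f' \<circ> transpose x (g x)) = sign_on A f' * sign_on A (transpose x (g x))"
    using assms(1) by (intro sign_on_compose)
  also have "\<dots> = (-1) ^ card C * -1"
    unfolding IH sign_on_transpose[OF gx(5,6) gx(2)[symmetric]] ..
  also have "sign_on A (f' \<circ> transpose x (g x)) = sign_on A f"
    using insert.prems(4)[of x] gx by (intro sign_on_cong) (auto simp: f'_def transpose_def)
  finally show ?case
    using insert.hyps by simp
qed

text \<open>Only subsets containing exactly one of \<open>a\<close> and \<open>b\<close> move. They
  come in pairs, and the pairs correspond to the \<open>(j - 1)\<close>-subsets of
  \<open>A - {a, b}\<close>. The case \<open>j = 0\<close> is separate because \<open>j - 1\<close>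
  is truncated.\<close>

lemma sign_on_subsets_transpose:
  assumes "finite A" "a \<in> A" "b \<in> A" "a \<noteq> b"
  shows "sign_on {T. T \<subseteq> A \<and> card T = j} ((`) (transpose a b)) =
    (-1) ^ (if j = 0 then 0 else (card A - 2) choose (j - 1))"
proof -
  let ?S = "{T. T \<subseteq> A \<and> card T = j}"
  \<comment> \<open>One representative of each exchanged pair; \<open>g\<close> gives its
    partner.\<close>
  define C where "C = {T\<in>?S. a \<in> T \<and> b \<notin> T}"
  define g where "g T = insert b (T - {a})" for T
  have fin: "finite T" if "T \<subseteq> A" for T
    using that assms(1) finite_subset by blast
  have S: "finite ?S"
    using assms(1) by simp
  have "sign_on ?S ((`) (transpose a b)) = (-1) ^ card C"
  proof (rule sign_on_involution)
    show "finite C" "finite ?S"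
      using S finite_subset[of C ?S] unfolding C_def by auto
    show "inj_on g C"
      by (rule inj_onI) (auto simp: g_def C_def)
    show "C \<inter> g ` C = {}"
      by (auto simp: g_def C_def)
    have "card (g T) = card T" if "T \<in> C" for T
      using that assms(4) fin[of T] card_Suc_Diff1[of T a] by (auto simp: g_def C_def)
    thus "C \<union> g ` C \<subseteq> ?S"
      using assms(3) by (auto simp: C_def) (auto simp: g_def)
  next
    fix T assume T: "T \<in> C"
    thus "transpose a b ` T = g T \<and> transpose a b ` g T = T"
      using assms(4) unfolding g_def C_def by (auto simp: transpose_def image_iff)
  next
    fix T assume T: "T \<in> ?S" "T \<notin> C" "T \<notin> g ` C"
    have "a \<in> T" if "b \<in> T"
    proof (rule ccontr)
      assume a: "a \<notin> T"
      have "card (insert a (T - {b})) = j"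
        using T(1) that a fin[of T] card_Suc_Diff1[of T b] by simp
      hence "insert a (T - {b}) \<in> C"
        using T(1) assms(2,4) by (auto simp: C_def)
      moreover have "g (insert a (T - {b})) = T"
        using that a by (auto simp: g_def)
      ultimately show False
        using T(3) by blast
    qed
    hence "a \<in> T \<longleftrightarrow> b \<in> T"
      using T unfolding C_def by blast
    thus "transpose a b ` T = T"
      by (rule transpose_image_eq)
  qed
  moreover have "card C = (if j = 0 then 0 else (card A - 2) choose (j - 1))"
  proof (cases "j = 0")
    case True
    hence "C = {}"
      using fin unfolding C_def by (auto simp: card_gt_0_iff)
    thus ?thesis
      using True by simp
  next
    case False
    let ?U = "{U. U \<subseteq> A - {a, b} \<and> card U = j - 1}"
    have "card (insert a U) = j" if "U \<in> ?U" for U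
    proof -
      have "finite U" "a \<notin> U"
        using that fin[of U] by auto
      thus ?thesis
        using that False by simp
    qed
    hence "insert a ` ?U \<subseteq> C"
      using assms(2,4) by (auto simp: C_def)
    moreover have "(\<lambda>T. T - {a}) ` C \<subseteq> ?U"
      using fin by (auto simp: C_def)
    ultimately have "bij_betw (insert a) ?U C"
      by (intro bij_betw_byWitness[of _ "\<lambda>T. T - {a}"]) (auto simp: C_def)
    hence "card C = card ?U"
      by (metis bij_betw_same_card)
    also have "\<dots> = card (A - {a, b}) choose (j - 1)"
      using assms(1) by (intro n_subsets) auto
    also have "card (A - {a, b}) = card A - 2"
      using assms by (simp add: card_Diff_subset)
    finally show ?thesis
      using False by simp
  qed
  ultimately show ?thesis by simp
qed

lemma bij_betw_image_subsets:
  assumes "p permutes A"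
  shows "bij_betw ((`) p) {T. T \<subseteq> A \<and> card T = j} {T. T \<subseteq> A \<and> card T = j}"
proof (rule bij_betw_byWitness[of _ "(`) (inv_into UNIV p)"])
  note inj = permutes_inj[OF assms] permutes_inj[OF permutes_inv[OF assms]]
  show "(`) p ` {T. T \<subseteq> A \<and> card T = j} \<subseteq> {T. T \<subseteq> A \<and> card T = j}"
    using permutes_image[OF assms] inj by (auto simp: card_image inj_on_subset)
  show "(`) (inv_into UNIV p) ` {T. T \<subseteq> A \<and> card T = j} \<subseteq> {T. T \<subseteq> A \<and> card T = j}"
    using permutes_image[OF permutes_inv[OF assms]] inj by (auto simp: card_image inj_on_subset)
qed (simp_all add: image_image permutes_inverses[OF assms])

text \<open>Both sides are multiplicative in \<open>p\<close>, so transpositions suffice.\<close>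

lemma sign_on_subsets:
  assumes "finite A" "p permutes A"
  shows "sign_on {T. T \<subseteq> A \<and> card T = j} ((`) p) =
    sign p ^ (if j = 0 then 0 else (card A - 2) choose (j - 1))"
  using assms(2,1)
proof (induction rule: permutes_induct)
  case id
  have "sign_on {T. T \<subseteq> A \<and> card T = j} ((`) id) = sign_on {T. T \<subseteq> A \<and> card T = j} id"
    by (intro sign_on_cong) auto
  thus ?case by simp
next
  case (swap a b p)
  let ?S = "{T. T \<subseteq> A \<and> card T = j}"
  have "sign_on ?S ((`) (transpose a b \<circ> p)) = sign_on ?S ((`) (transpose a b) \<circ> (`) p)"
    by (intro sign_on_cong) (auto simp: image_comp)
  also have "\<dots> = sign_on ?S ((`) (transpose a b)) * sign_on ?S ((`) p)"
    using swap.hyps assms(1)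
    by (intro sign_on_compose bij_betw_image_subsets permutes_swap_id) auto
  moreover have "permutation p"
    using swap.hyps(4) assms(1) permutation_permutes by blast
  hence "sign (transpose a b \<circ> p) = -1 * sign p"
    using swap.hyps(3) by (simp only: sign_compose permutation_swap_id sign_swap_id if_False)
  ultimately show ?case
    using swap.IH sign_on_subsets_transpose[OF assms(1) swap.hyps(1-3)]
    by (simp only: power_mult_distrib)
qed

section \<open>The sign of a cycle, and binomial coefficients modulo 2\<close>

definition cyclic_shift :: "nat \<Rightarrow> nat \<Rightarrow> nat"
  where "cyclic_shift n i = (if Suc i < n then Suc i else if Suc i = n then 0 else i)"

text \<open>A cycle of length \<open>n + 1\<close> is a cycle of length \<open>n\<close> composed
  with one transposition.\<close>

lemma cyclic_shift_permutes: "cyclic_shift n permutes {..<n}"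
  and sign_cyclic_shift: "n > 0 \<Longrightarrow> sign (cyclic_shift n) = (-1) ^ (n - 1)"
proof (induction n)
  case (Suc n)
  note IH = Suc.IH
  have eq: "cyclic_shift (Suc n) = cyclic_shift n \<circ> transpose (n - 1) n" if "n > 0"
    using that by (auto simp: cyclic_shift_def transpose_def fun_eq_iff)
  have 1: "cyclic_shift (Suc 0) = id"
    by (auto simp: cyclic_shift_def)
  have perm: "cyclic_shift n permutes {..<Suc n}"
    using Suc.IH(1) by (rule permutes_subset) auto
  {
    case 1
    have "cyclic_shift n \<circ> transpose (n - 1) n permutes {..<Suc n}"
      by (intro permutes_compose perm permutes_swap_id) auto
    thus ?case
      using eq \<open>cyclic_shift (Suc 0) = id\<close> permutes_id[of "{..<Suc 0}"]
      by (cases "n = 0") (simp_all only: neq0_conv)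
  next
    case 2
    have cs: "permutation (cyclic_shift n)"
      using perm permutation_permutes by blast
    show ?case
    proof (cases n)
      case 0
      thus ?thesis
        using \<open>cyclic_shift (Suc 0) = id\<close> by simp
    next
      case (Suc m)
      hence "n > 0" by simp
      have "sign (cyclic_shift (Suc n)) = sign (cyclic_shift n) * sign (transpose (n - 1) n)"
        unfolding eq[OF \<open>n > 0\<close>] by (rule sign_compose[OF cs permutation_swap_id])
      thus ?thesis
        using IH(2) Suc by (simp add: sign_swap_id)
    qed
  }
qed (auto simp: cyclic_shift_def permutes_def)

text \<open>Modulo 2, \<open>(1 + x) ^ (2 * m)\<close> is \<open>(1 + x ^ 2) ^ m\<close>. The
  induction uses Pascal's rule twice, which puts a factor 2 on the middle term.\<close>

lemma even_choose_double:
  "even ((2 * m) choose k) \<longleftrightarrow> odd k \<or> even (m choose (k div 2))"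
proof (induction m arbitrary: k)
  case 0
  show ?case
  proof (cases "k < 2")
    case True
    hence "k = 0 \<or> k = 1" by auto
    thus ?thesis by auto
  qed (simp add: binomial_eq_0)
next
  case (Suc m)
  show ?case
  proof (cases "k < 2")
    case True
    hence "k = 0 \<or> k = 1" by auto
    thus ?thesis by auto
  next
    case False
    then obtain l where l: "k = Suc (Suc l)"
      by (metis add_2_eq_Suc le_Suc_ex not_less)
    have "(2 * Suc m) choose k = ((2 * m) choose l) + 2 * ((2 * m) choose Suc l) + ((2 * m) choose Suc (Suc l))"
      unfolding l by simp
    thus ?thesis
      using Suc.IH[of l] Suc.IH[of "Suc (Suc l)"] unfolding l by auto
  qed
qed

section \<open>Extensions of finite fields\<close>

lemma field_hom_embedding:
  assumes "field_embedding f"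
  shows "field_hom f"
proof unfold_locales
  have "f (0 + 0) = f 0 + f 0"
    using assms unfolding field_embedding_def by blast
  hence "f 0 + f 0 = f 0 + 0"
    by (metis add.right_neutral)
  thus "f 0 = 0"
    by (rule add_left_imp_eq)
qed (use assms in \<open>auto simp: field_embedding_def\<close>)

lemma field_embedding_inj:
  assumes "field_embedding f"
  shows "inj f"
proof -
  interpret field_hom f
    by (rule field_hom_embedding[OF assms])
  show ?thesis
    by (rule injI) simp
qed

lemma field_embedding_comp: "field_embedding f \<Longrightarrow> field_embedding g \<Longrightarrow> field_embedding (g \<circ> f)"
  unfolding field_embedding_def by simp

lemma separable_poly_dvd:
  assumes "separable_poly p" "r dvd p"
  shows "separable_poly r"
  unfolding separable_poly_def
proof (rule coprimeI)
  obtain s where s: "p = r * s"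
    using assms(2) by blast
  fix c assume c: "c dvd r" "c dvd pderiv r"
  hence "c dvd p" "c dvd pderiv p"
    unfolding s pderiv_mult by auto
  thus "is_unit c"
    using assms(1) coprime_common_divisor[of p "pderiv p" c] unfolding separable_poly_def by blast
qed

lemma finite_field_power_card:
  fixes x :: "'a::field"
  assumes fin: "finite (UNIV :: 'a set)"
  shows "x ^ card (UNIV :: 'a set) = x"
proof (cases "x = 0")
  case False
  let ?U = "UNIV - {0 :: 'a}"
  have "\<Prod>?U = (\<Prod>y\<in>?U. x * y)"
    by (rule prod.reindex_bij_witness[of _ "\<lambda>y. x * y" "\<lambda>y. y / x"]) (use False in auto)
  also have "\<dots> = x ^ card ?U * \<Prod>?U"
    by (simp add: prod.distrib)
  finally have "x ^ card ?U = 1"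
    using fin by simp
  moreover have "card (UNIV :: 'a set) = Suc (card ?U)"
    using fin by (metis UNIV_I card_Suc_Diff1)
  ultimately show ?thesis
    by (simp only: power_Suc mult_1_right)
qed (use fin in \<open>simp add: card_gt_0_iff\<close>)

text \<open>Source of the upper bounds on fixed fields of powers of Frobenius: the fixed points are
  roots of \<open>X ^ m - X\<close>.\<close>

lemma card_power_fixed_points:
  assumes "m > 1"
  shows "finite {x :: 'a::field. x ^ m = x}" "card {x :: 'a. x ^ m = x} \<le> m"
proof -
  let ?R = "monom 1 m - monom 1 1 :: 'a poly"
  have "coeff ?R m \<noteq> 0"
    using assms by simp
  hence R: "?R \<noteq> 0"
    by (metis coeff_0)
  have eq: "{x :: 'a. x ^ m = x} = {x. poly ?R x = 0}"
    by (auto simp: poly_monom)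
  show "finite {x :: 'a. x ^ m = x}"
    unfolding eq by (rule poly_roots_finite[OF R])
  have "card {x :: 'a. x ^ m = x} \<le> degree ?R"
    unfolding eq by (rule card_poly_roots_bound[OF R])
  also have "\<dots> \<le> m"
    by (rule degree_diff_le) (use assms in \<open>auto simp: degree_monom_eq\<close>)
  finally show "card {x :: 'a. x ^ m = x} \<le> m" .
qed

lemma sum_power_less: "q > 1 \<Longrightarrow> (\<Sum>d<n. q ^ d) < (q :: nat) ^ n"
proof (induction n)
  case (Suc n)
  have "2 * q ^ n \<le> q * q ^ n"
    using Suc.prems by (intro mult_le_mono1) simp
  thus ?case
    using Suc.IH[OF Suc.prems] unfolding sum.lessThan_Suc power_Suc by linarith
qed simp

text \<open>The larger field is arbitrary, so that this serves both for \<open>L\<close> over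
  \<open>k\<close> and for the separable closure over \<open>k\<close>.\<close>

locale finite_field_ext =
  fixes \<kappa> :: "'k::finite_field \<Rightarrow> 'l::field" and q :: nat
  assumes embedding: "field_embedding \<kappa>"
    and card_base: "card (UNIV :: 'k set) = q" and primepow_q: "primepow q"
begin

sublocale field_hom \<kappa>
  by (rule field_hom_embedding[OF embedding])

sublocale map_poly_hom: map_poly_idom_hom \<kappa> ..

lemma q_gt_1: "q > 1"
  using primepow_gt_Suc_0[OF primepow_q] by simp

lemma q_pow_gt_1: "m > 0 \<Longrightarrow> q ^ m > 1"
  using one_less_power[OF q_gt_1] by blast

lemma q_eq_CHAR_power: "\<exists>e>0. prime CHAR('l) \<and> q = CHAR('l) ^ e"
proof -
  obtain p e where pe: "prime p" "e > 0" "q = p ^ e"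
    using primepow_q unfolding primepow_def by auto
  \<comment> \<open>Translation by 1 permutes the field, so the sum of all elements is unchanged
    although each of the \<open>q\<close> terms grows by 1.\<close>
  have "(\<Sum>x\<in>UNIV. x :: 'k) = (\<Sum>x\<in>UNIV. x + 1)"
    by (rule sum.reindex_bij_witness[of _ "\<lambda>x. x + 1" "\<lambda>x. x - 1"]) auto
  hence "of_nat q = (0 :: 'k)"
    by (simp add: sum.distrib card_base)
  hence "CHAR('k) dvd p ^ e"
    using of_nat_eq_0_iff_char_dvd pe by blast
  hence "CHAR('k) dvd p"
    using prime_dvd_power[OF CHAR_prime] by blast
  moreover have "CHAR('k) \<noteq> 1"
    by (metis CHAR_prime not_prime_1)
  ultimately have p: "p = CHAR('k)"
    using pe(1) unfolding prime_nat_iff by auto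
  have "of_nat p = \<kappa> (of_nat p)"
    by (simp add: hom_of_nat)
  also have "\<dots> = 0"
    unfolding p by simp
  finally have "CHAR('l) dvd p"
    using of_nat_eq_0_iff_char_dvd by blast
  moreover have "CHAR('l) \<noteq> 1"
    by (metis of_nat_1 of_nat_CHAR one_neq_zero)
  ultimately have "CHAR('l) = p"
    using pe(1) unfolding prime_nat_iff by auto
  thus ?thesis
    using pe by auto
qed

lemma frob_add: "(x + y :: 'l) ^ q ^ m = x ^ q ^ m + y ^ q ^ m"
proof -
  obtain e where "prime CHAR('l)" "q = CHAR('l) ^ e"
    using q_eq_CHAR_power by blast
  thus ?thesis
    by (intro freshmans_dream'[of _ "e * m"]) (auto simp: power_mult)
qed

lemma of_nat_q_power: "m > 0 \<Longrightarrow> of_nat (q ^ m) = (0 :: 'l)"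
  using q_eq_CHAR_power of_nat_CHAR[where ?'a = 'l] by (auto simp: power_0_left)

lemma two_neq_0: "odd q \<Longrightarrow> (2 :: 'l) \<noteq> 0"
proof
  assume "odd q" "(2 :: 'l) = 0"
  hence "of_nat 2 = (0 :: 'l)" by simp
  hence "CHAR('l) dvd 2"
    using of_nat_eq_0_iff_char_dvd by blast
  thus False
    using q_eq_CHAR_power \<open>odd q\<close> primes_dvd_imp_eq[of "CHAR('l)" 2] by auto
qed

lemma frob_embedding: "field_embedding (\<lambda>x :: 'l. x ^ q ^ m)"
  unfolding field_embedding_def by (simp add: frob_add power_mult_distrib)

lemma frob_inj: "(x :: 'l) ^ q ^ m = y ^ q ^ m \<Longrightarrow> x = y"
  using injD[OF field_embedding_inj[OF frob_embedding[of m]]] by blast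

lemma frob_sum: "(\<Sum>i\<in>I. f i :: 'l) ^ q ^ m = (\<Sum>i\<in>I. f i ^ q ^ m)"
proof -
  interpret frob: field_hom "\<lambda>x :: 'l. x ^ q ^ m"
    by (rule field_hom_embedding[OF frob_embedding])
  show ?thesis
    by (rule frob.hom_sum)
qed

lemma frob_comp: "((x :: 'l) ^ q ^ i) ^ q ^ j = x ^ q ^ (i + j)"
  by (simp add: power_add flip: power_mult)

lemma frob_base: "\<kappa> a ^ q ^ m = \<kappa> a"
  using finite_field_power_card_power_eq_same[of "q ^ m" m a] card_base
  by (metis hom_power)

text \<open>Descent criterion. The \<open>q\<close> elements of \<open>range \<kappa>\<close> are
  fixed, and \<open>X ^ q - X\<close> has at most \<open>q\<close> roots.\<close>

lemma frob_fixed: "(x :: 'l) ^ q = x \<longleftrightarrow> x \<in> range \<kappa>"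
proof
  have "range \<kappa> = {x. x ^ q = x}"
  proof (rule card_subset_eq)
    show "finite {x :: 'l. x ^ q = x}"
      by (rule card_power_fixed_points[OF q_gt_1])
    show sub: "range \<kappa> \<subseteq> {x. x ^ q = x}"
      using frob_base[of _ 1] by auto
    have "card (range \<kappa>) = q"
      using card_image[OF field_embedding_inj[OF embedding]] card_base by simp
    thus "card (range \<kappa>) = card {x :: 'l. x ^ q = x}"
      using card_power_fixed_points(2)[OF q_gt_1, where ?'a = 'l]
        card_mono[OF card_power_fixed_points(1)[OF q_gt_1] sub] by simp
  qed
  thus "x ^ q = x \<Longrightarrow> x \<in> range \<kappa>"
    by blast
qed (use frob_base[of _ 1] in auto)

text \<open>Frobenius fixes the coefficients; hence it carries roots to roots.\<close>

lemma poly_frob: "poly (map_poly \<kappa> g) (x ^ q ^ m) = poly (map_poly \<kappa> g) x ^ q ^ m"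
proof (induction g)
  case 0
  show ?case
    using q_gt_1 by simp
next
  case (pCons a g)
  thus ?case
    by (simp add: hom_distribs frob_add power_mult_distrib frob_base)
qed

text \<open>The derivative is the constant \<open>-1\<close>, since \<open>q ^ m\<close> is 0 in the
  field.\<close>

lemma separable_frob_poly: "m > 0 \<Longrightarrow> separable_poly (monom 1 (q ^ m) - monom 1 1 :: 'l poly)"
  unfolding separable_poly_def
  by (rule is_unit_right_imp_coprime)
    (simp add: pderiv_diff pderiv_monom of_nat_q_power del: of_nat_power)

end

section \<open>A primitive element and its minimal polynomial\<close>

locale finite_field_ext_degree = finite_field_ext +
  fixes n :: nat
  assumes degree: "extension_of_degree \<kappa> n"
begin

lemma n_pos: "n > 0"
  using degree unfolding extension_of_degree_def by blast

lemma finite_ext: "finite (UNIV :: 'b set)" and card_ext: "card (UNIV :: 'b set) = q ^ n"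
proof -
  interpret vs: vector_space "ext_scale \<kappa>"
    by unfold_locales (auto simp: ext_scale_def algebra_simps hom_distribs)
  have dim: "vs.dim (UNIV :: 'b set) = n"
    using degree unfolding extension_of_degree_def by blast
  obtain B :: "'b set" where B: "vs.independent B" "vs.span B = UNIV" "card B = n"
    using vs.basis_exists[of UNIV] dim by (metis top.extremum_unique)
  have fin: "finite B"
    using B(3) n_pos by (auto intro: card_ge_0_finite)
  define h where "h u = (\<Sum>b\<in>B. ext_scale \<kappa> (u b) b)" for u
  have "bij_betw h (B \<rightarrow>\<^sub>E UNIV) UNIV"
    unfolding bij_betw_def
  proof
    show "inj_on h (B \<rightarrow>\<^sub>E UNIV)"
    proof (rule inj_onI)
      fix u v assume uv: "u \<in> B \<rightarrow>\<^sub>E UNIV" "v \<in> B \<rightarrow>\<^sub>E UNIV" "h u = h v"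
      hence 0: "(\<Sum>b\<in>B. ext_scale \<kappa> (u b - v b) b) = 0"
        unfolding h_def by (simp add: vs.scale_left_diff_distrib sum_subtractf)
      have "u b - v b = 0" if "b \<in> B" for b
        by (rule vs.independentD[OF B(1) fin subset_refl 0 that])
      thus "u = v"
        using uv by (intro PiE_ext[of u B "\<lambda>_. UNIV" v]) auto
    qed
    have "x \<in> h ` (B \<rightarrow>\<^sub>E UNIV)" for x
    proof -
      have "x \<in> vs.span B"
        using B(2) by simp
      then obtain u where "x = h u"
        unfolding vs.span_finite[OF fin] h_def by auto
      also have "h u = h (restrict u B)"
        unfolding h_def by (intro sum.cong) auto
      finally show ?thesis
        by auto
    qed
    thus "h ` (B \<rightarrow>\<^sub>E UNIV) = UNIV"
      by auto
  qed
  moreover have "card (B \<rightarrow>\<^sub>E (UNIV :: 'a set)) = q ^ n" "finite (B \<rightarrow>\<^sub>E (UNIV :: 'a set))"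
    using fin B(3) card_base by (auto simp: card_PiE finite_PiE)
  ultimately show "finite (UNIV :: 'b set)" "card (UNIV :: 'b set) = q ^ n"
    by (metis bij_betw_finite, metis bij_betw_same_card)
qed

lemma frob_top: "(x :: 'b) ^ q ^ n = x"
  using finite_field_power_card[OF finite_ext] card_ext by metis

text \<open>The fixed fields of the smaller powers of Frobenius are too small to cover the whole field.\<close>

lemma primitive_exists: "\<exists>\<alpha> :: 'b. inj_on (\<lambda>i. \<alpha> ^ q ^ i) {..<n}"
proof -
  let ?F = "\<lambda>d. {x :: 'b. x ^ q ^ d = x}"
  have "card (\<Union>d\<in>{1..<n}. ?F d) \<le> (\<Sum>d\<in>{1..<n}. card (?F d))"
    by (rule card_UN_le) simp
  also have "\<dots> \<le> (\<Sum>d\<in>{1..<n}. q ^ d)"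
    by (intro sum_mono card_power_fixed_points q_pow_gt_1) auto
  also have "\<dots> \<le> (\<Sum>d<n. q ^ d)"
    by (intro sum_mono2) auto
  also have "\<dots> < q ^ n"
    by (rule sum_power_less[OF q_gt_1])
  finally have "(\<Union>d\<in>{1..<n}. ?F d) \<noteq> UNIV"
    using card_ext by auto
  then obtain \<alpha> where "\<alpha> \<notin> (\<Union>d\<in>{1..<n}. ?F d)"
    by blast
  hence \<alpha>: "\<alpha> ^ q ^ d \<noteq> \<alpha>" if "0 < d" "d < n" for d
    using that by auto
  have "i = j" if "i < n" "j < n" "\<alpha> ^ q ^ i = \<alpha> ^ q ^ j" "i \<le> j" for i j
  proof (rule ccontr)
    assume "i \<noteq> j"
    have "(\<alpha> ^ q ^ (j - i)) ^ q ^ i = \<alpha> ^ q ^ i"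
      using that by (simp add: frob_comp)
    hence "\<alpha> ^ q ^ (j - i) = \<alpha>"
      by (rule frob_inj)
    thus False
      using \<alpha>[of "j - i"] that \<open>i \<noteq> j\<close> by simp
  qed
  thus ?thesis
    by (intro exI[of _ \<alpha>] inj_onI) (metis lessThan_iff nle_le)
qed

definition prim :: 'b
  where "prim = (SOME \<alpha>. inj_on (\<lambda>i. \<alpha> ^ q ^ i) {..<n})"

lemma prim_conjugates: "inj_on (\<lambda>i. prim ^ q ^ i) {..<n}"
  unfolding prim_def by (rule someI_ex[OF primitive_exists])

text \<open>A root at \<open>prim\<close> forces roots at its \<open>n\<close> distinct conjugates,
  more than the degree allows.\<close>

lemma small_poly_prim:
  assumes "poly (map_poly \<kappa> g) prim = 0" "degree g < n"
  shows "g = 0"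
proof (rule ccontr)
  assume "g \<noteq> 0"
  hence g: "map_poly \<kappa> g \<noteq> 0"
    by simp
  have "(\<lambda>i. prim ^ q ^ i) ` {..<n} \<subseteq> {x. poly (map_poly \<kappa> g) x = 0}"
    using assms(1) q_gt_1 by (auto simp: poly_frob)
  hence "card ((\<lambda>i. prim ^ q ^ i) ` {..<n}) \<le> card {x. poly (map_poly \<kappa> g) x = 0}"
    by (intro card_mono poly_roots_finite g)
  also have "\<dots> \<le> degree (map_poly \<kappa> g)"
    by (rule card_poly_roots_bound[OF g])
  finally show False
    using assms(2) by (simp add: card_image[OF prim_conjugates])
qed

text \<open>By \<open>small_poly_prim\<close> the \<open>q ^ n\<close> polynomials of degree below
  \<open>n\<close> take distinct values at \<open>prim\<close>, and the field has only
  \<open>q ^ n\<close> elements.\<close>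

lemma prim_generates: "\<exists>g. degree g < n \<and> x = poly (map_poly \<kappa> g) prim"
proof -
  define G where "G c = (\<Sum>i<n. monom (c i) i)" for c :: "nat \<Rightarrow> 'a"
  have deg: "degree (G c) < n" for c
    unfolding G_def using n_pos degree_monom_le order_le_less_trans
    by (intro degree_sum_less) (auto intro: order_le_less_trans[OF degree_monom_le])
  have coeff_G: "coeff (G c) i = c i" if "i < n" for c i
    unfolding G_def using that by (simp add: coeff_sum)
  have "inj_on (\<lambda>c. poly (map_poly \<kappa> (G c)) prim) ({..<n} \<rightarrow>\<^sub>E UNIV)"
  proof (rule inj_onI)
    fix c d assume cd: "c \<in> {..<n} \<rightarrow>\<^sub>E UNIV" "d \<in> {..<n} \<rightarrow>\<^sub>E UNIV"
      "poly (map_poly \<kappa> (G c)) prim = poly (map_poly \<kappa> (G d)) prim"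
    hence "poly (map_poly \<kappa> (G c - G d)) prim = 0"
      by (simp add: hom_distribs)
    hence "G c - G d = 0"
      by (rule small_poly_prim) (intro degree_diff_less deg)
    hence "c i = d i" if "i < n" for i
      using coeff_G[OF that] by (metis eq_iff_diff_eq_0)
    thus "c = d"
      using cd by (intro PiE_ext[of c "{..<n}" "\<lambda>_. UNIV" d]) auto
  qed
  hence "card ((\<lambda>c. poly (map_poly \<kappa> (G c)) prim) ` ({..<n} \<rightarrow>\<^sub>E UNIV)) = card (UNIV :: 'b set)"
    using card_base card_ext by (simp add: card_image card_PiE)
  hence "(\<lambda>c. poly (map_poly \<kappa> (G c)) prim) ` ({..<n} \<rightarrow>\<^sub>E UNIV) = UNIV"
    using finite_ext by (intro card_subset_eq) auto
  then obtain c where "x = poly (map_poly \<kappa> (G c)) prim"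
    by blast
  thus ?thesis
    using deg by blast
qed

lemma min_poly_exists: "\<exists>p. degree p = n \<and> poly (map_poly \<kappa> p) prim = 0"
proof -
  obtain g where g: "degree g < n" "prim ^ n = poly (map_poly \<kappa> g) prim"
    using prim_generates by blast
  have "degree (monom 1 n - g) = n"
    using g(1) degree_add_eq_left[of "- g" "monom 1 n"] by (simp add: degree_monom_eq)
  moreover have "poly (map_poly \<kappa> (monom 1 n - g)) prim = 0"
    using g(2) by (simp add: hom_distribs poly_monom map_poly_monom)
  ultimately show ?thesis by blast
qed

text \<open>Not normalised to be monic: degree \<open>n\<close> and the root \<open>prim\<close>
  already give \<open>min_poly_dvd\<close>.\<close>

definition min_poly :: "'a poly"
  where "min_poly = (SOME p. degree p = n \<and> poly (map_poly \<kappa> p) prim = 0)"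

lemma min_poly: "degree min_poly = n" "poly (map_poly \<kappa> min_poly) prim = 0"
  using someI_ex[OF min_poly_exists] unfolding min_poly_def by blast+

lemma min_poly_nonzero: "min_poly \<noteq> 0"
  using min_poly(1) n_pos by auto

lemma min_poly_dvd:
  assumes "poly (map_poly \<kappa> g) prim = 0"
  shows "min_poly dvd g"
proof -
  have "poly (map_poly \<kappa> (g mod min_poly)) prim =
      poly (map_poly \<kappa> (g - g div min_poly * min_poly)) prim"
    by (simp add: minus_div_mult_eq_mod)
  also have "\<dots> = 0"
    using assms min_poly(2) by (simp add: hom_distribs)
  finally have "g mod min_poly = 0"
    using degree_mod_less'[OF min_poly_nonzero, of g] min_poly(1)
    by (metis small_poly_prim)
  thus ?thesis by blast
qed

end

section \<open>Embeddings and the Frobenius automorphism\<close>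

locale frobenius_setting =
  L: finite_field_ext_degree \<kappa> q n + K: finite_field_ext \<iota> q
  for \<kappa> :: "'k::finite_field \<Rightarrow> 'l::field" and \<iota> :: "'k \<Rightarrow> 's::field" and q n :: nat +
  assumes closure: "separable_closure \<iota>"
begin

abbreviation frob :: "nat \<Rightarrow> 's \<Rightarrow> 's"
  where "frob i x \<equiv> x ^ q ^ i"

abbreviation Emb :: "('l \<Rightarrow> 's) set"
  where "Emb \<equiv> embeddings \<kappa> \<iota>"

text \<open>The closure provides roots of separable polynomials only. Separability is inherited from
  \<open>X ^ (q ^ n) - X\<close>, which vanishes at \<open>prim\<close> and is therefore a multiple
  of \<open>min_poly\<close>.\<close>

lemma min_poly_root_exists: "\<exists>\<beta>. poly (map_poly \<iota> L.min_poly) \<beta> = 0"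
proof -
  have "poly (map_poly \<kappa> (monom 1 (q ^ n) - monom 1 1)) L.prim = 0"
    by (simp add: hom_distribs map_poly_monom poly_monom L.frob_top)
  hence "map_poly \<iota> L.min_poly dvd map_poly \<iota> (monom 1 (q ^ n) - monom 1 1)"
    by (intro K.map_poly_hom.hom_dvd L.min_poly_dvd)
  also have "map_poly \<iota> (monom 1 (q ^ n) - monom 1 1) = monom 1 (q ^ n) - monom 1 1"
    by (simp add: hom_distribs map_poly_monom)
  finally have "separable_poly (map_poly \<iota> L.min_poly)"
    using separable_poly_dvd[OF K.separable_frob_poly[OF L.n_pos]] by blast
  moreover have "degree (map_poly \<iota> L.min_poly) > 0"
    using L.min_poly(1) L.n_pos by simp
  ultimately show ?thesis
    using closure unfolding separable_closure_def by blast
qed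

lemma embedding_exists: "\<exists>\<sigma>. \<sigma> \<in> Emb"
proof -
  obtain \<beta> where \<beta>: "poly (map_poly \<iota> L.min_poly) \<beta> = 0"
    using min_poly_root_exists by blast
  define rep where "rep x = (SOME g. x = poly (map_poly \<kappa> g) L.prim)" for x
  have rep: "x = poly (map_poly \<kappa> (rep x)) L.prim" for x
    unfolding rep_def using L.prim_generates[of x] by (metis (mono_tags, lifting) someI_ex)
  define \<sigma> where "\<sigma> x = poly (map_poly \<iota> (rep x)) \<beta>" for x
  \<comment> \<open>Independence of the chosen representative: two polynomials with the same value
    at \<open>prim\<close> differ by a multiple of \<open>min_poly\<close>, which vanishes at
    \<open>\<beta>\<close>.\<close>
  have \<sigma>: "\<sigma> (poly (map_poly \<kappa> g) L.prim) = poly (map_poly \<iota> g) \<beta>" for g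
  proof -
    let ?h = "rep (poly (map_poly \<kappa> g) L.prim)"
    have "poly (map_poly \<kappa> (?h - g)) L.prim = 0"
      unfolding L.map_poly_hom.hom_minus poly_diff rep[symmetric] by simp
    hence "L.min_poly dvd ?h - g"
      by (rule L.min_poly_dvd)
    hence "map_poly \<iota> L.min_poly dvd map_poly \<iota> (?h - g)"
      by (rule K.map_poly_hom.hom_dvd)
    hence "poly (map_poly \<iota> (?h - g)) \<beta> = 0"
      using \<beta> by (metis dvdE mult_zero_left poly_mult)
    thus ?thesis
      unfolding \<sigma>_def by (simp add: hom_distribs)
  qed
  have "\<sigma> \<in> Emb"
    unfolding embeddings_def field_embedding_def
  proof (intro CollectI conjI allI)
    show "\<sigma> 1 = 1" "\<sigma> (\<kappa> a) = \<iota> a" for a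
      using \<sigma>[of 1] \<sigma>[of "[:a:]"] by (simp_all add: hom_distribs)
    fix x y
    have "\<sigma> (x + y) = \<sigma> (poly (map_poly \<kappa> (rep x + rep y)) L.prim)"
      unfolding L.map_poly_hom.hom_add poly_add rep[symmetric] ..
    also have "\<dots> = \<sigma> x + \<sigma> y"
      unfolding \<sigma> by (simp add: K.map_poly_hom.hom_add \<sigma>_def)
    finally show "\<sigma> (x + y) = \<sigma> x + \<sigma> y" .
    have "\<sigma> (x * y) = \<sigma> (poly (map_poly \<kappa> (rep x * rep y)) L.prim)"
      unfolding L.map_poly_hom.hom_mult poly_mult rep[symmetric] ..
    also have "\<dots> = \<sigma> x * \<sigma> y"
      unfolding \<sigma> by (simp add: K.map_poly_hom.hom_mult \<sigma>_def)
    finally show "\<sigma> (x * y) = \<sigma> x * \<sigma> y" .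
  qed
  thus ?thesis by blast
qed

lemma emb_field_embedding: "\<sigma> \<in> Emb \<Longrightarrow> field_embedding \<sigma>"
  and emb_base: "\<sigma> \<in> Emb \<Longrightarrow> \<sigma> (\<kappa> a) = \<iota> a"
  unfolding embeddings_def by blast+

lemma emb_power:
  assumes "\<sigma> \<in> Emb"
  shows "\<sigma> (x ^ m) = \<sigma> x ^ m"
proof -
  interpret \<sigma>: field_hom \<sigma>
    by (rule field_hom_embedding[OF emb_field_embedding[OF assms]])
  show ?thesis
    by (rule \<sigma>.hom_power)
qed

lemma emb_poly:
  assumes "\<sigma> \<in> Emb"
  shows "\<sigma> (poly (map_poly \<kappa> g) x) = poly (map_poly \<iota> g) (\<sigma> x)"
proof -
  interpret \<sigma>: field_hom \<sigma>
    by (rule field_hom_embedding[OF emb_field_embedding[OF assms]])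
  show ?thesis
    by (induction g)
      (simp_all add: hom_distribs \<sigma>.hom_add \<sigma>.hom_mult emb_base[OF assms])
qed

lemma emb_eqI:
  assumes "\<sigma> \<in> Emb" "\<tau> \<in> Emb" "\<sigma> L.prim = \<tau> L.prim"
  shows "\<sigma> = \<tau>"
proof
  fix x
  obtain g where "x = poly (map_poly \<kappa> g) L.prim"
    using L.prim_generates by blast
  thus "\<sigma> x = \<tau> x"
    using assms by (simp add: emb_poly)
qed

text \<open>Embeddings are numbered by the power of Frobenius that carries a fixed one to them. All
  natural numbers serve as indices, so that exponents simply add (\<open>emb_add\<close>); the
  numbering has period \<open>n\<close> (\<open>emb_n\<close>).\<close>

definition emb :: "nat \<Rightarrow> 'l \<Rightarrow> 's"
  where "emb i = (\<lambda>x. frob i ((SOME \<sigma>. \<sigma> \<in> Emb) x))"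

lemma emb_0_mem: "emb 0 \<in> Emb"
  unfolding emb_def using someI_ex[OF embedding_exists] by simp

lemma emb_eq: "emb i = (\<lambda>x. frob i (emb 0 x))"
  unfolding emb_def by simp

lemma emb_add: "frob i (emb j x) = emb (i + j) x"
  unfolding emb_def by (simp only: K.frob_comp add.commute)

lemma emb_mem: "emb i \<in> Emb"
proof -
  have "field_embedding (frob i \<circ> emb 0)"
    by (rule field_embedding_comp[OF emb_field_embedding[OF emb_0_mem] K.frob_embedding])
  thus ?thesis
    using emb_base[OF emb_0_mem] K.frob_base
    unfolding emb_eq[of i] embeddings_def comp_def by simp
qed

lemma frob_emb_top: "\<sigma> \<in> Emb \<Longrightarrow> frob n (\<sigma> x) = \<sigma> x"
  by (metis L.frob_top emb_power)

lemma emb_n: "emb (i + n) = emb i"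
proof
  fix x
  have "emb (n + i) x = frob n (emb i x)"
    by (simp only: emb_add)
  thus "emb (i + n) x = emb i x"
    using frob_emb_top[OF emb_mem] by (simp add: add.commute)
qed

lemma emb_cyclic_shift: "i < n \<Longrightarrow> emb (cyclic_shift n i) = emb (Suc i)"
  using emb_n[of 0] by (cases "Suc i = n") (auto simp: cyclic_shift_def)

text \<open>The \<open>n\<close> conjugates of \<open>emb 0 L.prim\<close> exhaust the roots of the
  minimal polynomial, and an embedding is determined by its value at \<open>prim\<close>.\<close>

lemma bij_betw_emb: "bij_betw emb {..<n} Emb"
proof -
  have inj: "inj_on (\<lambda>i. emb i L.prim) {..<n}"
  proof (rule inj_onI)
    fix i j assume ij: "i \<in> {..<n}" "j \<in> {..<n}" "emb i L.prim = emb j L.prim"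
    hence "emb 0 (L.prim ^ q ^ i) = emb 0 (L.prim ^ q ^ j)"
      unfolding emb_eq[of i] emb_eq[of j] emb_power[OF emb_0_mem] by simp
    hence "L.prim ^ q ^ i = L.prim ^ q ^ j"
      using injD[OF field_embedding_inj[OF emb_field_embedding[OF emb_0_mem]]] by blast
    thus "i = j"
      using ij L.prim_conjugates by (auto dest: inj_onD)
  qed
  let ?p = "map_poly \<iota> L.min_poly"
  have p: "?p \<noteq> 0"
    using L.min_poly_nonzero by simp
  have root: "poly ?p (\<sigma> L.prim) = 0" if "\<sigma> \<in> Emb" for \<sigma>
    using emb_poly[OF that, of L.min_poly L.prim] L.min_poly(2) emb_base[OF that, of 0]
    by simp
  have "(\<lambda>i. emb i L.prim) ` {..<n} = {x. poly ?p x = 0}"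
  proof (rule card_subset_eq)
    show "finite {x. poly ?p x = 0}"
      by (rule poly_roots_finite[OF p])
    show sub: "(\<lambda>i. emb i L.prim) ` {..<n} \<subseteq> {x. poly ?p x = 0}"
      using root emb_mem by blast
    have "card {x. poly ?p x = 0} \<le> n"
      using card_poly_roots_bound[OF p] L.min_poly(1) by simp
    thus "card ((\<lambda>i. emb i L.prim) ` {..<n}) = card {x. poly ?p x = 0}"
      using card_mono[OF poly_roots_finite[OF p] sub] by (simp add: card_image[OF inj])
  qed
  hence "\<exists>i<n. \<sigma> = emb i" if "\<sigma> \<in> Emb" for \<sigma>
    using root[OF that] emb_eqI[OF that emb_mem] by blast
  hence "emb ` {..<n} = Emb"
    using emb_mem by auto
  moreover have "inj_on emb {..<n}"
    using inj by (auto intro!: inj_onI dest: inj_onD fun_cong)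
  ultimately show ?thesis
    unfolding bij_betw_def by blast
qed

text \<open>All powers of \<open>x\<close> lie in the finite \<open>k\<close>-span of finitely many
  of them, so two iterates of Frobenius agree at \<open>x\<close>; injectivity cancels the smaller
  one.\<close>

lemma algebraic_frob: "\<exists>m>0. frob m x = x"
proof -
  obtain p where p: "separable_poly p" "poly (map_poly \<iota> p) x = 0"
    using closure unfolding separable_closure_def by blast
  have p0: "p \<noteq> 0"
    using p(1) unfolding separable_poly_def by auto
  \<comment> \<open>One more than the degree leaves room for a zero remainder.\<close>
  define d where "d = Suc (degree p)"
  let ?V = "(\<lambda>c. \<Sum>i<d. \<iota> (c i) * x ^ i) ` ({..<d} \<rightarrow>\<^sub>E (UNIV :: 'k set))"
  have "x ^ m \<in> ?V" for m
  proof -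
    let ?r = "monom 1 m mod p"
    have "poly (map_poly \<iota> ?r) x = poly (map_poly \<iota> (monom 1 m - monom 1 m div p * p)) x"
      by (simp add: minus_div_mult_eq_mod)
    also have "\<dots> = x ^ m"
      using p(2) by (simp add: hom_distribs map_poly_monom poly_monom)
    finally have "x ^ m = poly (map_poly \<iota> ?r) x" ..
    also have deg: "degree (map_poly \<iota> ?r) < d"
      using degree_mod_less[OF p0, of "monom 1 m"] unfolding d_def by auto
    have "poly (map_poly \<iota> ?r) x = (\<Sum>i<d. coeff (map_poly \<iota> ?r) i * x ^ i)"
      unfolding poly_altdef
      by (rule sum.mono_neutral_left) (use deg in \<open>auto simp: coeff_eq_0\<close>)
    also have "\<dots> = (\<Sum>i<d. \<iota> (restrict (coeff ?r) {..<d} i) * x ^ i)"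
      by (intro sum.cong) auto
    finally show ?thesis
      by (intro image_eqI[where x = "restrict (coeff ?r) {..<d}"]) (assumption, simp)
  qed
  hence "range (\<lambda>i. frob i x) \<subseteq> ?V"
    by blast
  moreover have "finite ?V"
    by (intro finite_imageI finite_PiE) auto
  ultimately have "finite (range (\<lambda>i. frob i x))"
    using finite_subset by blast
  hence "\<not> inj (\<lambda>i. frob i x)"
    using finite_imageD infinite_UNIV_nat by blast
  then obtain i j where "i < j" "frob i x = frob j x"
    unfolding inj_def by (metis linorder_neqE_nat)
  hence "frob i (frob (j - i) x) = frob i x"
    by (simp add: K.frob_comp)
  hence "frob (j - i) x = x"
    by (rule K.frob_inj)
  thus ?thesis
    using \<open>i < j\<close> by (intro exI[of _ "j - i"]) auto
qed

text \<open>On an infinite field injectivity does not give surjectivity; here an iterate of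
  Frobenius at \<open>x\<close> is a preimage of \<open>x\<close>, by
  \<open>algebraic_frob\<close>.\<close>

lemma frob_galois: "frob 1 \<in> galois_group \<iota>"
proof -
  have "\<exists>y. x = frob 1 y" for x
  proof -
    obtain m where m: "m > 0" "frob m x = x"
      using algebraic_frob by blast
    hence "x = frob 1 (frob (m - 1) x)"
      unfolding K.frob_comp by simp
    thus ?thesis ..
  qed
  hence "surj (frob 1)"
    unfolding surj_def by blast
  moreover have "inj (frob 1)"
    by (rule field_embedding_inj[OF K.frob_embedding])
  ultimately show ?thesis
    unfolding galois_group_def bij_def using K.frob_embedding[of 1] K.frob_base[of _ 1] by blast
qed

text \<open>\<open>\<tau> \<circ> emb 0\<close> is again an embedding, hence some
  \<open>emb i\<close>, and \<open>\<tau>\<close> commutes with powers. One exponent serves the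
  images of all embeddings, but need not describe \<open>\<tau>\<close> on the whole
  closure.\<close>

lemma galois_eq_frob:
  assumes "\<tau> \<in> galois_group \<iota>"
  shows "\<exists>i. \<forall>\<sigma>\<in>Emb. \<forall>x. \<tau> (\<sigma> x) = frob i (\<sigma> x)"
proof -
  have \<tau>: "field_embedding \<tau>" "\<And>a. \<tau> (\<iota> a) = \<iota> a"
    using assms unfolding galois_group_def by auto
  interpret \<tau>: field_hom \<tau>
    by (rule field_hom_embedding[OF \<tau>(1)])
  have "\<tau> \<circ> emb 0 \<in> Emb"
    using field_embedding_comp[OF emb_field_embedding[OF emb_0_mem] \<tau>(1)] \<tau>(2)
      emb_base[OF emb_0_mem] unfolding embeddings_def by simp
  then obtain i where i: "\<tau> \<circ> emb 0 = emb i"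
    using bij_betw_emb unfolding bij_betw_def by blast
  have "\<tau> (emb j x) = frob i (emb j x)" for j x
  proof -
    have "\<tau> (emb j x) = frob j (\<tau> (emb 0 x))"
      unfolding emb_eq[of j] by (rule \<tau>.hom_power)
    also have "\<tau> (emb 0 x) = emb i x"
      using fun_cong[OF i] by simp
    finally show ?thesis
      by (simp only: emb_add add.commute)
  qed
  moreover have "\<exists>j. \<sigma> = emb j" if "\<sigma> \<in> Emb" for \<sigma>
    using that bij_betw_emb unfolding bij_betw_def by blast
  ultimately show ?thesis by metis
qed

text \<open>This places the values of elements of \<open>E\<close> where
  \<open>galois_eq_frob\<close> applies. The image of \<open>L\<close> has \<open>q ^ n\<close>
  elements, as many as there can be fixed points.\<close>

lemma range_emb_0: "x \<in> range (emb 0) \<longleftrightarrow> frob n x = x"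
proof -
  have inj: "inj (emb 0)"
    by (rule field_embedding_inj[OF emb_field_embedding[OF emb_0_mem]])
  have fin: "finite {x :: 's. frob n x = x}" "card {x :: 's. frob n x = x} \<le> q ^ n"
    using card_power_fixed_points[OF K.q_pow_gt_1[OF L.n_pos]] by blast+
  have sub: "range (emb 0) \<subseteq> {x. frob n x = x}"
    using frob_emb_top[OF emb_0_mem] by auto
  have "range (emb 0) = {x. frob n x = x}"
    using card_mono[OF fin(1) sub] fin(2)
    by (intro card_subset_eq fin(1) sub) (simp add: card_image[OF inj] L.card_ext)
  thus ?thesis by blast
qed

end

section \<open>Frobenius acting on subsets of embeddings, and the algebra \<open>E\<close>\<close>

locale subset_setting = frobenius_setting +
  fixes j :: nat
begin

definition act :: "nat \<Rightarrow> ('b \<Rightarrow> 'c) set \<Rightarrow> ('b \<Rightarrow> 'c) set"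
  where "act i = subset_action (frob i)"

abbreviation S :: "('b \<Rightarrow> 'c) set set"
  where "S \<equiv> embedding_subsets j \<kappa> \<iota>"

abbreviation E :: "(('b \<Rightarrow> 'c) set \<Rightarrow> 'c) set"
  where "E \<equiv> etale_algebra \<iota> S subset_action"

lemma finite_Emb: "finite Emb"
  using bij_betw_finite[OF bij_betw_emb] by simp

lemma S_eq: "S = {T. T \<subseteq> Emb \<and> card T = j}"
  unfolding embedding_subsets_def using finite_Emb finite_subset by blast

lemma finite_S: "finite S"
  unfolding S_eq using finite_Emb by simp

lemma card_S: "card S = n choose j"
  unfolding S_eq using n_subsets[OF finite_Emb] bij_betw_same_card[OF bij_betw_emb] by simp

lemma act_add: "act i (act l T) = act (i + l) T"
  unfolding act_def subset_action_def by (simp add: image_image comp_def K.frob_comp add.commute)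

lemma act_n: "T \<in> S \<Longrightarrow> act n T = T"
proof -
  assume T: "T \<in> S"
  have "frob n \<circ> \<sigma> = \<sigma>" if "\<sigma> \<in> T" for \<sigma>
    using T that frob_emb_top unfolding S_eq by (auto simp: comp_def)
  thus ?thesis
    unfolding act_def subset_action_def by (simp cong: image_cong_simp)
qed

lemma act_0 [simp]: "act 0 T = T"
  unfolding act_def subset_action_def by (simp add: comp_def)

lemma act_emb: "act l (emb ` I) = (\<lambda>i. emb (l + i)) ` I"
  unfolding act_def subset_action_def image_image by (intro image_cong refl ext) (simp add: emb_add)

lemma act_mem: "T \<in> S \<Longrightarrow> act i T \<in> S"
proof -
  assume T: "T \<in> S"
  have inj: "inj_on ((\<circ>) (frob i)) T"
  proof (rule inj_onI)
    fix \<sigma> \<tau> assume "frob i \<circ> \<sigma> = frob i \<circ> \<tau>"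
    hence "frob i (\<sigma> x) = frob i (\<tau> x)" for x
      by (metis comp_apply)
    thus "\<sigma> = \<tau>"
      using K.frob_inj by blast
  qed
  have "frob i \<circ> \<sigma> \<in> Emb" if "\<sigma> \<in> T" for \<sigma>
  proof -
    have "\<sigma> \<in> emb ` {..<n}"
      using T that bij_betw_imp_surj_on[OF bij_betw_emb] unfolding S_eq by blast
    then obtain l where "\<sigma> = emb l"
      by blast
    hence "frob i \<circ> \<sigma> = emb (i + l)"
      by (auto simp: emb_add)
    thus ?thesis
      using emb_mem by simp
  qed
  hence "act i T \<subseteq> Emb"
    unfolding act_def subset_action_def by blast
  moreover have "card (act i T) = card T"
    unfolding act_def subset_action_def by (rule card_image[OF inj])
  ultimately show ?thesis
    using T unfolding S_eq by simp
qed

text \<open>Frobenius alone suffices: a Galois element \<open>\<tau>\<close> acts on subsets as some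
  \<open>act i\<close>, and \<open>f T\<close> is fixed by \<open>frob n\<close>, hence lies in the
  image of \<open>emb 0\<close>, where \<open>\<tau>\<close> is the same
  \<open>frob i\<close>.\<close>

lemma E_iff: "f \<in> E \<longleftrightarrow> (\<forall>T. T \<notin> S \<longrightarrow> f T = 0) \<and> (\<forall>T\<in>S. f (act 1 T) = frob 1 (f T))"
proof
  assume "f \<in> E"
  thus "(\<forall>T. T \<notin> S \<longrightarrow> f T = 0) \<and> (\<forall>T\<in>S. f (act 1 T) = frob 1 (f T))"
    using frob_galois unfolding etale_algebra_def act_def by blast
next
  assume f: "(\<forall>T. T \<notin> S \<longrightarrow> f T = 0) \<and> (\<forall>T\<in>S. f (act 1 T) = frob 1 (f T))"
  have iter: "f (act i T) = frob i (f T)" if T: "T \<in> S" for i T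
  proof (induction i)
    case (Suc i)
    have "f (act (Suc i) T) = f (act 1 (act i T))"
      by (simp add: act_add)
    also have "\<dots> = frob 1 (frob i (f T))"
      using f act_mem[OF T, of i] Suc by simp
    finally show ?case
      unfolding K.frob_comp by simp
  qed simp
  have "f (subset_action \<tau> T) = \<tau> (f T)" if \<tau>: "\<tau> \<in> galois_group \<iota>" and T: "T \<in> S" for \<tau> T
  proof -
    obtain i where i: "\<And>\<sigma> x. \<sigma> \<in> Emb \<Longrightarrow> \<tau> (\<sigma> x) = frob i (\<sigma> x)"
      using galois_eq_frob[OF \<tau>] by blast
    have "subset_action \<tau> T = act i T"
      using T i unfolding S_eq act_def subset_action_def
      by (intro image_cong refl ext) (auto simp: comp_def)
    moreover have "frob n (f T) = f T"
      using iter[OF T, of n] act_n[OF T] by simp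
    hence "f T \<in> range (emb 0)"
      using range_emb_0 by blast
    hence "\<tau> (f T) = frob i (f T)"
      using i[OF emb_0_mem] by auto
    ultimately show ?thesis
      using iter[OF T] by simp
  qed
  thus "f \<in> E"
    using f unfolding etale_algebra_def by blast
qed

lemma E_act: "f \<in> E \<Longrightarrow> T \<in> S \<Longrightarrow> f (act i T) = frob i (f T)"
proof (induction i)
  case (Suc i)
  have "f (act (Suc i) T) = f (act 1 (act i T))"
    by (simp add: act_add)
  also have "\<dots> = frob 1 (frob i (f T))"
    using Suc act_mem[of T i] E_iff[of f] by simp
  finally show ?case
    unfolding K.frob_comp by simp
qed simp

text \<open>The sum of the Frobenius translates of \<open>c\<close> times the indicator of
  \<open>T\<close>. Running over \<open>n\<close> steps instead of the orbit keeps it in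
  \<open>E\<close> when \<open>T\<close> recurs earlier than \<open>c\<close> does.\<close>

definition orbit_elt :: "('b \<Rightarrow> 'c) set \<Rightarrow> 'c \<Rightarrow> ('b \<Rightarrow> 'c) set \<Rightarrow> 'c"
  where "orbit_elt T c U = (\<Sum>i<n. if U = act i T then frob i c else 0)"

lemma orbit_elt_mem:
  assumes "T \<in> S" "frob n c = c"
  shows "orbit_elt T c \<in> E"
  unfolding E_iff
proof (intro conjI allI impI ballI)
  fix U assume "U \<notin> S"
  thus "orbit_elt T c U = 0"
    unfolding orbit_elt_def using act_mem[OF assms(1)] by (intro sum.neutral) auto
next
  fix U assume U: "U \<in> S"
  define F where "F i = (if act 1 U = act i T then frob i c else 0)" for i
  have act1: "act 1 U = act 1 V \<longleftrightarrow> U = V" if "V \<in> S" for V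
  proof
    assume "act 1 U = act 1 V"
    hence "act (n - 1) (act 1 U) = act (n - 1) (act 1 V)"
      by simp
    thus "U = V"
      using act_n[OF U] act_n[OF that] L.n_pos by (simp add: act_add)
  qed simp
  have "orbit_elt T c U ^ q ^ 1 = (\<Sum>i<n. (if U = act i T then frob i c else 0) ^ q ^ 1)"
    unfolding orbit_elt_def by (rule K.frob_sum)
  also have "\<dots> = (\<Sum>i<n. F (Suc i))"
  proof (intro sum.cong refl)
    fix i
    have "act 1 U = act (Suc i) T \<longleftrightarrow> U = act i T"
      using act1[OF act_mem[OF assms(1), of i]] by (simp add: act_add)
    thus "(if U = act i T then frob i c else 0) ^ q ^ 1 = F (Suc i)"
      using K.frob_comp[of c i 1] K.q_gt_1 by (simp add: F_def)
  qed
  \<comment> \<open>The shifted sum runs from 1 to \<open>n\<close>; its last term equals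
    \<open>F 0\<close> because \<open>n\<close> is a period of both \<open>T\<close> and
    \<open>c\<close>.\<close>
  also have "\<dots> = (\<Sum>i<n. F i)"
  proof -
    have "F n = F 0"
      using assms act_n[OF assms(1)] by (simp add: F_def)
    thus ?thesis
      using sum.lessThan_Suc[of F n] sum.lessThan_Suc_shift[of F n] by simp
  qed
  finally show "orbit_elt T c (act 1 U) = frob 1 (orbit_elt T c U)"
    by (simp add: orbit_elt_def F_def)
qed

definition pairing :: "(('b \<Rightarrow> 'c) set \<Rightarrow> 'c) \<Rightarrow> (('b \<Rightarrow> 'c) set \<Rightarrow> 'c) \<Rightarrow> 'c"
  where "pairing f g = (\<Sum>T\<in>S. f T * g T)"

lemma pairing_orbit_elt:
  assumes "T \<in> S"
  shows "pairing g (orbit_elt T c) = (\<Sum>i<n. g (act i T) * c ^ q ^ i)"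
proof -
  have "pairing g (orbit_elt T c) = (\<Sum>U\<in>S. \<Sum>i<n. if U = act i T then g U * frob i c else 0)"
    unfolding pairing_def orbit_elt_def sum_distrib_left by (intro sum.cong) auto
  also have "\<dots> = (\<Sum>i<n. \<Sum>U\<in>S. if U = act i T then g U * frob i c else 0)"
    by (rule sum.swap)
  also have "\<dots> = (\<Sum>i<n. g (act i T) * frob i c)"
    using finite_S act_mem[OF assms] by (intro sum.cong refl) (simp add: sum.delta')
  finally show ?thesis .
qed

text \<open>A polynomial in \<open>c\<close> of degree at most \<open>q\<^sup>n\<^sup>-\<^sup>1\<close> cannot vanish on the fixed field of the
  \<open>n\<close>-th power of Frobenius, which has \<open>q\<^sup>n\<close> elements.\<close>

lemma pairing_nondegenerate:
  assumes "\<And>f. f \<in> E \<Longrightarrow> pairing g f = 0" "T \<in> S"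
  shows "g T = 0"
proof -
  define P where "P = (\<Sum>i<n. monom (g (act i T)) (q ^ i))"
  have "poly P c = pairing g (orbit_elt T c)" for c
    unfolding P_def pairing_orbit_elt[OF assms(2)] by (simp add: poly_sum poly_monom)
  hence "poly P (emb 0 x) = 0" for x
    using assms(1)[OF orbit_elt_mem[OF assms(2) frob_emb_top[OF emb_0_mem]]] by simp
  hence roots: "range (emb 0) \<subseteq> {c. poly P c = 0}"
    by blast
  have "P = 0"
  proof (rule ccontr)
    assume P: "P \<noteq> 0"
    have "q ^ n = card (range (emb 0))"
      using card_image[OF field_embedding_inj[OF emb_field_embedding[OF emb_0_mem]]] L.card_ext
      by simp
    also have "\<dots> \<le> card {c. poly P c = 0}"
      by (intro card_mono poly_roots_finite P roots)
    also have "\<dots> \<le> degree P"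
      by (rule card_poly_roots_bound[OF P])
    also have "\<dots> \<le> q ^ (n - 1)"
      unfolding P_def
    proof (rule degree_sum_le)
      fix i assume "i \<in> {..<n}"
      hence "q ^ i \<le> q ^ (n - 1)"
        using K.q_gt_1 by (intro power_increasing) auto
      thus "degree (monom (g (act i T)) (q ^ i)) \<le> q ^ (n - 1)"
        using degree_monom_le order_trans by blast
    qed simp
    also have "\<dots> < q ^ n"
      using K.q_gt_1 L.n_pos by (intro power_strict_increasing) auto
    finally show False by simp
  qed
  \<comment> \<open>Only \<open>i = 0\<close> gives the exponent 1, so the linear coefficient
    isolates \<open>g T\<close>.\<close>
  moreover have "coeff P 1 = (\<Sum>i<n. if i = 0 then g (act i T) else 0)"
    unfolding P_def coeff_sum using K.q_gt_1 by (intro sum.cong) auto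
  hence "coeff P 1 = g T"
    using L.n_pos by simp
  ultimately show ?thesis by simp
qed

end

section \<open>Orthogonal bases of the etale algebra\<close>

lemma sum_fun_apply: "(\<Sum>i\<in>I. f i) x = (\<Sum>i\<in>I. f i x)"
  by (induction I rule: infinite_finite_induct) auto

lemma vector_space_map_scale:
  assumes "field_embedding \<iota>"
  shows "vector_space (map_scale \<iota> :: _ \<Rightarrow> ('t \<Rightarrow> 's::field) \<Rightarrow> _)"
proof -
  interpret field_hom \<iota>
    by (rule field_hom_embedding[OF assms])
  show ?thesis
    by unfold_locales (auto simp: map_scale_def fun_eq_iff algebra_simps hom_distribs)
qed

section \<open>Descent of the pairing to the base field\<close>

context subset_setting
begin

lemma E_outside: "f \<in> E \<Longrightarrow> T \<notin> S \<Longrightarrow> f T = 0"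
  by (simp add: E_iff)

lemma E_zero: "(\<lambda>_. 0) \<in> E"
  using K.q_gt_1 by (simp add: E_iff)

lemma E_add: "f \<in> E \<Longrightarrow> g \<in> E \<Longrightarrow> (\<lambda>T. f T + g T) \<in> E"
  using K.frob_add[of _ _ 1] unfolding E_iff by simp

lemma E_scale: "f \<in> E \<Longrightarrow> (\<lambda>T. \<iota> a * f T) \<in> E"
  using K.frob_base[of a 1] unfolding E_iff by (simp add: power_mult_distrib)

lemma E_mult: "f \<in> E \<Longrightarrow> g \<in> E \<Longrightarrow> (\<lambda>T. f T * g T) \<in> E"
  unfolding E_iff by (simp add: power_mult_distrib)

lemma E_sum: "(\<And>i. i \<in> I \<Longrightarrow> f i \<in> E) \<Longrightarrow> (\<lambda>T. \<Sum>i\<in>I. \<iota> (c i) * f i T) \<in> E"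
proof (induction I rule: infinite_finite_induct)
  case (insert i I)
  thus ?case
    using E_add[OF E_scale[of "f i" "c i"], of "\<lambda>T. \<Sum>i\<in>I. \<iota> (c i) * f i T"] by simp
qed (simp_all add: E_zero)

lemma E_diff: "f \<in> E \<Longrightarrow> g \<in> E \<Longrightarrow> (\<lambda>T. f T - g T) \<in> E"
  using E_add[of f "\<lambda>T. \<iota> (- 1) * g T"] E_scale[of g "- 1"] by (simp add: hom_distribs)

lemma bij_betw_act: "bij_betw (act 1) S S"
proof (rule bij_betw_byWitness[of _ "act (n - 1)"])
  show "\<forall>T\<in>S. act (n - 1) (act 1 T) = T" "\<forall>T\<in>S. act 1 (act (n - 1) T) = T"
    using act_n L.n_pos by (simp_all add: act_add)
qed (use act_mem in auto)

text \<open>Frobenius only permutes the summands, so \<open>frob_fixed\<close> applies.\<close>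

lemma sum_E_base:
  assumes "f \<in> E"
  shows "(\<Sum>T\<in>S. f T) \<in> range \<iota>"
proof -
  have "(\<Sum>T\<in>S. f T) ^ q ^ 1 = (\<Sum>T\<in>S. f T ^ q ^ 1)"
    by (rule K.frob_sum)
  also have "\<dots> = (\<Sum>T\<in>S. f (act 1 T))"
    using assms by (intro sum.cong) (auto simp: E_iff)
  also have "\<dots> = (\<Sum>T\<in>S. f T)"
    by (rule sum.reindex_bij_betw[OF bij_betw_act])
  finally show ?thesis
    using K.frob_fixed by simp
qed

lemma pairing_base: "f \<in> E \<Longrightarrow> g \<in> E \<Longrightarrow> pairing f g \<in> range \<iota>"
  using sum_E_base[OF E_mult] unfolding pairing_def .

lemma pairing_commute: "pairing f g = pairing g f"
  unfolding pairing_def by (simp add: mult.commute)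

lemma pairing_add: "pairing (\<lambda>T. f T + g T) h = pairing f h + pairing g h"
  unfolding pairing_def by (simp add: distrib_right sum.distrib)

lemma pairing_diff: "pairing (\<lambda>T. f T - g T) h = pairing f h - pairing g h"
  unfolding pairing_def by (simp add: left_diff_distrib sum_subtractf)

lemma pairing_sum: "pairing (\<lambda>T. \<Sum>i\<in>I. c i * f i T) h = (\<Sum>i\<in>I. c i * pairing (f i) h)"
  unfolding pairing_def sum_distrib_left sum_distrib_right
  by (subst sum.swap) (simp add: mult.assoc)

section \<open>Orthogonal families and independence over the closure\<close>

definition orthogonal :: "nat \<Rightarrow> (nat \<Rightarrow> ('b \<Rightarrow> 'c) set \<Rightarrow> 'c) \<Rightarrow> bool"
  where "orthogonal r e \<longleftrightarrow> (\<forall>i<r. e i \<in> E \<and> pairing (e i) (e i) \<noteq> 0) \<and>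
    (\<forall>i<r. \<forall>l<r. i \<noteq> l \<longrightarrow> pairing (e i) (e l) = 0)"

lemma orthogonalD:
  assumes "orthogonal r e"
  shows "i < r \<Longrightarrow> e i \<in> E" "i < r \<Longrightarrow> pairing (e i) (e i) \<noteq> 0"
    "i < r \<Longrightarrow> l < r \<Longrightarrow> i \<noteq> l \<Longrightarrow> pairing (e i) (e l) = 0"
  using assms unfolding orthogonal_def by blast+

lemma pairing_orthogonal_sum:
  assumes "orthogonal r e" "l < r"
  shows "pairing (\<lambda>T. \<Sum>i<r. c i * e i T) (e l) = c l * pairing (e l) (e l)"
proof -
  have "pairing (\<lambda>T. \<Sum>i<r. c i * e i T) (e l) = (\<Sum>i<r. if i = l then c i * pairing (e i) (e l) else 0)"
    unfolding pairing_sum using orthogonalD(3)[OF assms(1) _ assms(2)] by (intro sum.cong) auto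
  thus ?thesis
    using assms(2) by simp
qed

definition coord :: "(nat \<Rightarrow> ('b \<Rightarrow> 'c) set \<Rightarrow> 'c) \<Rightarrow> (('b \<Rightarrow> 'c) set \<Rightarrow> 'c) \<Rightarrow> nat \<Rightarrow> 'c"
  where "coord e g i = pairing g (e i) / pairing (e i) (e i)"

text \<open>The Gram-Schmidt remainder, for an arbitrary map \<open>g\<close> and not only for
  elements of \<open>E\<close>; \<open>completeness\<close> applies it to indicator
  functions.\<close>

definition resid :: "nat \<Rightarrow> (nat \<Rightarrow> ('b \<Rightarrow> 'c) set \<Rightarrow> 'c) \<Rightarrow> (('b \<Rightarrow> 'c) set \<Rightarrow> 'c) \<Rightarrow> ('b \<Rightarrow> 'c) set \<Rightarrow> 'c"
  where "resid r e g = (\<lambda>T. g T - (\<Sum>i<r. coord e g i * e i T))"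

lemma coord_base:
  assumes "orthogonal r e" "i < r" "g \<in> E"
  shows "coord e g i \<in> range \<iota>"
proof -
  obtain a b where "pairing g (e i) = \<iota> a" "pairing (e i) (e i) = \<iota> b"
    using pairing_base orthogonalD(1)[OF assms(1,2)] assms(3) by blast
  thus ?thesis
    unfolding coord_def by (metis K.hom_div rangeI)
qed

lemma resid_mem:
  assumes "orthogonal r e" "g \<in> E"
  shows "resid r e g \<in> E"
proof -
  have "\<forall>i<r. \<exists>a. coord e g i = \<iota> a"
    using coord_base[OF assms(1) _ assms(2)] by blast
  then obtain c where c: "\<And>i. i < r \<Longrightarrow> coord e g i = \<iota> (c i)"
    by metis
  have "(\<lambda>T. \<Sum>i<r. \<iota> (c i) * e i T) \<in> E"
    by (rule E_sum) (use orthogonalD(1)[OF assms(1)] in auto)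
  also have "(\<lambda>T. \<Sum>i<r. \<iota> (c i) * e i T) = (\<lambda>T. \<Sum>i<r. coord e g i * e i T)"
    by (intro ext sum.cong) (auto simp: c)
  finally show ?thesis
    unfolding resid_def by (rule E_diff[OF assms(2)])
qed

lemma pairing_resid:
  assumes "orthogonal r e" "l < r"
  shows "pairing (resid r e g) (e l) = 0"
  unfolding resid_def pairing_diff pairing_orthogonal_sum[OF assms]
  using orthogonalD(2)[OF assms] by (simp add: coord_def)

text \<open>Pair with \<open>e i\<close>. The coefficients lie in the closure, so this is
  independence over the closure and not only over \<open>k\<close>.\<close>

lemma independent_orthogonal:
  fixes e
  assumes "orthogonal r e" "\<And>T. (\<Sum>i<r. c i * e i T) = 0" "i < r"
  shows "c i = 0"
proof -
  have "c i * pairing (e i) (e i) = pairing (\<lambda>T. \<Sum>i<r. c i * e i T) (e i)"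
    using pairing_orthogonal_sum[OF assms(1,3)] by simp
  also have "\<dots> = 0"
    unfolding assms(2) pairing_def by simp
  finally show ?thesis
    using orthogonalD(2)[OF assms(1,3)] by simp
qed

text \<open>Maps into the closure, with scalars from the closure: the space in which families are
  counted against the indicator functions.\<close>

interpretation SV: vector_space "map_scale (\<lambda>x :: 'c. x) :: 'c \<Rightarrow> (('b \<Rightarrow> 'c) set \<Rightarrow> 'c) \<Rightarrow> _"
  by (rule vector_space_map_scale) (auto simp: field_embedding_def)

lemma orthogonal_inj: "orthogonal r e \<Longrightarrow> inj_on e {..<r}"
proof (rule inj_onI)
  fix i l assume "orthogonal r e" "i \<in> {..<r}" "l \<in> {..<r}" "e i = e l"
  thus "i = l"
    using orthogonalD(2,3)[of r e i] by (metis lessThan_iff)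
qed

lemma orthogonal_SV_independent:
  assumes "orthogonal r e"
  shows "SV.independent (e ` {..<r})"
proof (rule SV.independent_if_scalars_zero)
  fix u x assume u: "(\<Sum>x\<in>e ` {..<r}. map_scale (\<lambda>x. x) (u x) x) = 0" and x: "x \<in> e ` {..<r}"
  then obtain i where i: "i < r" "x = e i" by auto
  have "(\<Sum>i<r. u (e i) * e i T) = 0" for T
    using fun_cong[OF u, of T]
    unfolding sum.reindex[OF orthogonal_inj[OF assms]] sum_fun_apply by (simp add: map_scale_def)
  thus "u x = 0"
    using independent_orthogonal[OF assms, of "\<lambda>i. u (e i)" i] i by simp
qed simp

definition delta :: "('b \<Rightarrow> 'c) set \<Rightarrow> ('b \<Rightarrow> 'c) set \<Rightarrow> 'c"
  where "delta T = (\<lambda>U. if U = T then 1 else 0)"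

lemma delta_inj: "inj_on delta A"
proof (rule inj_onI)
  fix T U assume "delta T = delta U"
  from fun_cong[OF this, of T] show "T = U"
    by (simp add: delta_def split: if_splits)
qed

lemma delta_SV_independent: "SV.independent (delta ` S)"
proof (rule SV.independent_if_scalars_zero)
  fix u x assume u: "(\<Sum>x\<in>delta ` S. map_scale (\<lambda>x. x) (u x) x) = 0" and x: "x \<in> delta ` S"
  then obtain T where T: "T \<in> S" "x = delta T" by auto
  have "0 = (\<Sum>U\<in>S. u (delta U) * delta U T)"
    using fun_cong[OF u, of T] unfolding sum.reindex[OF delta_inj] sum_fun_apply
    by (simp add: map_scale_def)
  also have "\<dots> = (\<Sum>U\<in>S. if U = T then u (delta U) else 0)"
    by (intro sum.cong) (auto simp: delta_def)
  finally show "u x = 0"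
    using T finite_S by simp
qed (use finite_S in simp)

lemma delta_expand:
  assumes "\<And>T. T \<notin> S \<Longrightarrow> g T = 0"
  shows "g = (\<Sum>T\<in>S. map_scale (\<lambda>x. x) (g T) (delta T))"
proof
  fix U
  have "(\<Sum>T\<in>S. map_scale (\<lambda>x. x) (g T) (delta T)) U = (\<Sum>T\<in>S. if T = U then g T else 0)"
    unfolding sum_fun_apply map_scale_def delta_def by (intro sum.cong) auto
  thus "g U = (\<Sum>T\<in>S. map_scale (\<lambda>x. x) (g T) (delta T)) U"
    using assms finite_S by simp
qed

lemma orthogonal_bound:
  assumes "orthogonal r e"
  shows "r \<le> card S"
proof -
  have "e ` {..<r} \<subseteq> SV.span (delta ` S)"
  proof
    fix x assume "x \<in> e ` {..<r}"
    hence "x \<in> E"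
      using orthogonalD(1)[OF assms] by auto
    hence "x = (\<Sum>T\<in>S. map_scale (\<lambda>x. x) (x T) (delta T))"
      by (intro delta_expand E_outside)
    also have "\<dots> \<in> SV.span (delta ` S)"
      by (intro SV.span_sum SV.span_scale SV.span_base imageI)
    finally show "x \<in> SV.span (delta ` S)" .
  qed
  hence "card (e ` {..<r}) \<le> card (delta ` S)"
    using SV.independent_span_bound[OF _ orthogonal_SV_independent[OF assms]] finite_S by blast
  thus ?thesis
    by (simp add: card_image orthogonal_inj[OF assms] delta_inj)
qed

lemma orthogonal_extend:
  assumes "orthogonal r e" "z \<in> E" "pairing z z \<noteq> 0" "\<And>l. l < r \<Longrightarrow> pairing z (e l) = 0"
  shows "orthogonal (Suc r) (e(r := z))"
proof -
  have "pairing (e l) z = 0" if "l < r" for l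
    using assms(4)[OF that] pairing_commute by metis
  thus ?thesis
    unfolding orthogonal_def less_Suc_eq using assms orthogonalD[OF assms(1)] by auto
qed

text \<open>The bound \<open>card S\<close> lets a longest family be chosen outright, in place of an
  inductive construction of a basis.\<close>

lemma maximal_orthogonal_exists:
  "\<exists>r e. orthogonal r e \<and> (\<forall>e'. \<not> orthogonal (Suc r) e')"
proof -
  define R where "R = (GREATEST r. \<exists>e. orthogonal r e)"
  have "\<exists>e. orthogonal 0 e"
    by (simp add: orthogonal_def)
  hence "\<exists>e. orthogonal R e"
    unfolding R_def using orthogonal_bound
    by (intro GreatestI_nat[of "\<lambda>r. \<exists>e. orthogonal r e" _ "card S"]) auto
  moreover have "\<not> orthogonal (Suc R) e'" for e'
    using Greatest_le_nat[of "\<lambda>r. \<exists>e. orthogonal r e" "Suc R" "card S"] orthogonal_bound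
    unfolding R_def by fastforce
  ultimately show ?thesis by blast
qed

end

section \<open>A longest orthogonal family is a basis\<close>

locale orthogonal_setting = subset_setting +
  fixes r :: nat and e
  assumes odd_q: "odd q" and orth: "orthogonal r e" and maximal: "\<And>e'. \<not> orthogonal (Suc r) e'"
begin

text \<open>By maximality, every element of \<open>E\<close> orthogonal to all \<open>e i\<close> is
  isotropic. As 2 is invertible, polarisation makes the pairing of any two residues zero, which
  contradicts non-degeneracy if one of them is nonzero.\<close>

lemma resid_E:
  assumes "g \<in> E"
  shows "resid r e g T = 0"
proof (rule ccontr)
  assume *: "resid r e g T \<noteq> 0"
  let ?x = "resid r e g"
  have x: "?x \<in> E"
    by (rule resid_mem[OF orth assms])
  have aniso: "pairing z z = 0" if "z \<in> E" "\<And>l. l < r \<Longrightarrow> pairing z (e l) = 0" for z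
    using orthogonal_extend[OF orth that(1) _ that(2)] maximal by blast
  have "T \<in> S"
    using * E_outside[OF x] by blast
  then obtain y where y: "y \<in> E" "pairing ?x y \<noteq> 0"
    using pairing_nondegenerate[of ?x T] * by blast
  let ?y = "resid r e y"
  have y': "?y \<in> E"
    by (rule resid_mem[OF orth y(1)])
  \<comment> \<open>Passing from \<open>y\<close> to its residue does not change the pairing,
    because \<open>?x\<close> is orthogonal to every \<open>e i\<close>.\<close>
  have "pairing ?x ?y = pairing ?y ?x"
    by (rule pairing_commute)
  also have "\<dots> = pairing y ?x - (\<Sum>i<r. coord e y i * pairing (e i) ?x)"
    by (simp only: resid_def[of r e y] pairing_diff pairing_sum)
  also have "\<dots> = pairing ?x y"
    using pairing_resid[OF orth] by (simp add: pairing_commute[of _ ?x])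
  finally have xy: "pairing ?x ?y = pairing ?x y" .
  have "pairing (\<lambda>T. ?x T + ?y T) (\<lambda>T. ?x T + ?y T) =
      pairing ?x ?x + 2 * pairing ?x ?y + pairing ?y ?y"
    by (simp add: pairing_add pairing_commute[of _ "\<lambda>T. ?x T + ?y T"] pairing_commute[of ?y ?x])
  moreover have "pairing ?x ?x = 0" "pairing ?y ?y = 0"
    by (intro aniso x y' pairing_resid[OF orth]; assumption)+
  moreover have "pairing (\<lambda>T. ?x T + ?y T) (\<lambda>T. ?x T + ?y T) = 0"
    by (intro aniso E_add x y') (simp add: pairing_add pairing_resid[OF orth])
  ultimately show False
    using xy y(2) K.two_neq_0[OF odd_q] by simp
qed

text \<open>By \<open>resid_E\<close> every element of \<open>E\<close> is a combination of the
  \<open>e i\<close>, so the residue of any map pairs to zero with all of \<open>E\<close>;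
  \<open>pairing_nondegenerate\<close> covers arbitrary maps.\<close>

lemma resid_zero:
  assumes "T \<in> S"
  shows "resid r e g T = 0"
proof (rule pairing_nondegenerate[OF _ assms])
  fix f assume f: "f \<in> E"
  have "f U = (\<Sum>i<r. coord e f i * e i U)" for U
    using resid_E[OF f, of U] by (simp add: resid_def)
  hence "f = (\<lambda>U. \<Sum>i<r. coord e f i * e i U)"
    by blast
  hence "pairing f (resid r e g) = pairing (\<lambda>U. \<Sum>i<r. coord e f i * e i U) (resid r e g)"
    by (rule arg_cong)
  also have "\<dots> = (\<Sum>i<r. coord e f i * pairing (resid r e g) (e i))"
    unfolding pairing_sum by (simp only: pairing_commute)
  finally show "pairing (resid r e g) f = 0"
    using pairing_resid[OF orth] by (simp add: pairing_commute[of f])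
qed

lemma pairing_delta: "T \<in> S \<Longrightarrow> pairing (delta T) g = g T"
proof -
  assume T: "T \<in> S"
  have "pairing (delta T) g = (\<Sum>U\<in>S. if U = T then g U else 0)"
    unfolding pairing_def delta_def by (intro sum.cong) auto
  thus ?thesis
    using T finite_S by simp
qed

text \<open>The expansion of the indicator of \<open>T\<close> in the orthogonal family, evaluated
  at \<open>U\<close>.\<close>

lemma completeness:
  assumes "T \<in> S" "U \<in> S"
  shows "(\<Sum>i<r. e i T * e i U / pairing (e i) (e i)) = (if U = T then 1 else 0)"
  using resid_zero[OF assms(2), of "delta T"]
  unfolding resid_def coord_def pairing_delta[OF assms(1)] by (simp add: delta_def)

interpretation SV: vector_space "map_scale (\<lambda>x :: 'c. x) :: 'c \<Rightarrow> (('b \<Rightarrow> 'c) set \<Rightarrow> 'c) \<Rightarrow> _"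
  by (rule vector_space_map_scale) (auto simp: field_embedding_def)

lemma r_eq: "r = card S"
proof (rule antisym[OF orthogonal_bound[OF orth]])
  have "delta ` S \<subseteq> SV.span (e ` {..<r})"
  proof
    fix x assume "x \<in> delta ` S"
    then obtain T where T: "T \<in> S" "x = delta T" by blast
    have "x U = (\<Sum>i<r. coord e x i * e i U)" for U
    proof (cases "U \<in> S")
      case True
      thus ?thesis
        using resid_zero[of U x] by (simp add: resid_def)
    next
      case False
      hence "e i U = 0" if "i < r" for i
        using E_outside orthogonalD(1)[OF orth that] by blast
      moreover have "x U = 0"
        using False T by (auto simp: delta_def)
      ultimately show ?thesis by simp
    qed
    hence "x = (\<Sum>i<r. map_scale (\<lambda>x. x) (coord e x i) (e i))"
      by (auto simp: sum_fun_apply map_scale_def)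
    also have "\<dots> \<in> SV.span (e ` {..<r})"
      by (intro SV.span_sum SV.span_scale SV.span_base imageI)
    finally show "x \<in> SV.span (e ` {..<r})" .
  qed
  hence "card (delta ` S) \<le> card (e ` {..<r})"
    using SV.independent_span_bound[OF _ delta_SV_independent] by blast
  thus "card S \<le> r"
    using card_image_le[of "{..<r}" e] by (simp add: card_image delta_inj)
qed

end

section \<open>Traces and diagonal forms\<close>

lemma (in vector_space) representation_linear_combination:
  assumes "independent B" "\<And>i. i \<in> I \<Longrightarrow> v i \<in> span B"
  shows "representation B (\<Sum>i\<in>I. a i *s v i) x = (\<Sum>i\<in>I. a i * representation B (v i) x)"
  using assms by (simp add: representation_sum representation_scale span_scale)

text \<open>Both traces equal the double sum obtained by expanding along either basis.\<close>

lemma (in vector_space) trace_basis_independent: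
  assumes B: "independent B" "finite B" and C: "independent C" "finite C" and span: "span B = span C"
    and T: "Vector_Spaces.linear scale scale T" "\<And>x. x \<in> span B \<Longrightarrow> T x \<in> span B"
  shows "(\<Sum>b\<in>B. representation B (T b) b) = (\<Sum>c\<in>C. representation C (T c) c)"
proof -
  interpret T: Vector_Spaces.linear scale scale T
    by (rule T(1))
  let ?rB = "representation B" and ?rC = "representation C"
  have memB: "c \<in> span B" if "c \<in> C" for c
    using span span_base[OF that] by simp
  have memC: "b \<in> span C" if "b \<in> B" for b
    using span span_base[OF that] by simp
  have expC: "x = (\<Sum>c\<in>C. ?rC x c *s c)" if "x \<in> span C" for x
    using sum_representation_eq[OF C(1) that C(2) subset_refl] by simp
  have expB: "x = (\<Sum>b\<in>B. ?rB x b *s b)" if "x \<in> span B" for x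
    using sum_representation_eq[OF B(1) that B(2) subset_refl] by simp
  have 1: "?rB (T b) b = (\<Sum>c\<in>C. ?rC b c * ?rB (T c) b)" if "b \<in> B" for b
  proof -
    have "T b = T (\<Sum>c\<in>C. ?rC b c *s c)"
      using expC[OF memC[OF that]] by simp
    also have "\<dots> = (\<Sum>c\<in>C. ?rC b c *s T c)"
      by (simp add: T.sum T.scale)
    finally show ?thesis
      using T(2) memB by (simp add: representation_linear_combination[OF B(1)])
  qed
  have 2: "?rB (T c) b = (\<Sum>d\<in>C. ?rC (T c) d * ?rB d b)" if "c \<in> C" for b c
  proof -
    have "T c = (\<Sum>d\<in>C. ?rC (T c) d *s d)"
      using expC T(2)[OF memB[OF that]] span by blast
    hence "?rB (T c) b = ?rB (\<Sum>d\<in>C. ?rC (T c) d *s d) b"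
      by (rule arg_cong)
    also have "\<dots> = (\<Sum>d\<in>C. ?rC (T c) d * ?rB d b)"
      using memB by (intro representation_linear_combination[OF B(1)])
    finally show ?thesis .
  qed
  have 3: "(\<Sum>b\<in>B. ?rB d b * ?rC b c) = (if d = c then 1 else 0)" if "c \<in> C" "d \<in> C" for c d
  proof -
    have "(\<Sum>b\<in>B. ?rB d b * ?rC b c) = ?rC (\<Sum>b\<in>B. ?rB d b *s b) c"
      using memC by (intro representation_linear_combination[OF C(1), symmetric])
    also have "\<dots> = ?rC d c"
      using expB[OF memB[OF that(2)]] by simp
    finally show ?thesis
      using representation_basis[OF C(1) that(2)] by auto
  qed
  have "(\<Sum>b\<in>B. ?rB (T b) b) = (\<Sum>b\<in>B. \<Sum>c\<in>C. \<Sum>d\<in>C. ?rC (T c) d * (?rB d b * ?rC b c))"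
    by (intro sum.cong refl) (simp add: 1 2 sum_distrib_left mult_ac)
  also have "\<dots> = (\<Sum>c\<in>C. \<Sum>b\<in>B. \<Sum>d\<in>C. ?rC (T c) d * (?rB d b * ?rC b c))"
    by (rule sum.swap)
  also have "\<dots> = (\<Sum>c\<in>C. \<Sum>d\<in>C. \<Sum>b\<in>B. ?rC (T c) d * (?rB d b * ?rC b c))"
    by (intro sum.cong refl sum.swap)
  also have "\<dots> = (\<Sum>c\<in>C. \<Sum>d\<in>C. if d = c then ?rC (T c) d else 0)"
    unfolding sum_distrib_left[symmetric] by (intro sum.cong refl) (simp add: 3)
  also have "\<dots> = (\<Sum>c\<in>C. ?rC (T c) c)"
    using C(2) by simp
  finally show ?thesis .
qed

section \<open>Classes of diagonal forms\<close>

definition diag_coord_form :: "nat \<Rightarrow> (nat \<Rightarrow> 'k::field) \<Rightarrow> 'k coord_form"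
  where "diag_coord_form r a = (r, \<lambda>x y. \<Sum>i<r. a i * x i * y i)"

lemma gw_of_add: "gw_of (A + B) = gw_of A + gw_of B"
  unfolding gw_of_def by (simp add: plus_gw.abs_eq)

lemma gw_of_0: "gw_of 0 = 0"
  unfolding gw_of_def by (simp add: zero_gw.abs_eq)

lemma nondeg_form_unary:
  assumes "a \<noteq> 0"
  shows "nondeg_form (1, \<lambda>x y. a * x 0 * y 0)"
proof -
  have "x = 0" if "x \<in> coord_space 1" "\<forall>y\<in>coord_space 1. a * x 0 * y 0 = 0" for x :: "nat \<Rightarrow> 'a"
  proof -
    have "a * x 0 * std_vec 0 0 = 0"
      by (rule bspec[OF that(2)]) simp
    hence "x i = 0" for i
      using that(1) assms by (cases i) (auto simp: coord_space_def std_vec_def)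
    thus ?thesis by auto
  qed
  thus ?thesis
    by (auto simp: nondeg_form_def symmetric_bilinear_def nondegenerate_def coord_scale_def
        algebra_simps)
qed

lemma diag_form_eq:
  assumes "a \<noteq> 0"
  shows "diag_form a = gw_of (abs_form_class (1, \<lambda>x y. a * x 0 * y 0))"
proof -
  let ?f = "\<lambda>x :: 'a. \<lambda>i :: nat. if i = 0 then x else 0"
  have "isometry (*) UNIV (\<lambda>x y. a * x * y) coord_scale (coord_space 1) (\<lambda>x y. a * x 0 * y 0) ?f"
    unfolding isometry_def
  proof (intro conjI ballI allI)
    show "bij_betw ?f UNIV (coord_space 1)"
      by (rule bij_betw_byWitness[of _ "\<lambda>x. x 0"]) (auto simp: coord_space_def fun_eq_iff)
  qed (auto simp: coord_scale_def)
  thus ?thesis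
    unfolding diag_form_def
    by (intro gw_class_eqI nondeg_form_unary assms) (auto simp: isometric_def)
qed

lemma diag_coord_form_Suc:
  "diag_coord_form (Suc r) a = orth_sum (diag_coord_form r a) (1, \<lambda>x y. a r * x 0 * y 0)"
  by (auto simp: diag_coord_form_def trunc_vec_def shift_vec_def fun_eq_iff)

lemma diag_coord_form:
  assumes "\<And>i. i < r \<Longrightarrow> a i \<noteq> 0"
  shows "nondeg_form (diag_coord_form r a)"
    and "gw_of (abs_form_class (diag_coord_form r a)) = (\<Sum>i<r. diag_form (a i))"
proof -
  have "nondeg_form (diag_coord_form r a) \<and>
      gw_of (abs_form_class (diag_coord_form r a)) = (\<Sum>i<r. diag_form (a i))"
    using assms
  proof (induction r)
    case 0
    have "diag_coord_form 0 a = (0, \<lambda>_ _. 0)"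
      by (simp add: diag_coord_form_def)
    thus ?case
      using nondeg_form_zero gw_of_0 by (simp add: zero_form_class.abs_eq)
  next
    case (Suc r)
    have nd: "nondeg_form (diag_coord_form r a)" "nondeg_form (1, \<lambda>x y. a r * x 0 * y 0)"
      using Suc.IH Suc.prems nondeg_form_unary[of "a r"] by simp_all
    hence "abs_form_class (diag_coord_form (Suc r) a) =
        abs_form_class (diag_coord_form r a) + abs_form_class (1, \<lambda>x y. a r * x 0 * y 0)"
      unfolding diag_coord_form_Suc
        by (intro plus_form_class.abs_eq[symmetric]) (simp_all only: form_rel_refl)
    moreover have "nondeg_form (diag_coord_form (Suc r) a)"
      unfolding diag_coord_form_Suc by (rule nondeg_form_orth_sum[OF nd])
    ultimately show ?case
      using Suc by (simp add: gw_of_add diag_form_eq)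
  qed
  thus "nondeg_form (diag_coord_form r a)"
    "gw_of (abs_form_class (diag_coord_form r a)) = (\<Sum>i<r. diag_form (a i))"
    by blast+
qed

lemma diag_coord_form_isometricI:
  assumes "\<And>i. i < r \<Longrightarrow> a i \<noteq> 0" "\<And>i. i < r \<Longrightarrow> b i \<noteq> 0"
    and "isometry coord_scale (coord_space r) (snd (diag_coord_form r a)) coord_scale (coord_space r)
      (snd (diag_coord_form r b)) \<phi>"
  shows "(\<Sum>i<r. diag_form (a i)) = (\<Sum>i<r. diag_form (b i))"
proof -
  have "form_rel (diag_coord_form r a) (diag_coord_form r b)"
    unfolding form_rel_def isometric_def
    using assms(3) diag_coord_form(1)[of r a] diag_coord_form(1)[of r b] assms(1,2)
    by (auto simp: diag_coord_form_def)
  hence "abs_form_class (diag_coord_form r a) = abs_form_class (diag_coord_form r b)"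
    using Quotient3_form_class unfolding Quotient3_def by blast
  thus ?thesis
    using diag_coord_form(2)[of r a] diag_coord_form(2)[of r b] assms(1,2) by simp
qed

lemma diag_form_mult_square:
  assumes "a \<noteq> 0" "c \<noteq> 0"
  shows "diag_form (a * c ^ 2) = diag_form a"
proof -
  have "isometry coord_scale (coord_space 1) (snd (diag_coord_form 1 (\<lambda>_. a * c ^ 2)))
      coord_scale (coord_space 1) (snd (diag_coord_form 1 (\<lambda>_. a))) (coord_scale c)"
    unfolding isometry_def
  proof (intro conjI ballI allI)
    show "bij_betw (coord_scale c) (coord_space 1) (coord_space 1)"
      by (rule bij_betw_byWitness[of _ "coord_scale (1 / c)"])
        (use assms(2) in \<open>auto simp: coord_scale_def coord_space_def\<close>)
  qed (auto simp: coord_scale_def diag_coord_form_def algebra_simps power2_eq_square)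
  from diag_coord_form_isometricI[OF _ _ this] assms show ?thesis
    by simp
qed

text \<open>Read pairs as complex numbers over the field: \<open>?f\<close> multiplies by the number
  \<open>(x, y)\<close> of norm \<open>\<mu>\<close>, which scales the norm form by
  \<open>\<mu>\<close>.\<close>

lemma diag_form_sum_two_squares:
  assumes "\<mu> = x ^ 2 + y ^ 2" "\<mu> \<noteq> 0"
  shows "2 * diag_form \<mu> = 2"
proof -
  let ?f = "\<lambda>v i. if i = 0 then x * v 0 - y * v 1 else if i = Suc 0 then y * v 0 + x * v 1 else 0"
  \<comment> \<open>The inverse: multiplication by the conjugate \<open>(x, - y)\<close>, divided by
    the norm.\<close>
  let ?g = "\<lambda>v i. if i = 0 then (x * v 0 + y * v 1) / \<mu>
    else if i = Suc 0 then (x * v 1 - y * v 0) / \<mu> else 0"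
  have "isometry coord_scale (coord_space 2) (snd (diag_coord_form 2 (\<lambda>_. \<mu>)))
      coord_scale (coord_space 2) (snd (diag_coord_form 2 (\<lambda>_. 1))) ?f"
    unfolding isometry_def
  proof (intro conjI ballI allI)
    have 2: "i = 0 \<or> i = Suc 0 \<or> i \<ge> 2" for i :: nat
      by auto
    have gf: "(x * (x * s - y * t) + y * (y * s + x * t)) / \<mu> = s"
      "(x * (y * s + x * t) - y * (x * s - y * t)) / \<mu> = t" for s t
      using assms(2) unfolding assms(1) by (simp_all add: field_simps power2_eq_square)
    have fg: "x * ((x * s + y * t) / \<mu>) - y * ((x * t - y * s) / \<mu>) = s"
      "y * ((x * s + y * t) / \<mu>) + x * ((x * t - y * s) / \<mu>) = t" for s t
    proof -
      have "x * ((x * s + y * t) / \<mu>) - y * ((x * t - y * s) / \<mu>) = s * (x ^ 2 + y ^ 2) / \<mu>"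
        "y * ((x * s + y * t) / \<mu>) + x * ((x * t - y * s) / \<mu>) = t * (x ^ 2 + y ^ 2) / \<mu>"
        by (simp_all add: diff_divide_distrib[symmetric] add_divide_distrib[symmetric]
            algebra_simps power2_eq_square)
      thus "x * ((x * s + y * t) / \<mu>) - y * ((x * t - y * s) / \<mu>) = s"
        "y * ((x * s + y * t) / \<mu>) + x * ((x * t - y * s) / \<mu>) = t"
        using assms by simp_all
    qed
    show "bij_betw ?f (coord_space 2) (coord_space 2)"
    proof (rule bij_betw_byWitness[of _ ?g])
      show "\<forall>v\<in>coord_space 2. ?g (?f v) = v"
        using 2 gf by (fastforce simp: coord_space_def)
      show "\<forall>v\<in>coord_space 2. ?f (?g v) = v"
        using 2 fg by (fastforce simp: coord_space_def)
    qed (auto simp: coord_space_def)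
  next
    fix v w :: "nat \<Rightarrow> 'a"
    show "snd (diag_coord_form 2 (\<lambda>_. 1)) (?f v) (?f w) = snd (diag_coord_form 2 (\<lambda>_. \<mu>)) v w"
      by (simp add: diag_coord_form_def numeral_2_eq_2 assms(1) algebra_simps power2_eq_square)
  qed (auto simp: coord_scale_def algebra_simps)
  from diag_coord_form_isometricI[OF _ _ this] assms(2) show ?thesis
    by (simp add: numeral_2_eq_2 diag_form_one)
qed

section \<open>Squares in a finite field of odd order\<close>

context
  assumes odd_card: "odd (card (UNIV :: 'k::finite_field set))"
begin

definition nonzero_squares :: "'k set"
  where "nonzero_squares = (\<lambda>x. x ^ 2) ` (- {0})"

text \<open>Squaring is at most two-to-one; \<open>s\<close> chooses one root of each
  square.\<close>

lemma card_nonzero_squares: "card (UNIV :: 'k set) - 1 \<le> 2 * card nonzero_squares"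
proof -
  define s :: "'k \<Rightarrow> 'k" where "s y = (SOME x. y = x ^ 2)" for y
  have "- {0} \<subseteq> s ` nonzero_squares \<union> (\<lambda>y. - s y) ` nonzero_squares"
  proof
    fix x :: 'k assume "x \<in> - {0}"
    hence y: "x ^ 2 \<in> nonzero_squares"
      unfolding nonzero_squares_def by blast
    have "x ^ 2 = s (x ^ 2) ^ 2"
      unfolding s_def by (rule someI_ex) blast
    hence "x = s (x ^ 2) \<or> x = - s (x ^ 2)"
      by (simp add: power2_eq_iff)
    thus "x \<in> s ` nonzero_squares \<union> (\<lambda>y. - s y) ` nonzero_squares"
      using y by blast
  qed
  hence "card (- {0 :: 'k}) \<le> card (s ` nonzero_squares \<union> (\<lambda>y. - s y) ` nonzero_squares)"
    by (intro card_mono) auto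
  also have "\<dots> \<le> card (s ` nonzero_squares) + card ((\<lambda>y. - s y) ` nonzero_squares)"
    by (rule card_Un_le)
  also have "\<dots> \<le> card nonzero_squares + card nonzero_squares"
    by (intro add_mono card_image_le) auto
  finally show ?thesis
    by (simp add: Compl_eq_Diff_UNIV card_Diff_singleton)
qed

text \<open>The nonzero squares and their multiples by \<open>\<mu>\<close> are disjoint and each
  make up at least half of the nonzero elements, so together they exhaust them.\<close>

lemma nonsquare_cosets:
  fixes a \<mu> :: 'k
  assumes "a \<noteq> 0" "\<nexists>y. a = y ^ 2" "\<mu> \<noteq> 0" "\<nexists>y. \<mu> = y ^ 2"
  shows "\<exists>c. c \<noteq> 0 \<and> a = \<mu> * c ^ 2"
proof -
  let ?Q = nonzero_squares
  have disj: "?Q \<inter> (*) \<mu> ` ?Q = {}"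
  proof -
    have False if "x \<noteq> 0" "y \<noteq> 0" "x ^ 2 = \<mu> * y ^ 2" for x y
    proof -
      have "\<mu> = (x / y) ^ 2"
        using that by (simp add: field_simps)
      thus False
        using assms(4) by blast
    qed
    thus ?thesis
      unfolding nonzero_squares_def by auto
  qed
  have "inj_on ((*) \<mu>) ?Q"
    using assms(3) by (auto intro!: inj_onI)
  hence "card (?Q \<union> (*) \<mu> ` ?Q) = 2 * card ?Q"
    using disj by (simp add: card_Un_disjoint card_image)
  hence "card (- {0 :: 'k}) \<le> card (?Q \<union> (*) \<mu> ` ?Q)"
    using card_nonzero_squares by (simp add: Compl_eq_Diff_UNIV card_Diff_singleton)
  moreover have "?Q \<union> (*) \<mu> ` ?Q \<subseteq> - {0}"
    using assms(3) unfolding nonzero_squares_def by auto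
  ultimately have "?Q \<union> (*) \<mu> ` ?Q = - {0}"
    by (intro card_seteq) auto
  hence "a \<in> (*) \<mu> ` ?Q"
    using assms(1,2) unfolding nonzero_squares_def by auto
  thus ?thesis
    unfolding nonzero_squares_def by auto
qed

text \<open>Together with 0 the squares fill more than half of the field, so they meet their
  reflection under \<open>s \<mapsto> \<mu> - s\<close>.\<close>

lemma sum_two_squares: "\<exists>x y. (\<mu> :: 'k) = x ^ 2 + y ^ 2"
proof -
  let ?Q = "insert 0 nonzero_squares"
  have "0 \<notin> nonzero_squares"
    unfolding nonzero_squares_def by auto
  hence Q: "2 * card ?Q > card (UNIV :: 'k set)"
    using card_nonzero_squares by simp
  have "?Q \<inter> (\<lambda>s. \<mu> - s) ` ?Q \<noteq> {}"
  proof
    assume "?Q \<inter> (\<lambda>s. \<mu> - s) ` ?Q = {}"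
    moreover have "card ((\<lambda>s. \<mu> - s) ` ?Q) = card ?Q"
      by (intro card_image inj_onI) simp
    ultimately have "card (?Q \<union> (\<lambda>s. \<mu> - s) ` ?Q) = 2 * card ?Q"
      by (subst card_Un_disjoint) auto
    moreover have "card (?Q \<union> (\<lambda>s. \<mu> - s) ` ?Q) \<le> card (UNIV :: 'k set)"
      by (intro card_mono) auto
    ultimately show False
      using Q by linarith
  qed
  then obtain t where t: "t \<in> ?Q" "t \<in> (\<lambda>s. \<mu> - s) ` ?Q"
    by blast
  then obtain s where s: "s \<in> ?Q" "t = \<mu> - s"
    by blast
  have sq: "\<exists>x. u = x ^ 2" if "u \<in> ?Q" for u
    using that unfolding nonzero_squares_def by (auto intro: exI[of _ 0])
  obtain x y where "s = x ^ 2" "t = y ^ 2"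
    using sq[OF s(1)] sq[OF t(1)] by blast
  hence "\<mu> = x ^ 2 + y ^ 2"
    using s(2) by (simp add: algebra_simps)
  thus ?thesis by blast
qed

end

text \<open>A square factor keeps the square class of the product and a non-square factor switches
  it, since by \<open>nonsquare_cosets\<close> two non-squares have a square product.\<close>

lemma even_card_nonsquares_iff:
  fixes a :: "nat \<Rightarrow> 'k::finite_field"
  assumes "odd (card (UNIV :: 'k set))" "\<And>i. i < r \<Longrightarrow> a i \<noteq> 0"
  shows "even (card {i. i < r \<and> (\<nexists>y. a i = y ^ 2)}) \<longleftrightarrow> (\<exists>y. (\<Prod>i<r. a i) = y ^ 2)"
  using assms(2)
proof (induction r)
  case 0
  show ?case by (auto intro: exI[of _ 1])
next
  case (Suc r)
  let ?N = "\<lambda>r. {i. i < r \<and> (\<nexists>y. a i = y ^ 2)}" and ?P = "\<Prod>i<r. a i"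
  have P: "?P \<noteq> 0"
    using Suc.prems by simp
  have ar: "a r \<noteq> 0"
    using Suc.prems by simp
  have IH: "even (card (?N r)) \<longleftrightarrow> (\<exists>y. ?P = y ^ 2)"
    using Suc by simp
  show ?case
  proof (cases "\<exists>y. a r = y ^ 2")
    case True
    then obtain y where y: "a r = y ^ 2" by blast
    have "?N (Suc r) = ?N r"
      using True by (auto simp: less_Suc_eq)
    moreover have "(\<exists>z. ?P * a r = z ^ 2) \<longleftrightarrow> (\<exists>z. ?P = z ^ 2)"
    proof
      assume "\<exists>z. ?P * a r = z ^ 2"
      then obtain z where "?P * y ^ 2 = z ^ 2"
        using y by auto
      hence "?P = (z / y) ^ 2"
        using ar y by (simp add: field_simps)
      thus "\<exists>z. ?P = z ^ 2" ..
    next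
      assume "\<exists>z. ?P = z ^ 2"
      then obtain z where "?P = z ^ 2" ..
      hence "?P * a r = (z * y) ^ 2"
        using y by (simp add: power_mult_distrib)
      thus "\<exists>z. ?P * a r = z ^ 2" ..
    qed
    ultimately show ?thesis
      using IH by simp
  next
    case False
    have "?N (Suc r) = insert r (?N r)"
      using False by (auto simp: less_Suc_eq)
    hence card: "card (?N (Suc r)) = Suc (card (?N r))"
      by simp
    have "(\<exists>z. ?P * a r = z ^ 2) \<longleftrightarrow> \<not> (\<exists>z. ?P = z ^ 2)"
    proof
      assume "\<exists>z. ?P * a r = z ^ 2"
      then obtain z where z: "?P * a r = z ^ 2" ..
      show "\<not> (\<exists>z. ?P = z ^ 2)"
      proof
        assume "\<exists>z. ?P = z ^ 2"
        then obtain w where w: "?P = w ^ 2" ..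
        hence "a r = (z / w) ^ 2"
          using z P by (simp add: field_simps)
        thus False
          using False by blast
      qed
    next
      assume *: "\<not> (\<exists>z. ?P = z ^ 2)"
      then obtain c where "?P = a r * c ^ 2"
        using nonsquare_cosets[OF assms(1) P _ ar] False by blast
      hence "?P * a r = (a r * c) ^ 2"
        by (simp add: power2_eq_square mult_ac)
      thus "\<exists>z. ?P * a r = z ^ 2" ..
    qed
    thus ?thesis
      using IH card by simp
  qed
qed

lemma sum_diag_form:
  fixes a :: "nat \<Rightarrow> 'k::finite_field"
  assumes "odd (card (UNIV :: 'k set))" "\<And>i. i < r \<Longrightarrow> a i \<noteq> 0" "\<mu> \<noteq> 0" "\<nexists>y. \<mu> = y ^ 2"
  shows "(\<Sum>i<r. diag_form (a i)) =
    of_nat r - (1 - diag_form \<mu>) * of_nat (card {i. i < r \<and> (\<nexists>y. a i = y ^ 2)})"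
proof -
  have "diag_form (a i) = 1 - (1 - diag_form \<mu>) * (if \<nexists>y. a i = y ^ 2 then 1 else 0)"
    if i: "i < r" for i
  proof (cases "\<exists>y. a i = y ^ 2")
    case True
    then obtain y where y: "a i = y ^ 2" by blast
    hence "y \<noteq> 0"
      using assms(2)[OF i] by auto
    hence "diag_form (1 * y ^ 2) = 1"
      using diag_form_mult_square[of 1 y] diag_form_one by simp
    thus ?thesis
      using True y by simp
  next
    case False
    then obtain c where "c \<noteq> 0" "a i = \<mu> * c ^ 2"
      using nonsquare_cosets[OF assms(1) assms(2)[OF i] _ assms(3,4)] by blast
    thus ?thesis
      using False diag_form_mult_square[OF assms(3)] by simp
  qed
  hence "(\<Sum>i<r. diag_form (a i)) =
      (\<Sum>i<r. 1 - (1 - diag_form \<mu>) * (if \<nexists>y. a i = y ^ 2 then 1 else 0))"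
    by (intro sum.cong) auto
  also have "\<dots> = of_nat r - (1 - diag_form \<mu>) * (\<Sum>i<r. if \<nexists>y. a i = y ^ 2 then 1 else 0)"
    by (simp add: sum_subtractf sum_distrib_left)
  also have "(\<Sum>i<r. if \<nexists>y. a i = y ^ 2 then 1 else 0 :: 'k gw) =
      of_nat (card {i. i < r \<and> (\<nexists>y. a i = y ^ 2)})"
    by (simp add: sum.If_cases lessThan_def Int_def)
  finally show ?thesis .
qed

lemma diag_form_parity:
  fixes \<mu> :: "'k::finite_field"
  assumes "odd (card (UNIV :: 'k set))" "\<mu> \<noteq> 0" "even z \<longleftrightarrow> even z'"
  shows "(1 - diag_form \<mu>) * of_int z = (1 - diag_form \<mu>) * of_int z'"
proof -
  obtain x y where "\<mu> = x ^ 2 + y ^ 2"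
    using sum_two_squares[OF assms(1)] by blast
  hence "2 * diag_form \<mu> = 2"
    using diag_form_sum_two_squares assms(2) by blast
  hence 0: "(1 - diag_form \<mu>) * 2 = 0"
    by (simp add: algebra_simps)
  obtain k where k: "z - z' = 2 * k"
  proof -
    have "even (z - z')"
      using assms(3) by simp
    thus ?thesis
      using that by (elim dvdE)
  qed
  have "(1 - diag_form \<mu>) * of_int (z - z') = (1 - diag_form \<mu>) * 2 * of_int k"
    unfolding k by (simp only: of_int_mult of_int_numeral mult.assoc)
  also have "\<dots> = 0"
    unfolding 0 by simp
  finally show ?thesis
    by (simp add: algebra_simps)
qed

section \<open>The trace form in the orthogonal basis\<close>

context orthogonal_setting
begin

text \<open>In contrast to \<open>SV\<close>, the scalars come from \<open>k\<close>, as the trace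
  of the algebra requires.\<close>

interpretation KV: vector_space "map_scale \<iota> :: 'a \<Rightarrow> (('b \<Rightarrow> 'c) set \<Rightarrow> 'c) \<Rightarrow> _"
  by (rule vector_space_map_scale[OF K.embedding])

definition base_coord :: "(('b \<Rightarrow> 'c) set \<Rightarrow> 'c) \<Rightarrow> nat \<Rightarrow> 'a"
  where "base_coord g i = inv_into UNIV \<iota> (coord e g i)"

lemma \<iota>_base_coord: "g \<in> E \<Longrightarrow> i < r \<Longrightarrow> \<iota> (base_coord g i) = coord e g i"
  unfolding base_coord_def by (rule f_inv_into_f) (rule coord_base[OF orth])

lemma E_apply:
  assumes "g \<in> E"
  shows "g T = (\<Sum>i<r. \<iota> (base_coord g i) * e i T)"
  using resid_E[OF assms, of T] by (simp add: resid_def \<iota>_base_coord[OF assms])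

lemma E_expand: "g \<in> E \<Longrightarrow> g = (\<Sum>i<r. map_scale \<iota> (base_coord g i) (e i))"
  using E_apply by (auto simp: sum_fun_apply map_scale_def)

lemma span_e: "KV.span (e ` {..<r}) = E"
proof
  have "KV.subspace E"
    unfolding KV.subspace_def
    using E_zero E_add E_scale by (simp add: zero_fun_def plus_fun_def map_scale_def)
  thus "KV.span (e ` {..<r}) \<subseteq> E"
    using orthogonalD(1)[OF orth] by (intro KV.span_minimal) auto
  show "E \<subseteq> KV.span (e ` {..<r})"
  proof
    fix g assume "g \<in> E"
    hence "g = (\<Sum>i<r. map_scale \<iota> (base_coord g i) (e i))"
      by (rule E_expand)
    also have "\<dots> \<in> KV.span (e ` {..<r})"
      by (intro KV.span_sum KV.span_scale KV.span_base imageI)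
    finally show "g \<in> KV.span (e ` {..<r})" .
  qed
qed

lemma independent_e: "KV.independent (e ` {..<r})"
proof (rule KV.independent_if_scalars_zero)
  fix u x assume u: "(\<Sum>x\<in>e ` {..<r}. map_scale \<iota> (u x) x) = 0" and x: "x \<in> e ` {..<r}"
  then obtain i where i: "i < r" "x = e i" by auto
  have "(\<Sum>i<r. \<iota> (u (e i)) * e i T) = 0" for T
    using fun_cong[OF u, of T]
    unfolding sum.reindex[OF orthogonal_inj[OF orth]] sum_fun_apply by (simp add: map_scale_def)
  hence "\<iota> (u (e i)) = 0"
    using independent_orthogonal[OF orth, of "\<lambda>i. \<iota> (u (e i))" i] i by simp
  thus "u x = 0"
    using i by simp
qed simp

lemma representation_e:
  assumes "g \<in> E" "i < r"
  shows "KV.representation (e ` {..<r}) g (e i) = base_coord g i"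
proof -
  let ?rep = "KV.representation (e ` {..<r})"
  have span: "e l \<in> KV.span (e ` {..<r})" if "l < r" for l
    using that by (intro KV.span_base) auto
  have basis: "?rep (e l) (e i) = (if l = i then 1 else 0)" if "l < r" for l
  proof -
    have "e i = e l \<longleftrightarrow> l = i"
      using orthogonal_inj[OF orth] that assms(2) by (auto dest: inj_onD)
    thus ?thesis
      using KV.representation_basis[OF independent_e, of "e l"] that by simp
  qed
  have "?rep g (e i) = ?rep (\<Sum>l<r. map_scale \<iota> (base_coord g l) (e l)) (e i)"
    using E_expand[OF assms(1)] by (rule arg_cong)
  also have "\<dots> = (\<Sum>l<r. base_coord g l * ?rep (e l) (e i))"
    using span by (intro KV.representation_linear_combination[OF independent_e]) auto
  also have "\<dots> = (\<Sum>l<r. if l = i then base_coord g l else 0)"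
    by (intro sum.cong) (auto simp: basis)
  finally show ?thesis
    using assms(2) by simp
qed

text \<open>In the basis \<open>e\<close>, multiplication by \<open>x\<close> has diagonal entries
  \<open>pairing (x * e i) (e i) / pairing (e i) (e i)\<close>. Exchanging the sums over
  \<open>i\<close> and \<open>S\<close> leaves at each \<open>T\<close> a factor that is 1 by
  \<open>completeness\<close>.\<close>

lemma algebra_trace_E:
  assumes x: "x \<in> E"
  shows "\<iota> (algebra_trace (map_scale \<iota>) E x) = (\<Sum>T\<in>S. x T)"
proof -
  let ?C = "e ` {..<r}"
  \<comment> \<open>The basis that \<open>endo_trace\<close> happens to choose; its trace is
    compared with that in \<open>?C\<close>.\<close>
  define B where "B = (SOME B. KV.independent B \<and> KV.span B = E)"
  have B: "KV.independent B" "KV.span B = E"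
    using someI[of "\<lambda>B. KV.independent B \<and> KV.span B = E" ?C] independent_e span_e
    unfolding B_def by blast+
  have "finite B"
    using KV.independent_span_bound[of ?C B] B KV.span_superset[of B] span_e by auto
  moreover have "Vector_Spaces.linear (map_scale \<iota>) (map_scale \<iota>) (\<lambda>z. x * z)"
    by unfold_locales (auto simp: map_scale_def fun_eq_iff algebra_simps)
  moreover have "x * z \<in> E" if "z \<in> E" for z
    using E_mult[OF x that] by (simp add: times_fun_def)
  ultimately have "(\<Sum>b\<in>B. KV.representation B (x * b) b) =
      (\<Sum>c\<in>?C. KV.representation ?C (x * c) c)"
    using B span_e independent_e by (intro KV.trace_basis_independent) auto
  hence "algebra_trace (map_scale \<iota>) E x = (\<Sum>c\<in>?C. KV.representation ?C (x * c) c)"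
    unfolding algebra_trace_def endo_trace_def Let_def B_def .
  also have "\<dots> = (\<Sum>i<r. KV.representation ?C (x * e i) (e i))"
    by (simp add: sum.reindex[OF orthogonal_inj[OF orth]])
  finally have "\<iota> (algebra_trace (map_scale \<iota>) E x) = (\<Sum>i<r. \<iota> (KV.representation ?C (x * e i) (e i)))"
    by (simp add: K.hom_sum)
  also have "\<dots> = (\<Sum>i<r. coord e (x * e i) i)"
  proof (intro sum.cong refl)
    fix i assume "i \<in> {..<r}"
    hence i: "i < r" by simp
    have "x * e i \<in> E"
      using E_mult[OF x orthogonalD(1)[OF orth i]] by (simp add: times_fun_def)
    thus "\<iota> (KV.representation ?C (x * e i) (e i)) = coord e (x * e i) i"
      using i by (simp add: representation_e \<iota>_base_coord)
  qed
  also have "\<dots> = (\<Sum>i<r. \<Sum>T\<in>S. x T * (e i T * e i T / pairing (e i) (e i)))"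
    unfolding coord_def pairing_def sum_divide_distrib by (simp add: mult.assoc)
  also have "\<dots> = (\<Sum>T\<in>S. x T * (\<Sum>i<r. e i T * e i T / pairing (e i) (e i)))"
    by (subst sum.swap) (simp add: sum_distrib_left)
  also have "\<dots> = (\<Sum>T\<in>S. x T)"
    by (intro sum.cong refl) (simp add: completeness)
  finally show ?thesis .
qed

definition norm_sq :: "nat \<Rightarrow> 'a"
  where "norm_sq i = inv_into UNIV \<iota> (pairing (e i) (e i))"

lemma \<iota>_norm_sq: "i < r \<Longrightarrow> \<iota> (norm_sq i) = pairing (e i) (e i)"
  unfolding norm_sq_def
  by (rule f_inv_into_f) (intro pairing_base orthogonalD(1)[OF orth])

lemma norm_sq_nonzero: "i < r \<Longrightarrow> norm_sq i \<noteq> 0"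
  using \<iota>_norm_sq[of i] orthogonalD(2)[OF orth, of i] by auto

lemma enriched_binomial_eq: "enriched_binomial \<iota> \<kappa> j = (\<Sum>i<r. diag_form (norm_sq i))"
proof -
  let ?b = "\<lambda>x y. algebra_trace (map_scale \<iota>) E (x * y)"
  define \<psi> where "\<psi> v = (\<lambda>T. \<Sum>i<r. \<iota> (v i) * e i T)" for v :: "nat \<Rightarrow> 'a"
  have \<psi>: "\<psi> v \<in> E" for v
    unfolding \<psi>_def using orthogonalD(1)[OF orth] by (intro E_sum) auto
  have coord_\<psi>: "base_coord (\<psi> v) i = v i" if "i < r" for v i
  proof -
    have "coord e (\<psi> v) i = \<iota> (v i)"
      unfolding coord_def \<psi>_def pairing_orthogonal_sum[OF orth that]
      using orthogonalD(2)[OF orth that] by simp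
    thus ?thesis
      using \<iota>_base_coord[OF \<psi>[of v] that] by simp
  qed
  have "isometry coord_scale (coord_space r) (snd (diag_coord_form r norm_sq)) (map_scale \<iota>) E ?b \<psi>"
    unfolding isometry_def
  proof (intro conjI ballI allI)
    show "bij_betw \<psi> (coord_space r) E"
    proof (rule bij_betw_byWitness[of _ "\<lambda>g i. if i < r then base_coord g i else 0"])
      show "\<forall>v\<in>coord_space r. (\<lambda>i. if i < r then base_coord (\<psi> v) i else 0) = v"
        using coord_\<psi> by (auto simp: coord_space_def fun_eq_iff)
      show "\<forall>g\<in>E. \<psi> (\<lambda>i. if i < r then base_coord g i else 0) = g"
        using E_apply by (auto simp: \<psi>_def fun_eq_iff)
    qed (use \<psi> in \<open>auto simp: coord_space_def\<close>)
  next
    fix v w :: "nat \<Rightarrow> 'a" and a :: 'a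
    show "\<psi> (v + w) = \<psi> v + \<psi> w"
      by (simp add: \<psi>_def fun_eq_iff K.hom_add distrib_right sum.distrib)
    show "\<psi> (coord_scale a v) = map_scale \<iota> a (\<psi> v)"
      by (simp add: \<psi>_def fun_eq_iff coord_scale_def map_scale_def K.hom_mult sum_distrib_left mult.assoc)
    have "\<psi> v * \<psi> w \<in> E"
      using E_mult[OF \<psi> \<psi>] by (simp add: times_fun_def)
    hence "\<iota> (?b (\<psi> v) (\<psi> w)) = pairing (\<psi> v) (\<psi> w)"
      by (simp add: algebra_trace_E pairing_def)
    also have "\<dots> = (\<Sum>i<r. \<iota> (v i) * pairing (\<psi> w) (e i))"
      by (simp only: \<psi>_def[of v] pairing_sum pairing_commute[of _ "\<psi> w"])
    also have "\<dots> = (\<Sum>i<r. \<iota> (v i) * (\<iota> (w i) * pairing (e i) (e i)))"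
      by (intro sum.cong refl) (simp add: \<psi>_def pairing_orthogonal_sum[OF orth])
    also have "\<dots> = \<iota> (snd (diag_coord_form r norm_sq) v w)"
      by (simp add: diag_coord_form_def K.hom_sum K.hom_mult \<iota>_norm_sq mult_ac)
    finally show "?b (\<psi> v) (\<psi> w) = snd (diag_coord_form r norm_sq) v w"
      by simp
  qed
  hence "isometric (map_scale \<iota>) E ?b coord_scale (coord_space r) (snd (diag_coord_form r norm_sq))"
    by (intro isometric_sym[of coord_scale]) (auto simp: isometric_def)
  hence "isometric (map_scale \<iota>) E ?b coord_scale (coord_space (fst (diag_coord_form r norm_sq)))
      (snd (diag_coord_form r norm_sq))"
    by (simp add: diag_coord_form_def)
  hence "trace_class (map_scale \<iota>) E = gw_of (abs_form_class (diag_coord_form r norm_sq))"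
    unfolding trace_class_def
  proof (rule gw_class_eqI[rotated])
    show "x + y \<in> E" "map_scale \<iota> a x \<in> E" if "x \<in> E" "y \<in> E" for x y a
      using that E_add E_scale by (simp_all add: plus_fun_def map_scale_def)
  qed (use norm_sq_nonzero in \<open>auto intro: diag_coord_form(1)\<close>)
  thus ?thesis
    unfolding enriched_binomial_def using diag_coord_form(2) norm_sq_nonzero by metis
qed

end

section \<open>The discriminant\<close>

context subset_setting
begin

abbreviation index_sets :: "nat set set"
  where "index_sets \<equiv> {I. I \<subseteq> {..<n} \<and> card I = j}"

lemma bij_betw_index_sets: "bij_betw ((`) emb) index_sets S"
proof -
  have inj: "inj_on emb I" if "I \<subseteq> {..<n}" for I
    using bij_betw_imp_inj_on[OF bij_betw_emb] that by (rule inj_on_subset)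
  have "inj_on ((`) emb) index_sets"
    using inj_on_image_eq_iff[OF bij_betw_imp_inj_on[OF bij_betw_emb]]
    by (intro inj_onI) blast
  moreover have "(`) emb ` index_sets = S"
  proof
    show "(`) emb ` index_sets \<subseteq> S"
      using emb_mem inj by (auto simp: S_eq card_image)
    show "S \<subseteq> (`) emb ` index_sets"
    proof
      fix T assume T: "T \<in> S"
      hence "T \<subseteq> emb ` {..<n}"
        unfolding S_eq bij_betw_imp_surj_on[OF bij_betw_emb] by blast
      then obtain I where "I \<subseteq> {..<n}" "T = emb ` I"
        by (auto simp: subset_image_iff)
      thus "T \<in> (`) emb ` index_sets"
        using T inj[of I] by (auto simp: S_eq card_image)
    qed
  qed
  ultimately show ?thesis
    unfolding bij_betw_def by blast
qed

lemma act_1_index_set: "I \<subseteq> {..<n} \<Longrightarrow> act 1 (emb ` I) = emb ` cyclic_shift n ` I"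
  unfolding act_emb image_image by (intro image_cong refl) (auto simp: emb_cyclic_shift)

end

text \<open>Rows of a matrix are permuted by permutations of an initial segment; numbering
  \<open>A\<close> by \<open>h\<close> conjugates \<open>f\<close> into one, with the same
  sign.\<close>

lemma sign_on_reindex:
  assumes h: "bij_betw h {0..<r} A" and f: "bij_betw f A A"
  shows "\<exists>p. p permutes {0..<r :: nat} \<and> sign p = sign_on A f \<and> (\<forall>i<r. h (p i) = f (h i))"
proof -
  have fin: "finite A"
    using bij_betw_finite[OF h] by simp
  have c: "restrict_id f A permutes A"
    by (rule permutes_restrict_id[OF f])
  define h' where "h' = inv_into {0..<r} h"
  have h': "bij_betw h' A {0..<r}"
    unfolding h'_def by (rule bij_betw_inv_into[OF h])
  define p where "p = map_permutation A h' (restrict_id f A)"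
  have "p permutes {0..<r}"
    unfolding p_def by (rule map_permutation_permutes[OF h' c])
  moreover have "sign p = sign_on A f"
    unfolding p_def sign_map_permutation[OF bij_betw_imp_inj_on[OF h'] c fin] sign_on_def ..
  moreover have "h (p i) = f (h i)" if i: "i < r" for i
  proof -
    have hi: "h i \<in> A"
      using bij_betwE[OF h] i by auto
    have "h' (h i) = i"
      unfolding h'_def using bij_betw_inv_into_left[OF h] i by simp
    hence "p i = h' (f (h i))"
      using map_permutation_apply[OF bij_betw_imp_inj_on[OF h'] hi, of "restrict_id f A"] hi
      unfolding p_def by simp
    moreover have "f (h i) \<in> A"
      using bij_betwE[OF f] hi by blast
    ultimately show ?thesis
      unfolding h'_def using bij_betw_inv_into_right[OF h] by simp
  qed
  ultimately show ?thesis by blast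
qed

context orthogonal_setting
begin

text \<open>Orthogonality makes the Gram matrix \<open>M\<^sup>T * M\<close> diagonal.\<close>

lemma det_orthogonal:
  assumes T: "bij_betw T {0..<r} S"
  shows "det (mat r r (\<lambda>(i, k). e k (T i))) ^ 2 = \<iota> (\<Prod>i<r. norm_sq i)"
proof -
  define M where "M = mat r r (\<lambda>(i, k). e k (T i))"
  have M: "M \<in> carrier_mat r r"
    by (simp add: M_def)
  have "M\<^sup>T * M = mat r r (\<lambda>(i, k). if i = k then \<iota> (norm_sq i) else 0)"
  proof (rule eq_matI)
    fix i k assume "i < dim_row (mat r r (\<lambda>(i, k). if i = k then \<iota> (norm_sq i) else 0))"
      "k < dim_col (mat r r (\<lambda>(i, k). if i = k then \<iota> (norm_sq i) else 0))"
    hence ik: "i < r" "k < r" by simp_all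
    have "(M\<^sup>T * M) $$ (i, k) = (\<Sum>l\<in>{0..<r}. e i (T l) * e k (T l))"
      using ik by (simp add: M_def scalar_prod_def)
    also have "\<dots> = pairing (e i) (e k)"
      unfolding pairing_def by (rule sum.reindex_bij_betw[OF T])
    also have "\<dots> = (if i = k then \<iota> (norm_sq i) else 0)"
      using orthogonalD(3)[OF orth ik] \<iota>_norm_sq[OF ik(1)] by auto
    finally show "(M\<^sup>T * M) $$ (i, k) = mat r r (\<lambda>(i, k). if i = k then \<iota> (norm_sq i) else 0) $$ (i, k)"
      using ik by simp
  qed (simp_all add: M_def)
  moreover have "det (mat r r (\<lambda>(i, k). if i = k then \<iota> (norm_sq i) else 0)) = \<iota> (\<Prod>i<r. norm_sq i)"
  proof -
    let ?A = "mat r r (\<lambda>(i, k). if i = k then \<iota> (norm_sq i) else 0)"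
    have "det ?A = prod_list (diag_mat ?A)"
      by (rule det_upper_triangular[of _ r]) (auto simp: upper_triangular_def)
    also have "diag_mat ?A = map (\<lambda>i. \<iota> (norm_sq i)) [0..<r]"
      by (simp add: diag_mat_def)
    also have "prod_list \<dots> = (\<Prod>i\<in>{0..<r}. \<iota> (norm_sq i))"
      by (subst prod.distinct_set_conv_list[symmetric]) simp_all
    also have "\<dots> = \<iota> (\<Prod>i<r. norm_sq i)"
      by (simp add: K.hom_prod atLeast0LessThan)
    finally show ?thesis .
  qed
  moreover have "det (M\<^sup>T * M) = det M ^ 2"
    using det_mult[OF transpose_carrier_mat[THEN iffD2, OF M] M] det_transpose[OF M]
    by (simp add: power2_eq_square)
  ultimately show ?thesis
    by (simp add: M_def)
qed

text \<open>The determinant \<open>\<delta>\<close> of the matrix \<open>(e\<^sub>k(T))\<close> satisfies \<open>\<delta>\<^sup>2 = \<Prod>\<^sub>k \<langle>e\<^sub>k, e\<^sub>k\<rangle>\<close>, and Frobenius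
  multiplies it by the sign of its action on \<open>S\<close>. So that product is a square in the base
  field iff the action is even.\<close>

lemma prod_norm_sq_square_iff:
  "(\<exists>y. (\<Prod>i<r. norm_sq i) = y ^ 2) \<longleftrightarrow> sign_on index_sets ((`) (cyclic_shift n)) = 1"
proof -
  have "r = card index_sets"
    using r_eq bij_betw_same_card[OF bij_betw_index_sets] by simp
  then obtain h where h: "bij_betw h {0..<r} index_sets"
    using ex_bij_betw_nat_finite[of index_sets] by auto
  have h_mem: "h i \<in> index_sets" if "i < r" for i
    using bij_betwE[OF h] that by auto
  define T where "T i = emb ` h i" for i
  have T: "bij_betw T {0..<r} S"
    using bij_betw_trans[OF h bij_betw_index_sets] by (simp add: T_def[abs_def] comp_def)
  have T_mem: "T i \<in> S" if "i < r" for i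
    using bij_betwE[OF T] that by auto
  obtain p where p: "p permutes {0..<r}"
    and sign_p: "sign p = sign_on index_sets ((`) (cyclic_shift n))"
    and hp: "\<And>i. i < r \<Longrightarrow> h (p i) = cyclic_shift n ` h i"
    using sign_on_reindex[OF h bij_betw_image_subsets[OF cyclic_shift_permutes]] by blast
  have Tp: "T (p i) = act 1 (T i)" if "i < r" for i
    using act_1_index_set[of "h i"] h_mem[OF that] by (simp add: T_def hp[OF that])

  define M where "M = mat r r (\<lambda>(i, k). e k (T i))"
  have M: "M \<in> carrier_mat r r"
    by (simp add: M_def)
  define \<delta> where "\<delta> = det M"
  let ?d = "\<Prod>i<r. norm_sq i"
  have d: "?d \<noteq> 0"
    using norm_sq_nonzero by simp

  have \<delta>_sq: "\<delta> ^ 2 = \<iota> ?d"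
    unfolding \<delta>_def M_def by (rule det_orthogonal[OF T])
  hence \<delta>: "\<delta> \<noteq> 0"
    using d by auto

  interpret frob: field_hom "\<lambda>x :: 'c. x ^ q"
    using field_hom_embedding[OF K.frob_embedding[of 1]] by simp
  \<comment> \<open>By equivariance, raising the entries to the power \<open>q\<close> turns row
    \<open>i\<close> into row \<open>p i\<close>.\<close>
  have "map_mat (\<lambda>x. x ^ q) M = mat r r (\<lambda>(i, k). M $$ (p i, k))"
  proof (rule eq_matI)
    fix i k assume "i < dim_row (mat r r (\<lambda>(i, k). M $$ (p i, k)))"
      "k < dim_col (mat r r (\<lambda>(i, k). M $$ (p i, k)))"
    hence ik: "i < r" "k < r" by simp_all
    moreover have "p i < r"
      using permutes_in_image[OF p, of i] ik by simp
    moreover have "e k (T (p i)) = e k (T i) ^ q"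
      using E_act[OF orthogonalD(1)[OF orth ik(2)] T_mem[OF ik(1)], of 1] Tp[OF ik(1)] by simp
    ultimately show "map_mat (\<lambda>x. x ^ q) M $$ (i, k) = mat r r (\<lambda>(i, k). M $$ (p i, k)) $$ (i, k)"
      by (simp add: M_def)
  qed (simp_all add: M_def)
  hence \<delta>_frob: "\<delta> ^ q = of_int (sign p) * \<delta>"
    using det_permute_rows[OF M p] frob.hom_det[of M] unfolding \<delta>_def by simp
  show ?thesis
    unfolding sign_p[symmetric]
  proof
    assume "\<exists>y. ?d = y ^ 2"
    then obtain y where "?d = y ^ 2" ..
    hence "\<delta> ^ 2 = \<iota> y ^ 2"
      using \<delta>_sq by (simp add: K.hom_power)
    hence "\<delta> = \<iota> y \<or> \<delta> = \<iota> (- y)"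
      by (simp add: power2_eq_iff K.hom_uminus)
    hence "\<delta> ^ q = \<delta>"
      using K.frob_fixed by blast
    hence "of_int (sign p) = (1 :: 'c)"
      using \<delta>_frob \<delta> by simp
    \<comment> \<open>The sign is known only as an element of the closure; in odd characteristic 1
      and -1 remain distinct there.\<close>
    moreover have "- 1 \<noteq> (1 :: 'c)"
      using K.two_neq_0[OF odd_q] by (metis add.inverse_inverse add_eq_0_iff one_add_one)
    ultimately show "sign p = 1"
      by (cases p rule: sign_cases) auto
  next
    assume "sign p = 1"
    hence "\<delta> \<in> range \<iota>"
      using \<delta>_frob K.frob_fixed by simp
    then obtain y where "\<delta> = \<iota> y" by blast
    hence "\<iota> ?d = \<iota> (y ^ 2)"
      using \<delta>_sq by (simp add: K.hom_power)
    thus "\<exists>y. ?d = y ^ 2"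
      by auto
  qed
qed

end

section \<open>Parity of the binomial coefficient with halved arguments\<close>

lemma rat_binomial_of_nat: "rat_binomial (of_nat m) (of_nat l) = int (m choose l)"
  unfolding rat_binomial_def by (simp flip: binomial_gbinomial)

lemma rat_half_Ints_iff: "(of_int z / 2 :: rat) \<in> \<int> \<longleftrightarrow> even z"
proof
  assume "(of_int z / 2 :: rat) \<in> \<int>"
  then obtain w where "of_int z / 2 = (of_int w :: rat)"
    by (auto elim: Ints_cases)
  hence "(of_int z :: rat) = of_int (2 * w)"
    by (simp add: field_simps)
  thus "even z"
    by (simp only: of_int_eq_iff) simp
qed (auto elim!: evenE)

text \<open>The sign is \<open>-1\<close> to the power \<open>(n - 1) * ?D\<close>. This exponent is
  even unless \<open>n\<close> is even and \<open>j\<close> is odd, which is exactly when both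
  halves are integers. There \<open>n - 1\<close> is odd, and halving both arguments of the binomial
  coefficient preserves its parity.\<close>

lemma even_rat_binomial_iff:
  assumes "n \<ge> 1"
  shows "even (rat_binomial ((of_nat n - 2) / 2) ((of_nat j - 1) / 2)) \<longleftrightarrow>
    sign_on {I. I \<subseteq> {..<n} \<and> card I = j} ((`) (cyclic_shift n)) = 1"
proof -
  let ?b = "rat_binomial ((of_nat n - 2) / 2) ((of_nat j - 1) / 2)"
  let ?D = "if j = 0 then 0 else (n - 2) choose (j - 1)"
  have "sign_on {I. I \<subseteq> {..<n} \<and> card I = j} ((`) (cyclic_shift n)) = ((-1) ^ (n - 1)) ^ ?D"
    using sign_on_subsets[OF _ cyclic_shift_permutes, of n j] sign_cyclic_shift[of n] assms by simp
  \<comment> \<open>For \<open>n = 1\<close> the truncation of \<open>n - 2\<close> is harmless, as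
    the factor \<open>n - 1\<close> is 0.\<close>
  also have "\<dots> = 1 \<longleftrightarrow> even ((n - 1) * ?D)"
    unfolding power_mult[symmetric] by (simp add: minus_one_power_iff)
  also have "\<dots> \<longleftrightarrow> even ?b"
  proof (cases "even n \<and> odd j")
    case True
    then obtain m' l where "n = 2 * m'" and l: "j = 2 * l + 1"
      by (auto elim!: evenE oddE)
    moreover obtain m where "m' = Suc m"
      using assms \<open>n = 2 * m'\<close> by (cases m') auto
    ultimately have ml: "n = 2 * m + 2" "j = 2 * l + 1"
      by simp_all
    have "(of_nat n - 2) / 2 = (of_nat m :: rat)" "(of_nat j - 1) / 2 = (of_nat l :: rat)"
      unfolding ml by simp_all
    hence "?b = int (m choose l)"
      by (simp only: rat_binomial_of_nat)
    moreover have "even ((2 * m) choose (2 * l)) \<longleftrightarrow> even (m choose l)"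
      using even_choose_double[of m "2 * l"] by simp
    ultimately show ?thesis
      by (simp add: ml)
  next
    case False
    have "(of_nat n - 2) / 2 = (of_int (int n - 2) / 2 :: rat)"
      "(of_nat j - 1) / 2 = (of_int (int j - 1) / 2 :: rat)"
      by simp_all
    hence "?b = 0"
      using False rat_half_Ints_iff[of "int n - 2"] rat_half_Ints_iff[of "int j - 1"]
      unfolding rat_binomial_def by auto
    \<comment> \<open>The conventional value 0 has to be matched by an even exponent:
      \<open>n - 1\<close> is even, or \<open>j = 0\<close>, or an even number is chosen from at the
      odd index \<open>j - 1\<close>.\<close>
    moreover have "even ((n - 1) * ?D)"
    proof (cases "even n \<and> j > 0")
      case True
      then obtain m where m: "n = 2 * m" by blast
      hence "n - 2 = 2 * (m - 1)" by simp
      thus ?thesis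
        using True False even_choose_double[of "m - 1" "j - 1"] by simp
    next
      case False
      thus ?thesis
        using assms by auto
    qed
    ultimately show ?thesis by simp
  qed
  finally show ?thesis by blast
qed

theorem theorem1p1:
  fixes \<iota> :: "'k::finite_field \<Rightarrow> 's::field"
    and \<kappa> :: "'k \<Rightarrow> 'l::field"
    and \<mu> :: 'k
    and q n j :: nat
  assumes "primepow q" and "odd q" and "card (UNIV :: 'k set) = q"
    and "separable_closure \<iota>"
    and "n \<ge> 1" and "extension_of_degree \<kappa> n"
    and "\<mu> \<noteq> 0" and "\<nexists>y. \<mu> = y ^ 2"
  shows "enriched_binomial \<iota> \<kappa> j =
    of_nat (n choose j) -
    (1 - diag_form \<mu>) * of_int (rat_binomial ((of_nat n - 2) / 2) ((of_nat j - 1) / 2))"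
proof -
  interpret subset_setting \<kappa> \<iota> q n j
    by unfold_locales (use assms in \<open>auto simp: extension_of_degree_def separable_closure_def\<close>)
  obtain r e where e: "orthogonal r e" "\<And>e'. \<not> orthogonal (Suc r) e'"
    using maximal_orthogonal_exists by blast
  interpret orthogonal_setting \<kappa> \<iota> q n j r e
    by unfold_locales (use assms(2) e in auto)
  let ?N = "{i. i < r \<and> (\<nexists>y. norm_sq i = y ^ 2)}"
  let ?b = "rat_binomial ((of_nat n - 2) / 2) ((of_nat j - 1) / 2)"
  have odd_card: "odd (card (UNIV :: 'k set))"
    using assms(2,3) by simp
  \<comment> \<open>Both parities are read off from the sign of Frobenius on the subsets.\<close>
  have "even (card ?N) \<longleftrightarrow> even ?b"
    using even_card_nonsquares_iff[OF odd_card, of r norm_sq] norm_sq_nonzero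
      prod_norm_sq_square_iff even_rat_binomial_iff[OF assms(5), of j] by blast
  hence "even (int (card ?N)) \<longleftrightarrow> even ?b"
    by simp
  hence "(1 - diag_form \<mu>) * of_int (int (card ?N)) = (1 - diag_form \<mu>) * of_int ?b"
    by (rule diag_form_parity[OF odd_card assms(7)])
  moreover have "enriched_binomial \<iota> \<kappa> j = of_nat r - (1 - diag_form \<mu>) * of_nat (card ?N)"
    unfolding enriched_binomial_eq
    by (rule sum_diag_form[OF odd_card norm_sq_nonzero assms(7,8)])
  ultimately show ?thesis
    by (simp add: r_eq card_S)
qed

end
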